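(* For a $\mu$-complete Tychonoff $k_{\mathbb R}$-space $X$ the following conditions are equivalent: (1) $X$ is a topological sum $K\oplus D$ of a countable $k_\omega$-space $K$ and a discrete space $D$. (2) The free paratopological Abelian group $\mathsf{PA}(X)$ of $X$ is (homeomorphic to) a product $K\times D$ of a countable $k_\omega$-space $K$ and a discrete space $D$. (3) $X$ is an $\aleph_k$-space and $\mathsf{PA}(X)$ contains no strong $\mathrm{Fin}^\omega$-fan and no $\mathrm{Fin}^{\omega_1}$-fan. (4) $X$ is an $\aleph_k$-space and $\mathsf{PA}(X)$ is a $k$-space.
   Context: A paratopological Abelian group is an Abelian group endowed with a topology making the group operation jointly continuous (the inversion need not be continuous). The free paratopological Abelian group of $X$ is a paratopological Abelian group $\mathsf{PA}(X)$ with a continuous map $\delta_X:X\to\mathsf{PA}(X)$ such that for every continuous map $f:X\to Y$ to a paratopological Abelian group $Y$ there is a unique continuous homomorphism $\bar f:\mathsf{PA}(X)\to Y$ with $f=\bar f\circ\delta_X$. A topological sum is a disjoint topological union. "Regular" includes $T_1$. A family $\mathcal N$ of subsets of a space $Y$ is a $k$-network if for each open $U\subset Y$ and compact $K\subset U$ there is a finite $\mathcal F\subset\mathcal N$ with $K\subset\bigcup\mathcal F\subset U$; it is compact-countable if each compact subset of $Y$ meets at most countably many members of $\mathcal N$. An $\aleph_k$-space is a regular space with a compact-countable $k$-network. $Y$ is a $k$-space if $A\subset Y$ is closed whenever $A\cap K$ is closed in $K$ for every compact $K\subset Y$. $Y$ is a $k_\omega$-space if it has a countable cover $\mathcal K$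 by compact subsets such that $F\subset Y$ is closed iff $F\cap K$ is closed in $K$ for all $K\in\mathcal K$. $Y$ is a $k_{\mathbb R}$-space if every function $f:Y\to\mathbb R$ whose restriction to each compact subset of $Y$ is continuous is continuous. A subset $B\subset Y$ is bounded if every locally finite family of open subsets of $Y$ each meeting $B$ is finite; $Y$ is $\mu$-complete if each closed bounded subset of $Y$ is compact. For a cardinal $\lambda$, a family $(F_\alpha)_{\alpha\in\lambda}$ of subsets of $Y$ is locally finite if each point of $Y$ has a neighborhood meeting $F_\alpha$ for only finitely many $\alpha$; it is compact-finite if each compact subset of $Y$ meets $F_\alpha$ for only finitely many $\alpha$. A set $U\subset Y$ is $\mathbb R$-open if for each $y\in U$ there is a continuous $f:Y\to[0,1]$ with $f(y)=1$ and $f(Y\setminus U)\subset\{0\}$. A $\mathrm{Fin}^\lambda$-fan in $Y$ is a family $(F_\alpha)_{\alpha\in\lambda}$ of finite (possibly empty) subsets of $Y$ that is compact-finite but not locally finite; it is strong if each $F_\alpha$ has an $\mathbb R$-open neighborhood $U_\alpha\supset F_\alpha$ such that $(U_\alpha)_{\alpha\in\lambda}$ is compact-finite. *)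

theory Defs
  imports "HOL-Analysis.Analysis" "HOL-Algebra.Free_Abelian_Groups"
begin

section \<open>Classes of topological spaces\<close>

definition Tychonoff_space :: "'a topology \<Rightarrow> bool" where
  "Tychonoff_space Y \<longleftrightarrow> completely_regular_space Y \<and> t1_space Y"

definition k_network :: "'a topology \<Rightarrow> 'a set set \<Rightarrow> bool" where
  "k_network Y \<N> \<longleftrightarrow>
     (\<forall>N\<in>\<N>. N \<subseteq> topspace Y) \<and>
     (\<forall>U K. openin Y U \<and> compactin Y K \<and> K \<subseteq> U \<longrightarrow>
        (\<exists>\<F>. finite \<F> \<and> \<F> \<subseteq> \<N> \<and> K \<subseteq> \<Union>\<F> \<and> \<Union>\<F> \<subseteq> U))"

definition compact_countable :: "'a topology \<Rightarrow> 'a set set \<Rightarrow> bool" where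
  "compact_countable Y \<N> \<longleftrightarrow> (\<forall>K. compactin Y K \<longrightarrow> countable {N \<in> \<N>. N \<inter> K \<noteq> {}})"

text \<open>The library's \<^const>\<open>regular_space\<close> does not include the $T_1$ axiom.\<close>

definition aleph_k_space :: "'a topology \<Rightarrow> bool" where
  "aleph_k_space Y \<longleftrightarrow>
     regular_space Y \<and> t1_space Y \<and> (\<exists>\<N>. k_network Y \<N> \<and> compact_countable Y \<N>)"

definition k_omega_space :: "'a topology \<Rightarrow> bool" where
  "k_omega_space Y \<longleftrightarrow>
     (\<exists>\<K>. countable \<K> \<and> (\<forall>K\<in>\<K>. compactin Y K) \<and> \<Union>\<K> = topspace Y \<and>
        (\<forall>F. F \<subseteq> topspace Y \<longrightarrow>
           (closedin Y F \<longleftrightarrow> (\<forall>K\<in>\<K>. closedin (subtopology Y K) (F \<inter> K)))))"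

definition kR_space :: "'a topology \<Rightarrow> bool" where
  "kR_space Y \<longleftrightarrow>
     (\<forall>f. (\<forall>K. compactin Y K \<longrightarrow> continuous_map (subtopology Y K) euclideanreal f) \<longrightarrow>
          continuous_map Y euclideanreal f)"

definition bounded_in :: "'a topology \<Rightarrow> 'a set \<Rightarrow> bool" where
  "bounded_in Y B \<longleftrightarrow>
     B \<subseteq> topspace Y \<and>
     (\<forall>\<U>. locally_finite_in Y \<U> \<and> (\<forall>U\<in>\<U>. openin Y U \<and> U \<inter> B \<noteq> {}) \<longrightarrow> finite \<U>)"

definition mu_complete :: "'a topology \<Rightarrow> bool" where
  "mu_complete Y \<longleftrightarrow> (\<forall>B. closedin Y B \<and> bounded_in Y B \<longrightarrow> compactin Y B)"


section \<open>Fans\<close>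

text \<open>
  Families are indexed by a set \<open>I\<close>. Local and compact finiteness count indices, not
  members, so the library's \<^const>\<open>locally_finite_in\<close> (on sets of sets) is not applicable.
\<close>

definition locally_finite_family :: "'a topology \<Rightarrow> 'i set \<Rightarrow> ('i \<Rightarrow> 'a set) \<Rightarrow> bool" where
  "locally_finite_family Y I F \<longleftrightarrow>
     (\<forall>y\<in>topspace Y. \<exists>U. openin Y U \<and> y \<in> U \<and> finite {\<alpha> \<in> I. F \<alpha> \<inter> U \<noteq> {}})"

definition compact_finite_family :: "'a topology \<Rightarrow> 'i set \<Rightarrow> ('i \<Rightarrow> 'a set) \<Rightarrow> bool" where
  "compact_finite_family Y I F \<longleftrightarrow>
     (\<forall>K. compactin Y K \<longrightarrow> finite {\<alpha> \<in> I. F \<alpha> \<inter> K \<noteq> {}})"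

definition R_open :: "'a topology \<Rightarrow> 'a set \<Rightarrow> bool" where
  "R_open Y U \<longleftrightarrow>
     U \<subseteq> topspace Y \<and>
     (\<forall>y\<in>U. \<exists>f. continuous_map Y (top_of_set {0..1::real}) f \<and> f y = 1 \<and>
                 f ` (topspace Y - U) \<subseteq> {0})"

definition Fin_fan :: "'a topology \<Rightarrow> 'i set \<Rightarrow> ('i \<Rightarrow> 'a set) \<Rightarrow> bool" where
  "Fin_fan Y I F \<longleftrightarrow>
     (\<forall>\<alpha>\<in>I. finite (F \<alpha>) \<and> F \<alpha> \<subseteq> topspace Y) \<and>
     compact_finite_family Y I F \<and> \<not> locally_finite_family Y I F"

definition strong_Fin_fan :: "'a topology \<Rightarrow> 'i set \<Rightarrow> ('i \<Rightarrow> 'a set) \<Rightarrow> bool" where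
  "strong_Fin_fan Y I F \<longleftrightarrow>
     Fin_fan Y I F \<and>
     (\<exists>U. (\<forall>\<alpha>\<in>I. R_open Y (U \<alpha>) \<and> F \<alpha> \<subseteq> U \<alpha>) \<and> compact_finite_family Y I U)"

text \<open>The underlying set of the cardinal $\omega_1$, realised as the successor of $\omega$.\<close>

definition omega1 :: "nat set set" where
  "omega1 = Field (cardSuc natLeq)"

lemma card_of_omega1: "(card_of omega1, cardSuc natLeq) \<in> ordIso"
  unfolding omega1_def by (rule card_of_Field_ordIso[OF cardSuc_Card_order[OF natLeq_Card_order]])


section \<open>Free paratopological Abelian groups\<close>

definition paratop_Abelian_group :: "('g, 'm) monoid_scheme \<Rightarrow> 'g topology \<Rightarrow> bool" where
  "paratop_Abelian_group G T \<longleftrightarrow>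
     comm_group G \<and> topspace T = carrier G \<and>
     continuous_map (prod_topology T T) T (\<lambda>(x, y). x \<otimes>\<^bsub>G\<^esub> y)"

text \<open>
  The universal property with respect to target groups whose elements are of type \<open>'h\<close>.
  Homomorphisms are taken in \<^const>\<open>extensional\<close> so that uniqueness is
  uniqueness on the carrier.
\<close>

definition free_paratop_Abelian_group_wrt ::
  "'h itself \<Rightarrow> 'a topology \<Rightarrow> 'g monoid \<Rightarrow> 'g topology \<Rightarrow> ('a \<Rightarrow> 'g) \<Rightarrow> bool" where
  "free_paratop_Abelian_group_wrt (_ :: 'h itself) X G T \<delta> \<longleftrightarrow>
     paratop_Abelian_group G T \<and> continuous_map X T \<delta> \<and>
     (\<forall>(H :: 'h monoid) S f.
        paratop_Abelian_group H S \<and> continuous_map X S f \<longrightarrow>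
        (\<exists>!g. g \<in> hom G H \<and> g \<in> extensional (carrier G) \<and> continuous_map T S g \<and>
              (\<forall>x\<in>topspace X. g (\<delta> x) = f x)))"

text \<open>
  HOL cannot quantify over all target types inside a formula. It suffices to let the targets
  range over two types: that of \<open>G\<close> and that of formal integer combinations of elements
  of \<open>X\<close>. Theorem \<open>free_paratop_Abelian_group_universal\<close> below derives the universal
  property for targets of arbitrary type, and \<open>free_paratop_Abelian_group_exists\<close> shows
  that every space has a free paratopological Abelian group.
\<close>

definition free_paratop_Abelian_group ::
  "'a topology \<Rightarrow> 'g monoid \<Rightarrow> 'g topology \<Rightarrow> ('a \<Rightarrow> 'g) \<Rightarrow> bool" where
  "free_paratop_Abelian_group X G T \<delta> \<longleftrightarrow>
     free_paratop_Abelian_group_wrt TYPE('g) X G T \<delta> \<and>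
     free_paratop_Abelian_group_wrt TYPE('a \<Rightarrow>\<^sub>0 int) X G T \<delta>"


subsection \<open>Existence\<close>

definition PA_group :: "'a topology \<Rightarrow> ('a \<Rightarrow>\<^sub>0 int) monoid" where
  "PA_group X = free_Abelian_group (topspace X)"

definition PA_topologies :: "'a topology \<Rightarrow> ('a \<Rightarrow>\<^sub>0 int) topology set" where
  "PA_topologies X = {T. paratop_Abelian_group (PA_group X) T \<and> continuous_map X T frag_of}"

definition PA_topology :: "'a topology \<Rightarrow> ('a \<Rightarrow>\<^sub>0 int) topology" where
  "PA_topology X = topology_generated_by (\<Union>T\<in>PA_topologies X. Collect (openin T))"

lemma comm_group_PA: "comm_group (PA_group X)"
  by (simp add: PA_group_def abelian_free_Abelian_group)

lemma paratop_pullback: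
  assumes H: "paratop_Abelian_group H S" and G: "comm_group G" and h: "h \<in> hom G H"
  shows "paratop_Abelian_group G (pullback_topology (carrier G) h S)"
proof -
  let ?T = "pullback_topology (carrier G) h S"
  interpret G: comm_group G by (rule G)
  have top: "topspace ?T = carrier G"
    using H h unfolding paratop_Abelian_group_def hom_def
    by (auto simp: topspace_pullback_topology)
  have hc: "continuous_map ?T S h"
    using continuous_map_pullback[OF continuous_map_id, of "carrier G" h S] by simp
  have mH: "continuous_map (prod_topology S S) S (\<lambda>(x, y). x \<otimes>\<^bsub>H\<^esub> y)"
    using H by (simp add: paratop_Abelian_group_def)
  have hh: "continuous_map (prod_topology ?T ?T) (prod_topology S S) (\<lambda>p. (h (fst p), h (snd p)))"
    by (intro continuous_map_pairedI continuous_map_compose[OF _ hc, unfolded o_def]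
        continuous_map_fst continuous_map_snd)
  have "continuous_map (prod_topology ?T ?T) S (\<lambda>p. h (fst p) \<otimes>\<^bsub>H\<^esub> h (snd p))"
    using continuous_map_compose[OF hh mH] by (simp add: o_def)
  then have "continuous_map (prod_topology ?T ?T) S (h \<circ> (\<lambda>(x, y). x \<otimes>\<^bsub>G\<^esub> y))"
    by (rule continuous_map_eq) (use h top in \<open>auto simp: hom_def\<close>)
  then have "continuous_map (prod_topology ?T ?T) ?T (\<lambda>(x, y). x \<otimes>\<^bsub>G\<^esub> y)"
    by (rule continuous_map_pullback') (use top in auto)
  with top G show ?thesis by (simp add: paratop_Abelian_group_def)
qed

lemma pullback_in_PA_topologies:
  assumes H: "paratop_Abelian_group H S" and f: "continuous_map X S f"
    and h: "h \<in> hom (PA_group X) H" and hf: "\<And>x. x \<in> topspace X \<Longrightarrow> h (frag_of x) = f x"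
  shows "pullback_topology (carrier (PA_group X)) h S \<in> PA_topologies X"
proof -
  have "continuous_map X S (h \<circ> frag_of)"
    using f by (rule continuous_map_eq) (simp add: hf)
  then have "continuous_map X (pullback_topology (carrier (PA_group X)) h S) frag_of"
    by (rule continuous_map_pullback') (auto simp: PA_group_def)
  with paratop_pullback[OF H comm_group_PA h] show ?thesis
    by (simp add: PA_topologies_def)
qed

lemma PA_topologies_nonempty: "PA_topologies X \<noteq> {}"
proof -
  define H :: "unit monoid" where "H = \<lparr>carrier = UNIV, monoid.mult = (\<lambda>_ _. ()), one = ()\<rparr>"
  have "comm_group H"
    by (rule comm_groupI) (auto simp: H_def)
  then have H: "paratop_Abelian_group H (discrete_topology UNIV)"
    by (simp add: paratop_Abelian_group_def prod_topology_discrete_topology[symmetric])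
      (simp add: H_def)
  have "(\<lambda>_. ()) \<in> hom (PA_group X) H"
    by (auto simp: hom_def H_def)
  from pullback_in_PA_topologies[OF H _ this, of "\<lambda>_. ()"] show ?thesis
    by auto
qed

lemma topspace_PA_topology: "topspace (PA_topology X) = carrier (PA_group X)"
proof -
  have T: "\<Union>(Collect (openin T)) = carrier (PA_group X)" if "T \<in> PA_topologies X" for T
    using that by (auto simp: PA_topologies_def paratop_Abelian_group_def topspace_def)
  have "topspace (PA_topology X) = (\<Union>T\<in>PA_topologies X. \<Union>(Collect (openin T)))"
    unfolding PA_topology_def topology_generated_by_topspace by blast
  also have "\<dots> = carrier (PA_group X)"
    using T PA_topologies_nonempty[of X] by simp
  finally show ?thesis .
qed

lemma openin_PA_topology: "T \<in> PA_topologies X \<Longrightarrow> openin T U \<Longrightarrow> openin (PA_topology X) U"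
  unfolding PA_topology_def by (rule topology_generated_by_Basis) auto

lemma continuous_map_from_PA:
  assumes "T \<in> PA_topologies X"
  shows "continuous_map (PA_topology X) T id"
proof -
  have tT: "topspace T = carrier (PA_group X)"
    using assms by (simp add: PA_topologies_def paratop_Abelian_group_def)
  have "openin (PA_topology X) {x \<in> topspace (PA_topology X). id x \<in> U}" if U: "openin T U" for U
  proof -
    have "{x \<in> topspace (PA_topology X). id x \<in> U} = U"
      using openin_subset[OF U] tT by (auto simp: topspace_PA_topology)
    then show ?thesis using openin_PA_topology[OF assms U] by simp
  qed
  then show ?thesis by (simp add: continuous_map_def topspace_PA_topology tT)
qed

lemma continuous_map_into_PA:
  assumes "f \<in> topspace Z \<rightarrow> carrier (PA_group X)"
    and "\<And>T. T \<in> PA_topologies X \<Longrightarrow> continuous_map Z T f"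
  shows "continuous_map Z (PA_topology X) f"
  unfolding PA_topology_def
proof (rule continuous_on_generated_topo)
  show "f ` topspace Z \<subseteq> \<Union> (\<Union>T\<in>PA_topologies X. Collect (openin T))"
    using assms(1) topspace_PA_topology[of X]
    unfolding PA_topology_def topology_generated_by_topspace by auto
next
  fix U assume "U \<in> (\<Union>T\<in>PA_topologies X. Collect (openin T))"
  then obtain T where T: "T \<in> PA_topologies X" "openin T U" by auto
  have "openin Z {x \<in> topspace Z. f x \<in> U}"
    using assms(2)[OF T(1)] T(2) by (simp add: continuous_map_def)
  then show "openin Z (f -` U \<inter> topspace Z)"
    by (simp add: vimage_def Collect_conj_eq Int_commute)
qed

lemma paratop_PA: "paratop_Abelian_group (PA_group X) (PA_topology X)"
proof -
  interpret G: comm_group "PA_group X" by (rule comm_group_PA)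
  let ?P = "PA_topology X"
  let ?m = "\<lambda>(x, y). x \<otimes>\<^bsub>PA_group X\<^esub> y"
  have "continuous_map (prod_topology ?P ?P) ?P ?m"
  proof (rule continuous_map_into_PA)
    show "?m \<in> topspace (prod_topology ?P ?P) \<rightarrow> carrier (PA_group X)"
      by (auto simp: topspace_PA_topology)
  next
    fix T assume T: "T \<in> PA_topologies X"
    have id: "continuous_map ?P T (\<lambda>x. x)"
      using continuous_map_from_PA[OF T] by (simp add: id_def)
    have "continuous_map (prod_topology ?P ?P) (prod_topology T T) (\<lambda>p. (fst p, snd p))"
      by (intro continuous_map_pairedI continuous_map_compose[OF _ id, unfolded o_def]
          continuous_map_fst continuous_map_snd)
    moreover have "continuous_map (prod_topology T T) T ?m"
      using T by (simp add: PA_topologies_def paratop_Abelian_group_def)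
    ultimately show "continuous_map (prod_topology ?P ?P) T ?m"
      using continuous_map_compose by (fastforce simp: o_def)
  qed
  then show ?thesis
    by (simp add: paratop_Abelian_group_def comm_group_PA topspace_PA_topology)
qed

lemma hom_PA_unique:
  assumes H: "comm_group H" and g: "g \<in> hom (PA_group X) H" and g': "g' \<in> hom (PA_group X) H"
    and eq: "\<And>x. x \<in> topspace X \<Longrightarrow> g (frag_of x) = g' (frag_of x)"
    and x: "x \<in> carrier (PA_group X)"
  shows "g x = g' x"
proof -
  interpret H: comm_group H by (rule H)
  let ?F = "free_Abelian_group (topspace X)"
  interpret gh: group_hom ?F H g
    using g by (simp add: group_hom_def group_hom_axioms_def PA_group_def)
  interpret gh': group_hom ?F H g'
    using g' by (simp add: group_hom_def group_hom_axioms_def PA_group_def)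
  have "Poly_Mapping.keys x \<subseteq> topspace X" using x by (simp add: PA_group_def)
  then show ?thesis
  proof (rule free_Abelian_group_induct)
    show "g 0 = g' 0" using gh.hom_one gh'.hom_one by simp
  next
    fix x y assume xy: "Poly_Mapping.keys x \<subseteq> topspace X" "Poly_Mapping.keys y \<subseteq> topspace X"
      "g x = g' x" "g y = g' y"
    have y: "Poly_Mapping.keys (- y) \<subseteq> topspace X" using xy by simp
    have "k (x - y) = k x \<otimes>\<^bsub>H\<^esub> inv\<^bsub>H\<^esub> (k y)" 
      if "group_hom ?F H k" for k
      using group_hom.hom_mult[OF that, of x "- y"] group_hom.hom_inv[OF that, of y] xy y by simp
    from this[OF gh.group_hom_axioms] this[OF gh'.group_hom_axioms]
    show "g (x - y) = g' (x - y)" using xy by simp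
  qed (rule eq)
qed

lemma PA_universal:
  "free_paratop_Abelian_group_wrt TYPE('h) X (PA_group X) (PA_topology X) frag_of"
  unfolding free_paratop_Abelian_group_wrt_def
proof (intro conjI allI impI)
  show "paratop_Abelian_group (PA_group X) (PA_topology X)" by (rule paratop_PA)
  show "continuous_map X (PA_topology X) frag_of"
    by (rule continuous_map_into_PA) (auto simp: PA_group_def PA_topologies_def)
next
  fix H :: "'h monoid" and S f
  assume "paratop_Abelian_group H S \<and> continuous_map X S f"
  then have H: "paratop_Abelian_group H S" and f: "continuous_map X S f" by auto
  have cH: "comm_group H" and tS: "topspace S = carrier H"
    using H by (auto simp: paratop_Abelian_group_def)
  have "f ` topspace X \<subseteq> carrier H"
    using f tS by (auto simp: continuous_map_def)
  then obtain h where h: "h \<in> hom (PA_group X) H" "\<And>x. x \<in> topspace X \<Longrightarrow> h (frag_of x) = f x"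
    using comm_group.free_Abelian_group_universal[OF cH] unfolding PA_group_def by metis
  let ?T = "pullback_topology (carrier (PA_group X)) h S"
  have T: "?T \<in> PA_topologies X" by (rule pullback_in_PA_topologies[OF H f h])
  have "continuous_map ?T S h"
    using continuous_map_pullback[OF continuous_map_id, of "carrier (PA_group X)" h S] by simp
  with continuous_map_from_PA[OF T] have hc: "continuous_map (PA_topology X) S h"
    using continuous_map_compose by fastforce
  let ?C = "carrier (PA_group X)"
  show "\<exists>!g. g \<in> hom (PA_group X) H \<and> g \<in> extensional ?C \<and>
           continuous_map (PA_topology X) S g \<and> (\<forall>x\<in>topspace X. g (frag_of x) = f x)"
  proof (rule ex1I[where a = "restrict h ?C"], intro conjI)
    interpret G: comm_group "PA_group X" by (rule comm_group_PA)
    show "restrict h ?C \<in> hom (PA_group X) H"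
      using h(1) by (auto simp: hom_def)
    show "continuous_map (PA_topology X) S (restrict h ?C)"
      using hc by (rule continuous_map_eq) (simp add: topspace_PA_topology)
    show "\<forall>x\<in>topspace X. restrict h ?C (frag_of x) = f x"
      using h(2) by (simp add: PA_group_def)
  next
    fix g assume g: "g \<in> hom (PA_group X) H \<and> g \<in> extensional ?C \<and>
           continuous_map (PA_topology X) S g \<and> (\<forall>x\<in>topspace X. g (frag_of x) = f x)"
    show "g = restrict h ?C"
    proof (rule extensionalityI[of _ ?C])
      fix x assume "x \<in> ?C"
      then show "g x = restrict h ?C x"
        using hom_PA_unique[OF cH, of g X h x] g h by simp
    qed (use g in auto)
  qed auto
qed

theorem free_paratop_Abelian_group_exists:
  "free_paratop_Abelian_group X (PA_group X) (PA_topology X) frag_of"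
  by (simp add: free_paratop_Abelian_group_def PA_universal)


subsection \<open>The universal property for targets of arbitrary type\<close>

lemma free_wrtD:
  fixes H :: "'h monoid"
  assumes "free_paratop_Abelian_group_wrt TYPE('h) X G T \<delta>"
    and "paratop_Abelian_group H S" and "continuous_map X S f"
  obtains g where "g \<in> hom G H" "continuous_map T S g" "\<And>x. x \<in> topspace X \<Longrightarrow> g (\<delta> x) = f x"
  using assms unfolding free_paratop_Abelian_group_wrt_def by metis

lemma free_wrt_unique:
  fixes H :: "'h monoid"
  assumes free: "free_paratop_Abelian_group_wrt TYPE('h) X G T \<delta>"
    and H: "paratop_Abelian_group H S"
    and g: "g \<in> hom G H" "continuous_map T S g"
    and g': "g' \<in> hom G H" "continuous_map T S g'"
    and eq: "\<And>x. x \<in> topspace X \<Longrightarrow> g (\<delta> x) = g' (\<delta> x)"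
    and x: "x \<in> carrier G"
  shows "g x = g' x"
proof -
  have G: "comm_group G" and tT: "topspace T = carrier G" and d: "continuous_map X T \<delta>"
    using free by (auto simp: free_paratop_Abelian_group_wrt_def paratop_Abelian_group_def)
  interpret G: comm_group G by (rule G)
  have dG: "\<delta> x \<in> carrier G" if "x \<in> topspace X" for x
    using d tT that by (auto simp: continuous_map_def)
  have f: "continuous_map X S (\<lambda>x. g (\<delta> x))"
    using continuous_map_compose[OF d g(2)] by (simp add: o_def)
  let ?Q = "\<lambda>k. k \<in> hom G H \<and> k \<in> extensional (carrier G) \<and> continuous_map T S k \<and>
              (\<forall>x\<in>topspace X. k (\<delta> x) = g (\<delta> x))"
  have "\<exists>!k. ?Q k"
    using free H f unfolding free_paratop_Abelian_group_wrt_def by blast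
  moreover have "?Q (restrict k (carrier G))"
    if "k \<in> hom G H" "continuous_map T S k" "\<And>x. x \<in> topspace X \<Longrightarrow> g (\<delta> x) = k (\<delta> x)" for k
  proof (intro conjI)
    show "restrict k (carrier G) \<in> hom G H"
      using that(1) by (auto simp: hom_def)
    show "continuous_map T S (restrict k (carrier G))"
      using that(2) by (rule continuous_map_eq) (simp add: tT)
    show "\<forall>x\<in>topspace X. restrict k (carrier G) (\<delta> x) = g (\<delta> x)"
      using that(3) dG by simp
  qed auto
  ultimately have "restrict g (carrier G) = restrict g' (carrier G)"
    using g g' eq by blast
  then show ?thesis using x by (metis restrict_apply')
qed

theorem free_paratop_Abelian_group_universal:
  fixes X :: "'a topology" and G :: "'g monoid"
  assumes free: "free_paratop_Abelian_group X G T \<delta>"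
  shows "free_paratop_Abelian_group_wrt TYPE('h) X G T \<delta>"
proof -
  have free1: "free_paratop_Abelian_group_wrt TYPE('g) X G T \<delta>"
    and free2: "free_paratop_Abelian_group_wrt TYPE('a \<Rightarrow>\<^sub>0 int) X G T \<delta>"
    using free by (auto simp: free_paratop_Abelian_group_def)
  have GT: "paratop_Abelian_group G T" and d: "continuous_map X T \<delta>"
    using free1 by (auto simp: free_paratop_Abelian_group_wrt_def)
  then have tT: "topspace T = carrier G" and G: "comm_group G"
    by (auto simp: paratop_Abelian_group_def)
  interpret G: comm_group G by (rule G)
  have dG: "\<delta> x \<in> carrier G" if "x \<in> topspace X" for x
    using d tT that by (auto simp: continuous_map_def)
  let ?P = "PA_group X" and ?S = "PA_topology X"
  have e: "continuous_map X ?S frag_of"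
    using PA_universal[where X=X] unfolding free_paratop_Abelian_group_wrt_def by (elim conjE)
  obtain \<phi> where \<phi>: "\<phi> \<in> hom G ?P" "continuous_map T ?S \<phi>"
      "\<And>x. x \<in> topspace X \<Longrightarrow> \<phi> (\<delta> x) = frag_of x"
    using free_wrtD[OF free2 paratop_PA e] by metis
  obtain \<psi> where \<psi>: "\<psi> \<in> hom ?P G" "continuous_map ?S T \<psi>"
      "\<And>x. x \<in> topspace X \<Longrightarrow> \<psi> (frag_of x) = \<delta> x"
    using free_wrtD[OF PA_universal GT d] by metis
  have \<psi>\<phi>: "\<psi> (\<phi> y) = y" if "y \<in> carrier G" for y
  proof -
    have "(\<psi> \<circ> \<phi>) y = id y"
    proof (rule free_wrt_unique[OF free1 GT _ _ _ _ _ that])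
      show "\<psi> \<circ> \<phi> \<in> hom G G" using \<phi>(1) \<psi>(1) by (rule hom_compose)
      show "continuous_map T T (\<psi> \<circ> \<phi>)" using \<phi>(2) \<psi>(2) by (rule continuous_map_compose)
      show "id \<in> hom G G" by (simp add: hom_def)
    qed (use \<phi>(3) \<psi>(3) in simp_all)
    then show ?thesis by simp
  qed
  show ?thesis
    unfolding free_paratop_Abelian_group_wrt_def
  proof (intro conjI allI impI)
    fix H :: "'h monoid" and S f
    assume "paratop_Abelian_group H S \<and> continuous_map X S f"
    then have H: "paratop_Abelian_group H S" and f: "continuous_map X S f" by auto
    obtain h where h: "h \<in> hom ?P H" "continuous_map ?S S h"
        "\<And>x. x \<in> topspace X \<Longrightarrow> h (frag_of x) = f x"
      using free_wrtD[OF PA_universal H f] by metis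
    show "\<exists>!g. g \<in> hom G H \<and> g \<in> extensional (carrier G) \<and> continuous_map T S g \<and>
              (\<forall>x\<in>topspace X. g (\<delta> x) = f x)"
    proof (rule ex1I[where a = "restrict (h \<circ> \<phi>) (carrier G)"], intro conjI)
      have hp: "h \<circ> \<phi> \<in> hom G H"
        using \<phi>(1) h(1) by (rule hom_compose)
      then show "restrict (h \<circ> \<phi>) (carrier G) \<in> hom G H"
        by (auto simp: hom_def)
      show "continuous_map T S (restrict (h \<circ> \<phi>) (carrier G))"
        using continuous_map_compose[OF \<phi>(2) h(2)] by (rule continuous_map_eq) (simp add: tT)
      show "\<forall>x\<in>topspace X. restrict (h \<circ> \<phi>) (carrier G) (\<delta> x) = f x"
        using dG \<phi>(3) h(3) by simp
    next
      fix g assume g: "g \<in> hom G H \<and> g \<in> extensional (carrier G) \<and> continuous_map T S g \<and>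
              (\<forall>x\<in>topspace X. g (\<delta> x) = f x)"
      show "g = restrict (h \<circ> \<phi>) (carrier G)"
      proof (rule extensionalityI[of _ "carrier G"])
        fix y assume y: "y \<in> carrier G"
        have py: "\<phi> y \<in> carrier ?P" using \<phi>(1) y by (auto simp: hom_def)
        have "(g \<circ> \<psi>) (\<phi> y) = h (\<phi> y)"
        proof (rule free_wrt_unique[OF PA_universal H _ _ h(1,2) _ py])
          show "g \<circ> \<psi> \<in> hom ?P H" using \<psi>(1) g by (auto intro: hom_compose)
          show "continuous_map ?S S (g \<circ> \<psi>)" using \<psi>(2) g by (auto intro: continuous_map_compose)
        qed (use g \<psi>(3) h(3) in simp)
        then show "g y = restrict (h \<circ> \<phi>) (carrier G) y"
          using \<psi>\<phi> y by simp
      qed (use g in auto)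
    qed auto
  qed (use GT d in auto)
qed

end

theory Submission
  imports Defs "HOL-Library.Countable_Set_Type"
begin

text \<open>
  The four conditions are linked in the cycle \<open>cond1\<close>, \<open>cond2\<close>, \<open>cond4\<close>, \<open>cond3\<close>, \<open>cond1\<close>. All work is done in the
  concrete group \<^term>\<open>PA_topology X\<close> of formal integer combinations of points; the given
  group is homeomorphic to it by uniqueness of free objects.

  \<^bold>\<open>Neighbourhoods of zero.\<close> Let \<open>W\<^sub>0, W\<^sub>1, \<dots>\<close> be sets of combinations with
  \<open>W\<^sub>n\<^sub>+\<^sub>1 + W\<^sub>n\<^sub>+\<^sub>1 \<subseteq> W\<^sub>n\<close> such that for all \<open>n\<close> and \<open>z\<close> the difference \<open>y - z\<close> lies in
  \<open>W\<^sub>n\<close> for every \<open>y\<close> close to \<open>z\<close>. They define a paratopological group topology for which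
  \<open>X\<close> maps continuously, so \<open>W\<^sub>0\<close> is a neighbourhood of zero (\<open>PA_nhd_of_zero\<close>). Because inversion
  need not be continuous, the condition is one-sided: any family of real functions on \<open>X\<close> that is
  upper semicontinuous uniformly in the index yields such sets. If the family is moreover pointwise
  bounded, its linear extensions are uniformly bounded above on compact sets
  (\<open>equi_usc_bounded_on_compact\<close>). Each fan constructed below is compact-finite because suitable
  functions would violate such a bound on a compact set meeting too many of its members.

  \<^bold>\<open>From cond3 to cond1.\<close> Let \<open>X'\<close> be the set of non-isolated points; each is the limit of a
  nontrivial sequence, by the \<open>k\<^sub>R\<close>-property and the network. Suppose \<open>x\<^sub>a\<^sub>,\<^sub>n \<longlonglongrightarrow> x\<^sub>a\<close> for
  \<open>a < \<omega>\<^sub>1\<close>, and put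
  \<open>z\<^sub>a\<^sub>,\<^sub>b = (x\<^sub>a\<^sub>,\<^sub>n - x\<^sub>a) + (x\<^sub>b\<^sub>,\<^sub>n - x\<^sub>b)\<close> for \<open>b < a\<close>, where \<open>n\<close> is essentially the value at \<open>b\<close> of an injection
  of the predecessors of \<open>a\<close> into the natural numbers. These elements always accumulate at zero
  (\<open>omega1_fan_in_PA\<close>). If the limits \<open>x\<^sub>a\<close> are distinct, the coefficient \<open>-1\<close> at \<open>x\<^sub>a\<close>,
  seen through disjoint open sets, makes them compact-finite, so \<open>cond3\<close> forces \<open>X'\<close> to be countable
  (\<open>uncountable_nonisolated_imp_fan\<close>). If the limits coincide and each compact set meets only
  finitely many of the sequences, the positive coefficients do it (\<open>common_limit_imp_fan\<close>).
  Secondly, if some compact \<open>K\<close> is not covered by finitely many network members with compact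
  closure, then near \<open>K\<close> there are points \<open>x\<^sub>k\<^sub>,\<^sub>j\<close> that for fixed \<open>k\<close> have a locally finite
  family of neighbourhoods, and \<open>x\<^sub>k\<^sub>,\<^sub>j + (k + 1)\<^sup>2 (y\<^sub>j - y)\<close> with \<open>y\<^sub>j \<longlonglongrightarrow> y\<close> is a strong fan
  (\<open>noncompact_network_imp_strong_fan\<close>).

  So the network members with compact closure suffice to cover compact sets. They are countable, and the equivalence relation
  that they generate on points has countable classes, of which a compact set meets finitely many.
  Classes of isolated points that accumulate somewhere in \<open>X'\<close> are countable in number, again
  by \<open>common_limit_imp_fan\<close>; together with the classes meeting \<open>X'\<close> they form the required countable clopen set
  (\<open>no_fan_imp_clopen_countable\<close>). It is a \<open>k\<^sub>\<omega>\<close>-space because countably many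
  compact sets absorb all others in it and it is a Tychonoff \<open>k\<^sub>R\<close>-space, by successive Tietze extensions (\<open>clopen_kR_imp_k_omega\<close>).

  \<^bold>\<open>From cond1 to cond2.\<close> Let \<open>L\<close> be the countable \<open>k\<^sub>\<omega>\<close>-summand. Finite sums of singletons and
  of images of compact subsets of \<open>L\<close> are countably many compact sets covering the subgroup \<open>A\<close>
  generated by \<open>L\<close>; countability of \<open>L\<close> is what makes singletons of negative elements
  affordable. A set that is open relative to all these compact sets is open: it can be halved
  repeatedly (\<open>k_open_halve\<close>), which produces sets \<open>W\<^sub>n\<close> as above. Hence \<open>A\<close> is an open
  \<open>k\<^sub>\<omega>\<close>-subgroup, and the isolated points generate a discrete complement.

  \<^bold>\<open>The remaining steps.\<close> A product of a \<open>k\<^sub>\<omega>\<close>-space and a discrete space is a \<open>k\<close>-space,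
  and when the former is countable and Hausdorff it has a compact-countable \<open>k\<close>-network, which pulls back to
  \<open>X\<close>. In a \<open>T\<^sub>1\<close> \<open>k\<close>-space every compact-finite family of finite sets is locally finite.
\<close>

section \<open>Functionals on integral combinations\<close>

abbreviation keys :: "('a \<Rightarrow>\<^sub>0 int) \<Rightarrow> 'a set" where "keys \<equiv> Poly_Mapping.keys"

text \<open>
  The additive extension of \<open>f\<close> to integral combinations. With the indicator of a set for \<open>f\<close> it
  adds up the coefficients at the points of that set.
\<close>

definition frag_eval :: "('a \<Rightarrow> real) \<Rightarrow> ('a \<Rightarrow>\<^sub>0 int) \<Rightarrow> real" where
  "frag_eval f g = (\<Sum>x\<in>keys g. of_int (Poly_Mapping.lookup g x) * f x)"

lemma frag_eval_superset:
  assumes "finite S" "keys g \<subseteq> S"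
  shows "frag_eval f g = (\<Sum>x\<in>S. of_int (Poly_Mapping.lookup g x) * f x)"
  unfolding frag_eval_def using assms
  by (intro sum.mono_neutral_left) (auto simp: in_keys_iff)

lemma frag_eval_0 [simp]: "frag_eval f 0 = 0"
  by (simp add: frag_eval_def)

lemma frag_eval_of [simp]: "frag_eval f (frag_of x) = f x"
  by (simp add: frag_eval_def)

lemma frag_eval_add [simp]: "frag_eval f (g + h) = frag_eval f g + frag_eval f h"
proof -
  let ?S = "keys g \<union> keys h"
  have S: "finite ?S" "keys g \<subseteq> ?S" "keys h \<subseteq> ?S" "keys (g + h) \<subseteq> ?S"
    using keys_add[of g h] by auto
  show ?thesis
    unfolding frag_eval_superset[OF S(1,2)] frag_eval_superset[OF S(1,3)] frag_eval_superset[OF S(1,4)]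
    by (simp add: lookup_add distrib_right sum.distrib)
qed

lemma frag_eval_uminus [simp]: "frag_eval f (- g) = - frag_eval f g"
  by (simp add: frag_eval_def sum_negf)

lemma frag_eval_diff [simp]: "frag_eval f (g - h) = frag_eval f g - frag_eval f h"
  using frag_eval_add[of f g "- h"] by simp

lemma frag_eval_cmul [simp]: "frag_eval f (frag_cmul n g) = of_int n * frag_eval f g"
proof -
  have "keys (frag_cmul n g) \<subseteq> keys g" by (rule keys_cmul)
  then show ?thesis
    by (subst frag_eval_superset[OF finite_keys, of _ g])
      (simp_all add: frag_eval_def sum_distrib_left mult.assoc)
qed

lemma frag_eval_scale: "frag_eval (\<lambda>x. c * f x) g = c * frag_eval f g"
  by (simp add: frag_eval_def sum_distrib_left mult.left_commute)

lemma abs_frag_eval_le: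
  assumes "\<And>x. x \<in> keys g \<Longrightarrow> \<bar>f x\<bar> \<le> B x"
  shows "\<bar>frag_eval f g\<bar> \<le> (\<Sum>x\<in>keys g. \<bar>of_int (Poly_Mapping.lookup g x)\<bar> * B x)"
  unfolding frag_eval_def
  by (rule order_trans[OF sum_abs]) (auto intro!: sum_mono mult_left_mono simp: abs_mult assms)

section \<open>Compact sets\<close>

lemma compactin_pointwise_cover:
  assumes K: "compactin X K" and V: "\<And>x. x \<in> K \<Longrightarrow> openin X (V x) \<and> x \<in> V x"
  shows "\<exists>D\<subseteq>K. finite D \<and> K \<subseteq> \<Union>(V ` D)"
proof -
  have "openin X W" if "W \<in> V ` K" for W using that V by blast
  moreover have "K \<subseteq> \<Union>(V ` K)" using V by blast
  ultimately obtain \<F> where F: "finite \<F>" "\<F> \<subseteq> V ` K" "K \<subseteq> \<Union>\<F>"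
    using compactinD[OF K, of "V ` K"] by metis
  then show ?thesis using finite_subset_image[OF F(1,2)] by blast
qed

lemma compactin_Diff_open:
  assumes K: "compactin X K" and U: "openin X U"
  shows "compactin X (K - U)"
proof -
  have "closedin X (topspace X - U)" using U by blast
  then have "compactin X ((topspace X - U) \<inter> K)" using K by (rule closed_Int_compactin)
  moreover have "(topspace X - U) \<inter> K = K - U" using compactin_subset_topspace[OF K] by blast
  ultimately show ?thesis by simp
qed

section \<open>Translations and neighbourhoods of zero\<close>

lemma topspace_PA [simp]: "topspace (PA_topology X) = {g. keys g \<subseteq> topspace X}"
  by (simp add: topspace_PA_topology PA_group_def carrier_free_Abelian_group_iff set_eq_iff)

lemma carrier_PA: "carrier (PA_group X) = {g. keys g \<subseteq> topspace X}"
  by (simp add: PA_group_def carrier_free_Abelian_group_iff set_eq_iff)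

lemma keys_diff_subset: "keys g \<subseteq> S \<Longrightarrow> keys h \<subseteq> S \<Longrightarrow> keys (g - h) \<subseteq> S"
  by (rule order_trans[OF keys_diff]) simp

lemma keys_add_subset: "keys g \<subseteq> S \<Longrightarrow> keys h \<subseteq> S \<Longrightarrow> keys (g + h) \<subseteq> S"
  by (rule order_trans[OF keys_add]) simp

lemma continuous_frag_of: "continuous_map X (PA_topology X) frag_of"
  using PA_universal[where X=X] unfolding free_paratop_Abelian_group_wrt_def by (elim conjE)

lemma continuous_map_PA_add:
  assumes "continuous_map Z (PA_topology X) f" "continuous_map Z (PA_topology X) g"
  shows "continuous_map Z (PA_topology X) (\<lambda>z. f z + g z)"
proof -
  have "continuous_map (prod_topology (PA_topology X) (PA_topology X)) (PA_topology X)
      (\<lambda>(x, y). x \<otimes>\<^bsub>PA_group X\<^esub> y)"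
    using paratop_PA[of X] by (simp add: paratop_Abelian_group_def)
  from continuous_map_compose[OF continuous_map_pairedI[OF assms] this]
  show ?thesis by (simp add: o_def PA_group_def)
qed

lemma homeomorphic_map_PA_translation:
  assumes "keys g \<subseteq> topspace X"
  shows "homeomorphic_map (PA_topology X) (PA_topology X) (\<lambda>h. g + h)"
proof -
  have c: "continuous_map (PA_topology X) (PA_topology X) (\<lambda>h. k + h)"
    if "keys k \<subseteq> topspace X" for k
    using that continuous_map_PA_add[of "PA_topology X" X "\<lambda>_. k" "\<lambda>h. h"] by simp
  have "homeomorphic_maps (PA_topology X) (PA_topology X) (\<lambda>h. g + h) (\<lambda>h. - g + h)"
    unfolding homeomorphic_maps_def using c[of g] c[of "- g"] assms
    by (simp del: add_uminus_conv_diff uminus_add_conv_diff)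
  then show ?thesis by (rule homeomorphic_maps_imp_map)
qed

lemma openin_PA_translation:
  assumes "keys g \<subseteq> topspace X" "openin (PA_topology X) U"
  shows "openin (PA_topology X) ((\<lambda>h. g + h) ` U)"
  using homeomorphic_map_openness[OF homeomorphic_map_PA_translation[OF assms(1)]] assms(2)
  by (metis openin_subset)

lemma openin_PA_add:
  assumes U: "openin (PA_topology X) U" "a + b \<in> U"
    and ab: "keys a \<subseteq> topspace X" "keys b \<subseteq> topspace X"
  obtains A B where "openin (PA_topology X) A" "openin (PA_topology X) B" "a \<in> A" "b \<in> B"
    "\<And>x y. x \<in> A \<Longrightarrow> y \<in> B \<Longrightarrow> x + y \<in> U"
proof -
  let ?P = "PA_topology X"
  have c: "continuous_map (prod_topology ?P ?P) ?P (\<lambda>p. fst p + snd p)"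
    by (intro continuous_map_PA_add continuous_map_fst continuous_map_snd)
  let ?O = "{p \<in> topspace (prod_topology ?P ?P). fst p + snd p \<in> U}"
  have "openin (prod_topology ?P ?P) ?O" using c U(1) by (rule openin_continuous_map_preimage)
  moreover have "(a, b) \<in> ?O" using U(2) ab by simp
  ultimately have "\<exists>A B. openin ?P A \<and> openin ?P B \<and> a \<in> A \<and> b \<in> B \<and> A \<times> B \<subseteq> ?O"
    by (rule openin_prod_topology_alt[THEN iffD1, rule_format])
  then obtain A B where "openin ?P A" "openin ?P B" "a \<in> A" "b \<in> B" "A \<times> B \<subseteq> ?O"
    by blast
  then show thesis by (intro that[of A B]) auto
qed

text \<open>
  The translates of the \<open>W n\<close> are a neighbourhood base of a paratopological group topology on the
  combinations, and the last hypothesis says that \<open>X\<close> maps continuously into it. The free topology is finer.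
  Only differences \<open>y - z\<close> with \<open>y\<close> near \<open>z\<close> occur, never with the roles exchanged; this matches the
  possible discontinuity of inversion.
\<close>

lemma PA_nhd_of_zero:
  fixes W :: "nat \<Rightarrow> ('a \<Rightarrow>\<^sub>0 int) set"
  assumes Wsub: "\<And>n. W n \<subseteq> {g. keys g \<subseteq> topspace X}"
    and W0: "\<And>n. 0 \<in> W n"
    and Wadd: "\<And>n g h. g \<in> W (Suc n) \<Longrightarrow> h \<in> W (Suc n) \<Longrightarrow> g + h \<in> W n"
    and WX: "\<And>n z. z \<in> topspace X \<Longrightarrow>
      \<exists>V. openin X V \<and> z \<in> V \<and> (\<forall>y\<in>V. frag_of y - frag_of z \<in> W n)"
  obtains U where "openin (PA_topology X) U" "0 \<in> U" "U \<subseteq> W 0"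
proof -
  define A where "A = {g. keys g \<subseteq> topspace X}"
  define op where "op U \<longleftrightarrow> U \<subseteq> A \<and> (\<forall>g\<in>U. \<exists>n. \<forall>w\<in>W n. g + w \<in> U)" for U
  have mono1: "W (Suc n) \<subseteq> W n" for n using Wadd[OF _ W0] by fastforce
  then have mono: "m \<le> n \<Longrightarrow> W n \<subseteq> W m" for m n by (rule lift_Suc_antimono_le)
  have "istopology op"
    unfolding istopology_def
  proof (intro conjI allI impI)
    fix S T assume S: "op S" and T: "op T"
    have "\<exists>n. \<forall>w\<in>W n. g + w \<in> S \<inter> T" if "g \<in> S \<inter> T" for g
    proof -
      obtain m where m: "\<forall>w\<in>W m. g + w \<in> S" using S \<open>g \<in> S \<inter> T\<close> by (auto simp: op_def)
      obtain n where n: "\<forall>w\<in>W n. g + w \<in> T" using T \<open>g \<in> S \<inter> T\<close> by (auto simp: op_def)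
      show ?thesis using m n mono[of m "max m n"] mono[of n "max m n"] by (intro exI[of _ "max m n"]) auto
    qed
    then show "op (S \<inter> T)" using S by (auto simp: op_def)
  next
    fix \<U> assume "\<forall>U\<in>\<U>. op U"
    then show "op (\<Union>\<U>)" unfolding op_def by (meson Sup_least UnionE UnionI)
  qed
  then have oi: "openin (topology op) = op" by (rule topology_inverse')
  let ?T = "topology op"
  have WA: "W n \<subseteq> A" for n using Wsub by (simp add: A_def)
  have Aadd: "g + h \<in> A" if "g \<in> A" "h \<in> A" for g h
    using that keys_add_subset[of g "topspace X" h] by (simp add: A_def)
  have opA: "op A" unfolding op_def using WA Aadd by blast
  have tT: "topspace ?T = A"
    using opA oi by (metis op_def openin_subset openin_topspace subset_antisym)
  \<comment> \<open>the interior of the translate of \<open>W n\<close> by \<open>g\<close>\<close>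
  define I where "I g n = {h. \<exists>m. \<forall>w\<in>W m. \<exists>v\<in>W n. h + w = g + v}" for g n
  have I1: "g \<in> I g n" for g n unfolding I_def by auto
  have I2: "I g n \<subseteq> (\<lambda>v. g + v) ` W n" for g n unfolding I_def using W0 by force
  have I3: "op (I g n)" if "g \<in> A" for g n
    unfolding op_def
  proof (intro conjI ballI)
    show "I g n \<subseteq> A" using I2[of g n] WA Aadd[OF that] by blast
    fix h assume "h \<in> I g n"
    then obtain m where m: "\<forall>w\<in>W m. \<exists>v\<in>W n. h + w = g + v" by (auto simp: I_def)
    have "h + w \<in> I g n" if "w \<in> W (Suc m)" for w
      unfolding I_def using m Wadd[OF that]
      by (auto intro!: exI[of _ "Suc m"] simp: add.assoc)
    then show "\<exists>m. \<forall>w\<in>W m. h + w \<in> I g n" by blast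
  qed
  have "paratop_Abelian_group (PA_group X) ?T"
    unfolding paratop_Abelian_group_def
  proof (intro conjI)
    show "comm_group (PA_group X)" by (rule comm_group_PA)
    show "topspace ?T = carrier (PA_group X)" by (simp add: tT A_def carrier_PA)
    show "continuous_map (prod_topology ?T ?T) ?T (\<lambda>(x, y). x \<otimes>\<^bsub>PA_group X\<^esub> y)"
      unfolding continuous_map_def
    proof (intro conjI allI impI)
      show "(\<lambda>(x, y). x \<otimes>\<^bsub>PA_group X\<^esub> y) \<in> topspace (prod_topology ?T ?T) \<rightarrow> topspace ?T"
        using Aadd by (auto simp: tT PA_group_def)
      fix U assume U: "openin ?T U"
      let ?O = "{p \<in> topspace (prod_topology ?T ?T). (case p of (x, y) \<Rightarrow> x \<otimes>\<^bsub>PA_group X\<^esub> y) \<in> U}"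
      show "openin (prod_topology ?T ?T) ?O"
        unfolding openin_prod_topology_alt
      proof (intro allI impI)
        fix x y assume "(x, y) \<in> ?O"
        then have xy: "x \<in> A" "y \<in> A" "x + y \<in> U" by (auto simp: tT PA_group_def)
        then obtain n where n: "\<forall>w\<in>W n. x + y + w \<in> U" using U by (auto simp: oi op_def)
        have "I x (Suc n) \<times> I y (Suc n) \<subseteq> ?O"
        proof clarify
          fix a b assume ab: "a \<in> I x (Suc n)" "b \<in> I y (Suc n)"
          then obtain v w where vw: "v \<in> W (Suc n)" "w \<in> W (Suc n)" "a = x + v" "b = y + w"
            using I2 by blast
          have "a + b = x + y + (v + w)" using vw by (simp add: algebra_simps)
          then have "a + b \<in> U" using n Wadd[OF vw(1,2)] by auto
          moreover have "a \<in> A" "b \<in> A" using ab I3 xy unfolding op_def by blast+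
          ultimately show "(a, b) \<in> topspace (prod_topology ?T ?T) \<and> a \<otimes>\<^bsub>PA_group X\<^esub> b \<in> U"
            by (simp add: tT PA_group_def)
        qed
        moreover have "openin ?T (I x (Suc n))" "openin ?T (I y (Suc n))"
          using I3 xy by (simp_all add: oi)
        ultimately show "\<exists>V W. openin ?T V \<and> openin ?T W \<and> x \<in> V \<and> y \<in> W \<and> V \<times> W \<subseteq> ?O"
          using I1 by blast
      qed
    qed
  qed
  moreover have "continuous_map X ?T frag_of"
    unfolding continuous_map_def
  proof (intro conjI allI impI)
    show "frag_of \<in> topspace X \<rightarrow> topspace ?T" by (auto simp: tT A_def)
    fix U assume U: "openin ?T U"
    show "openin X {x \<in> topspace X. frag_of x \<in> U}"
    proof (subst openin_subopen, clarify)
      fix z assume z: "z \<in> topspace X" "frag_of z \<in> U"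
      then obtain n where n: "\<forall>w\<in>W n. frag_of z + w \<in> U" using U by (auto simp: oi op_def)
      obtain V where V: "openin X V" "z \<in> V" "\<forall>y\<in>V. frag_of y - frag_of z \<in> W n"
        using WX[OF z(1)] by blast
      have "V \<subseteq> {x \<in> topspace X. frag_of x \<in> U}"
        using V n openin_subset[OF V(1)] by force
      then show "\<exists>T. openin X T \<and> z \<in> T \<and> T \<subseteq> {x \<in> topspace X. frag_of x \<in> U}" using V by blast
    qed
  qed
  ultimately have "?T \<in> PA_topologies X" by (simp add: PA_topologies_def)
  moreover have "openin ?T (I 0 0)" using I3[of 0 0] by (simp add: oi A_def)
  ultimately have "openin (PA_topology X) (I 0 0)" by (rule openin_PA_topology)
  then show thesis using that[of "I 0 0"] I1[of 0 0] I2[of 0 0] by auto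
qed

definition equi_usc :: "'a topology \<Rightarrow> 'i set \<Rightarrow> ('i \<Rightarrow> 'a \<Rightarrow> real) \<Rightarrow> bool" where
  "equi_usc X I \<phi> \<longleftrightarrow> (\<forall>z\<in>topspace X. \<forall>\<epsilon>>0. \<exists>V. openin X V \<and> z \<in> V \<and>
      (\<forall>y\<in>V. \<forall>i\<in>I. \<phi> i y \<le> \<phi> i z + \<epsilon>))"

text \<open>
  The sets on which all functionals are at most \<open>2\<close> to the power \<open>-n\<close> satisfy the hypotheses of
  \<open>PA_nhd_of_zero\<close>; semicontinuity from above is enough since only differences \<open>y - z\<close> with \<open>y\<close>
  near \<open>z\<close> have to be small.
\<close>

lemma equi_usc_nhd:
  assumes "equi_usc X I \<phi>"
  obtains U where "openin (PA_topology X) U" "0 \<in> U" "\<And>g i. g \<in> U \<Longrightarrow> i \<in> I \<Longrightarrow> frag_eval (\<phi> i) g \<le> 1"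
proof -
  define W where "W n = {g. keys g \<subseteq> topspace X \<and> (\<forall>i\<in>I. frag_eval (\<phi> i) g \<le> (1/2)^n)}" for n :: nat
  obtain U where "openin (PA_topology X) U" "0 \<in> U" "U \<subseteq> W 0"
  proof (rule PA_nhd_of_zero[of W X])
    show "W n \<subseteq> {g. keys g \<subseteq> topspace X}" for n by (auto simp: W_def)
    show "0 \<in> W n" for n by (auto simp: W_def)
    show "g + h \<in> W n" if "g \<in> W (Suc n)" "h \<in> W (Suc n)" for g h n
    proof -
      have "keys (g + h) \<subseteq> topspace X" using that by (intro keys_add_subset) (auto simp: W_def)
      moreover have "frag_eval (\<phi> i) g + frag_eval (\<phi> i) h \<le> (1/2)^n" if "i \<in> I" for i
      proof -
        have "frag_eval (\<phi> i) g \<le> (1/2) ^ Suc n" "frag_eval (\<phi> i) h \<le> (1/2) ^ Suc n"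
          using \<open>g \<in> W (Suc n)\<close> \<open>h \<in> W (Suc n)\<close> that unfolding W_def by blast+
        then show ?thesis by simp
      qed
      ultimately show ?thesis by (simp add: W_def)
    qed
    show "\<exists>V. openin X V \<and> z \<in> V \<and> (\<forall>y\<in>V. frag_of y - frag_of z \<in> W n)" if z: "z \<in> topspace X" for n z
    proof -
      have "(1/2::real)^n > 0" by simp
      then obtain V where V: "openin X V" "z \<in> V" "\<forall>y\<in>V. \<forall>i\<in>I. \<phi> i y \<le> \<phi> i z + (1/2)^n"
        using assms z unfolding equi_usc_def by blast
      have "frag_of y - frag_of z \<in> W n" if "y \<in> V" for y
      proof -
        have "keys (frag_of y - frag_of z) \<subseteq> topspace X"
          using z that openin_subset[OF V(1)] by (intro keys_diff_subset) auto
        then show ?thesis using V(3) that by (force simp: W_def)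
      qed
      then show ?thesis using V by blast
    qed
  qed
  then show thesis by (intro that[of U]) (auto simp: W_def)
qed

text \<open>
  Finitely many translates of the neighbourhood from \<open>equi_usc_nhd\<close> cover a compact set, and the
  functionals are bounded at each of the finitely many centres.
\<close>

lemma equi_usc_bounded_on_compact:
  assumes usc: "equi_usc X I \<phi>"
    and bnd: "\<And>x. x \<in> topspace X \<Longrightarrow> \<exists>B. \<forall>i\<in>I. \<bar>\<phi> i x\<bar> \<le> B"
    and C: "compactin (PA_topology X) C"
  obtains B where "\<And>g i. g \<in> C \<Longrightarrow> i \<in> I \<Longrightarrow> frag_eval (\<phi> i) g \<le> B"
proof -
  let ?P = "PA_topology X"
  obtain U where U: "openin ?P U" "0 \<in> U" "\<And>g i. g \<in> U \<Longrightarrow> i \<in> I \<Longrightarrow> frag_eval (\<phi> i) g \<le> 1"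
    using equi_usc_nhd[OF usc] by blast
  have Csub: "C \<subseteq> {g. keys g \<subseteq> topspace X}" using compactin_subset_topspace[OF C] by simp
  have "openin ?P ((\<lambda>h. g + h) ` U) \<and> g \<in> (\<lambda>h. g + h) ` U" if "g \<in> C" for g
    using openin_PA_translation[OF _ U(1), of g] Csub that U(2) by (auto intro: image_eqI[of _ _ 0])
  from compactin_pointwise_cover[OF C this]
  obtain F where F: "F \<subseteq> C" "finite F" "C \<subseteq> (\<Union>g\<in>F. (\<lambda>h. g + h) ` U)" by blast
  obtain B where B: "\<And>x i. x \<in> topspace X \<Longrightarrow> i \<in> I \<Longrightarrow> \<bar>\<phi> i x\<bar> \<le> B x" using bnd by metis
  define b where "b g = (\<Sum>x\<in>keys g. \<bar>of_int (Poly_Mapping.lookup g x)\<bar> * B x)" for g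
  have b: "frag_eval (\<phi> i) g \<le> b g" if "g \<in> C" "i \<in> I" for g i
  proof -
    have "\<bar>frag_eval (\<phi> i) g\<bar> \<le> b g" unfolding b_def
      using that Csub by (intro abs_frag_eval_le B) auto
    then show ?thesis by simp
  qed
  have "frag_eval (\<phi> i) c \<le> (\<Sum>g\<in>F. \<bar>b g\<bar>) + 1" if c: "c \<in> C" "i \<in> I" for c i
  proof -
    obtain g h where gh: "g \<in> F" "h \<in> U" "c = g + h" using c F(3) by auto
    have "frag_eval (\<phi> i) c \<le> b g + 1" using gh U(3)[of h i] b[of g i] c F(1) by auto
    also have "b g \<le> (\<Sum>g\<in>F. \<bar>b g\<bar>)"
      using member_le_sum[of g F "\<lambda>g. \<bar>b g\<bar>"] gh(1) F(2) by auto
    finally show ?thesis by simp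
  qed
  then show thesis using that by blast
qed

section \<open>Continuous functionals and separation\<close>

text \<open>
  The universal property applied to the additive group of the reals.
\<close>

lemma continuous_map_frag_eval:
  assumes f: "continuous_map X euclideanreal f"
  shows "continuous_map (PA_topology X) euclideanreal (frag_eval f)"
proof -
  define R :: "real monoid" where "R = \<lparr>carrier = UNIV, monoid.mult = (+), one = 0\<rparr>"
  have cR: "comm_group R"
  proof (rule comm_groupI)
    show "\<exists>y\<in>carrier R. y \<otimes>\<^bsub>R\<^esub> x = \<one>\<^bsub>R\<^esub>" for x
      by (rule bexI[of _ "- x"]) (auto simp: R_def)
  qed (auto simp: R_def)
  have R: "paratop_Abelian_group R euclideanreal"
    unfolding paratop_Abelian_group_def
  proof (intro conjI cR)
    have "continuous_map (prod_topology euclideanreal euclideanreal) euclideanreal (\<lambda>p. fst p + snd p)"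
      by (intro continuous_intros continuous_map_fst continuous_map_snd)
    then show "continuous_map (prod_topology euclideanreal euclideanreal) euclideanreal
       (\<lambda>(x, y). x \<otimes>\<^bsub>R\<^esub> y)" by (simp add: R_def case_prod_unfold)
  qed (auto simp: R_def)
  obtain g where g: "g \<in> hom (PA_group X) R" "continuous_map (PA_topology X) euclideanreal g"
      "\<And>x. x \<in> topspace X \<Longrightarrow> g (frag_of x) = f x"
    using free_wrtD[OF PA_universal R f] by metis
  have "frag_eval f \<in> hom (PA_group X) R"
    by (auto simp: hom_def R_def PA_group_def)
  then have "g x = frag_eval f x" if "x \<in> carrier (PA_group X)" for x
    using hom_PA_unique[OF cR g(1), of "frag_eval f"] g(3) that by simp
  then show ?thesis
    by (intro continuous_map_eq[OF g(2)]) (simp add: carrier_PA)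
qed

text \<open>
  Complete regularity in the orientation used below, with the function made zero outside the space.
\<close>

lemma Tychonoff_function:
  assumes X: "Tychonoff_space X" and U: "openin X U" and x: "x \<in> U"
  obtains f where "continuous_map X euclideanreal f" "f x = 1" "\<And>y. 0 \<le> f y \<and> f y \<le> 1"
    "\<And>y. y \<notin> U \<Longrightarrow> f y = 0"
proof -
  have "closedin X (topspace X - U)" "x \<in> topspace X - (topspace X - U)"
    using U x openin_subset by auto
  then obtain f where f: "continuous_map X (top_of_set {0..1::real}) f" "f x = 0" "f ` (topspace X - U) \<subseteq> {1}"
    using X unfolding Tychonoff_space_def completely_regular_space_def by metis
  have fr: "0 \<le> f y \<and> f y \<le> 1" if "y \<in> topspace X" for y
    using f(1) that unfolding continuous_map_in_subtopology by auto
  have fc: "continuous_map X euclideanreal f" using f(1) by (simp add: continuous_map_in_subtopology)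
  define g where "g y = (if y \<in> topspace X then 1 - f y else 0)" for y
  have "continuous_map X euclideanreal (\<lambda>y. 1 - f y)"
    by (intro continuous_intros fc)
  then have "continuous_map X euclideanreal g"
    by (rule continuous_map_eq) (simp add: g_def)
  then show thesis
    using f fr x openin_subset[OF U] by (intro that[of g]) (auto simp: g_def)
qed

lemma Tychonoff_imp_Hausdorff: "Tychonoff_space X \<Longrightarrow> Hausdorff_space X"
  by (simp add: Tychonoff_space_def completely_regular_imp_regular_space regular_t1_imp_Hausdorff_space)

text \<open>
  Functionals separate points: a continuous function that is \<open>1\<close> at one point of the support of
  \<open>g - h\<close> and \<open>0\<close> at the others takes different values at \<open>g\<close> and \<open>h\<close>.
\<close>

lemma Hausdorff_PA:
  assumes X: "Tychonoff_space X"
  shows "Hausdorff_space (PA_topology X)"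
  unfolding Hausdorff_space_def
proof clarify
  fix g h assume gh: "g \<in> topspace (PA_topology X)" "h \<in> topspace (PA_topology X)" "g \<noteq> h"
  then have gh': "keys g \<subseteq> topspace X" "keys h \<subseteq> topspace X" by simp_all
  have sub: "keys (g - h) \<subseteq> topspace X" by (rule keys_diff_subset[OF gh'])
  have "keys (g - h) \<noteq> {}" using gh(3) by simp
  then obtain x where x: "x \<in> keys (g - h)" by blast
  have "keys (g - h) - {x} \<subseteq> topspace X" "finite (keys (g - h) - {x})" using sub by auto
  then have "closedin X (keys (g - h) - {x})"
    using X unfolding Tychonoff_space_def t1_space_closedin_finite by blast
  then have "openin X (topspace X - (keys (g - h) - {x}))" by blast
  moreover have "x \<in> topspace X - (keys (g - h) - {x})" using x sub by blast
  ultimately obtain f where f: "continuous_map X euclideanreal f" "f x = 1"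
     "\<And>y. y \<notin> topspace X - (keys (g - h) - {x}) \<Longrightarrow> f y = 0"
    using Tychonoff_function[OF X, of _ x] by metis
  have "frag_eval f (g - h) = of_int (Poly_Mapping.lookup (g - h) x) * f x"
    unfolding frag_eval_def using x f(3) by (subst sum.remove[OF finite_keys x]) (auto intro!: sum.neutral)
  then have "frag_eval f g \<noteq> frag_eval f h"
    using f(2) x by (auto simp: in_keys_iff)
  then obtain A B where AB: "open A" "open B" "frag_eval f g \<in> A" "frag_eval f h \<in> B" "A \<inter> B = {}"
    by (meson separation_t2)
  let ?p = "\<lambda>S. {k \<in> topspace (PA_topology X). frag_eval f k \<in> S}"
  have "openin (PA_topology X) (?p A)" "openin (PA_topology X) (?p B)"
    using AB by (auto intro!: openin_continuous_map_preimage[OF continuous_map_frag_eval[OF f(1)]] simp del: topspace_PA)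
  moreover have "disjnt (?p A) (?p B)" using AB by (auto simp: disjnt_def)
  ultimately show "\<exists>U V. openin (PA_topology X) U \<and> openin (PA_topology X) V \<and> g \<in> U \<and> h \<in> V \<and> disjnt U V"
    using gh AB by (intro exI[of _ "?p A"] exI[of _ "?p B"]) auto
qed

section \<open>Fans indexed by the first uncountable ordinal\<close>

lemma uncountable_imp_omega1_le:
  assumes "uncountable A"
  obtains f where "inj_on f omega1" "f ` omega1 \<subseteq> A"
proof -
  have "\<not> |A| \<le>o natLeq"
    using assms countable_card_le_natLeq by blast
  then have "natLeq <o |A|"
    using natLeq_Well_order card_of_Well_order not_ordLeq_iff_ordLess by blast
  then have "cardSuc natLeq \<le>o |A|"
    using natLeq_Card_order card_of_Card_order by (blast intro: cardSuc_least)
  then have "|omega1| \<le>o |A|" using card_of_omega1 ordIso_ordLeq_trans by blast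
  then show thesis using that by (meson card_of_ordLeq)
qed

text \<open>
  \<open>R a\<close> is the set of predecessors of \<open>a\<close>. An uncountable set \<open>A\<close> has a countable infinite
  subset; since initial segments are countable, some element of \<open>A\<close> lies above that whole subset.
\<close>

lemma omega1_ladder:
  obtains R :: "nat set \<Rightarrow> nat set set" and e :: "nat set \<Rightarrow> nat set \<Rightarrow> nat"
  where "\<And>a. R a \<subseteq> omega1 - {a}" "\<And>a. a \<in> omega1 \<Longrightarrow> inj_on (e a) (R a)"
    "\<And>A. uncountable A \<Longrightarrow> A \<subseteq> omega1 \<Longrightarrow> \<exists>a\<in>A. infinite (R a \<inter> A)"
proof -
  let ?r = "cardSuc natLeq"
  have C: "Card_order ?r" by (rule cardSuc_Card_order[OF natLeq_Card_order])
  then have W: "Well_order ?r" unfolding card_order_on_def by blast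
  define R where "R = underS ?r"
  have Rsub: "R a \<subseteq> omega1 - {a}" for a
    unfolding R_def omega1_def underS_def Field_def by auto
  have Rc: "countable (R a)" if "a \<in> omega1" for a
  proof -
    have "|R a| <o ?r" unfolding R_def using C that by (simp add: card_of_underS omega1_def)
    then have "|R a| \<le>o natLeq"
      using cardSuc_ordLeq_ordLess[OF natLeq_Card_order card_of_Card_order] by blast
    then show ?thesis using countable_card_le_natLeq by blast
  qed
  have "\<exists>a\<in>A. infinite (R a \<inter> A)" if A: "uncountable A" "A \<subseteq> omega1" for A
  proof -
    have "infinite A" using A(1) countable_finite by blast
    then obtain B where B: "B \<subseteq> A" "infinite B" "countable B" using infinite_countable_subset' by blast
    have "countable (B \<union> (\<Union>b\<in>B. R b))" using B A by (intro countable_Un countable_UN Rc) auto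
    then have "\<not> A \<subseteq> B \<union> (\<Union>b\<in>B. R b)" using A(1) by (meson countable_subset)
    then obtain a where a: "a \<in> A" "a \<notin> B" "\<And>b. b \<in> B \<Longrightarrow> a \<notin> R b" by blast
    have "B \<subseteq> R a \<inter> A"
    proof
      fix b assume b: "b \<in> B"
      then have "a \<in> Field ?r" "b \<in> Field ?r" "a \<noteq> b" using a A B by (auto simp: omega1_def)
      then have "(a, b) \<in> ?r \<or> (b, a) \<in> ?r"
        using W unfolding order_on_defs total_on_def by blast
      then have "b \<in> R a" using a(3)[OF b] \<open>a \<noteq> b\<close> unfolding R_def underS_def by blast
      then show "b \<in> R a \<inter> A" using b B by blast
    qed
    then show ?thesis using a(1) B(2) finite_subset by blast
  qed
  moreover have "inj_on (to_nat_on (R a)) (R a)" if "a \<in> omega1" for a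
    using Rc[OF that] by (rule inj_on_to_nat_on)
  ultimately show thesis using that[of R "\<lambda>a. to_nat_on (R a)"] Rsub by simp
qed

text \<open>
  Empty sets fill the unused indices, so a fan indexed by any set that injects into \<open>\<omega>\<^sub>1\<close> is enough.
\<close>

lemma Fin_fan_reindex_omega1:
  assumes F: "Fin_fan T I F" and g: "inj_on g I" "g ` I \<subseteq> omega1"
  shows "\<exists>F. Fin_fan T omega1 F"
proof -
  define F' where "F' a = (if a \<in> g ` I then F (the_inv_into I g a) else {})" for a
  have F'g: "F' (g i) = F i" if "i \<in> I" for i
    using that g(1) by (simp add: F'_def the_inv_into_f_f)
  have hit: "{a \<in> omega1. F' a \<inter> S \<noteq> {}} = g ` {i \<in> I. F i \<inter> S \<noteq> {}}" for S
  proof (rule subset_antisym)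
    show "{a \<in> omega1. F' a \<inter> S \<noteq> {}} \<subseteq> g ` {i \<in> I. F i \<inter> S \<noteq> {}}"
    proof
      fix a assume "a \<in> {a \<in> omega1. F' a \<inter> S \<noteq> {}}"
      then obtain y where a: "y \<in> F' a" "y \<in> S" by blast
      then obtain i where "i \<in> I" "a = g i" by (auto simp: F'_def split: if_splits)
      then show "a \<in> g ` {i \<in> I. F i \<inter> S \<noteq> {}}" using a F'g by blast
    qed
    show "g ` {i \<in> I. F i \<inter> S \<noteq> {}} \<subseteq> {a \<in> omega1. F' a \<inter> S \<noteq> {}}"
      using g(2) F'g by blast
  qed
  have fin: "finite {a \<in> omega1. F' a \<inter> S \<noteq> {}} \<longleftrightarrow> finite {i \<in> I. F i \<inter> S \<noteq> {}}" for S
    unfolding hit using g(1) by (intro finite_image_iff) (auto simp: inj_on_def)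
  have "finite (F' a) \<and> F' a \<subseteq> topspace T" for a
    using F F'g unfolding Fin_fan_def by (cases "a \<in> g ` I") (auto simp: F'_def the_inv_into_f_f[OF g(1)])
  then have "Fin_fan T omega1 F'"
    using F unfolding Fin_fan_def compact_finite_family_def locally_finite_family_def fin by blast
  then show ?thesis by blast
qed

lemma eventually_PA_differences:
  assumes "limitin X s p sequentially" "openin (PA_topology X) U" "0 \<in> U"
  shows "\<exists>N. \<forall>n\<ge>N. frag_of (s n) - frag_of p \<in> U"
proof -
  let ?P = "PA_topology X"
  have p: "p \<in> topspace X" using assms(1) by (rule limitin_topspace)
  have "openin ?P ((\<lambda>h. frag_of p + h) ` U)"
    using assms(2) p by (intro openin_PA_translation) auto
  moreover have "limitin ?P (frag_of \<circ> s) (frag_of p) sequentially"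
    by (rule continuous_map_limit[OF continuous_frag_of assms(1)])
  moreover have "frag_of p \<in> (\<lambda>h. frag_of p + h) ` U" using assms(3) by (rule rev_image_eqI) simp
  ultimately obtain N where N: "\<forall>n\<ge>N. frag_of (s n) \<in> (\<lambda>h. frag_of p + h) ` U"
    unfolding limitin_sequentially by (auto simp: o_def)
  have "frag_of (s n) - frag_of p \<in> U" if "n \<ge> N" for n
    using N that by force
  then show ?thesis by blast
qed

text \<open>
  Given a neighbourhood of zero, each sequence \<open>s a\<close> has a threshold beyond which
  \<open>s a n - p a\<close> is small. Uncountably many \<open>a\<close> share the threshold \<open>k\<close>, and one of them has infinitely many
  predecessors \<open>b\<close> among them; for all but finitely many of these the injection \<open>e a\<close> has a value of at least \<open>k\<close> at
  \<open>b\<close>. So infinitely many of the elements are in the neighbourhood. Compact-finiteness is left as the hypothesis \<open>cf\<close>, reduced to sequences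
  of pairs with distinct first entries; \<open>M\<close> allows finitely many terms of both sequences
  to be discarded for each pair.
\<close>

lemma omega1_fan_in_PA:
  fixes X :: "'a topology" and p :: "nat set \<Rightarrow> 'a" and s :: "nat set \<Rightarrow> nat \<Rightarrow> 'a"
    and M :: "nat set \<Rightarrow> nat set \<Rightarrow> nat"
  assumes lim: "\<And>a. a \<in> omega1 \<Longrightarrow> limitin X (s a) (p a) sequentially"
    and sX: "\<And>a n. a \<in> omega1 \<Longrightarrow> s a n \<in> topspace X"
    and cf: "\<And>C a b n. compactin (PA_topology X) C \<Longrightarrow> inj a \<Longrightarrow>
       (\<And>i::nat. a i \<in> omega1 \<and> b i \<in> omega1 \<and> a i \<noteq> b i \<and>
         M (a i) (b i) \<le> n i \<and> M (b i) (a i) \<le> n i \<and>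
         (frag_of (s (a i) (n i)) - frag_of (p (a i))) + (frag_of (s (b i) (n i)) - frag_of (p (b i))) \<in> C)
       \<Longrightarrow> False"
  shows "\<exists>F. Fin_fan (PA_topology X) omega1 F"
proof -
  let ?P = "PA_topology X"
  obtain R :: "nat set \<Rightarrow> nat set set" and e :: "nat set \<Rightarrow> nat set \<Rightarrow> nat"
    where R: "\<And>a. R a \<subseteq> omega1 - {a}" and e: "\<And>a. a \<in> omega1 \<Longrightarrow> inj_on (e a) (R a)"
    and inf: "\<And>A. uncountable A \<Longrightarrow> A \<subseteq> omega1 \<Longrightarrow> \<exists>a\<in>A. infinite (R a \<inter> A)"
    using omega1_ladder by metis
  define d where "d a n = frag_of (s a n) - frag_of (p a)" for a n
  define m where "m a b = e a b + M a b + M b a" for a b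
  define z where "z = (\<lambda>(a, b). d a (m a b) + d b (m a b))"
  define J where "J = (SIGMA a:omega1. R a)"
  have J: "J \<subseteq> omega1 \<times> omega1" using R unfolding J_def by blast
  have dX: "keys (d a n) \<subseteq> topspace X" if "a \<in> omega1" for a n
    unfolding d_def using sX[OF that] limitin_topspace[OF lim[OF that]]
    by (intro keys_diff_subset) auto
  have zX: "keys (z j) \<subseteq> topspace X" if "j \<in> J" for j
  proof -
    obtain a b where j: "j = (a, b)" "a \<in> omega1" "b \<in> omega1" using \<open>j \<in> J\<close> J by blast
    show ?thesis unfolding j(1) z_def prod.case by (intro keys_add_subset dX j)
  qed
  have "finite {j \<in> J. z j \<in> C}" if C: "compactin ?P C" for C
  proof (rule ccontr)
    define Q where "Q = {j \<in> J. z j \<in> C}"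
    assume "infinite {j \<in> J. z j \<in> C}"
    then have Q: "infinite Q" by (simp add: Q_def)
    have Qj: "a \<in> omega1 \<and> b \<in> omega1 \<and> a \<noteq> b \<and> d a (m a b) + d b (m a b) \<in> C" if "(a, b) \<in> Q" for a b
    proof -
      have "(a, b) \<in> J" "z (a, b) \<in> C" using that by (simp_all add: Q_def)
      then have "a \<in> omega1" "b \<in> R a" "d a (m a b) + d b (m a b) \<in> C"
        by (simp_all add: J_def z_def)
      then show ?thesis using R[of a] by auto
    qed
    have "Q \<subseteq> fst ` Q \<times> snd ` Q" by force
    then have "infinite (fst ` Q) \<or> infinite (snd ` Q)"
      using Q by (meson finite_SigmaI finite_subset)
    then show False
    proof
      assume "infinite (fst ` Q)"
      then obtain a :: "nat \<Rightarrow> nat set" where a: "inj a" "range a \<subseteq> fst ` Q"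
        by (meson infinite_countable_subset)
      have "\<exists>b. (a i, b) \<in> Q" for i
      proof -
        have "a i \<in> fst ` Q" using a(2) by (rule subsetD) simp
        then obtain j where "j \<in> Q" "a i = fst j" by blast
        then have "(a i, snd j) \<in> Q" by simp
        then show ?thesis by (rule exI)
      qed
      then obtain b where b: "\<And>i. (a i, b i) \<in> Q" by meson
      show False
        by (rule cf[OF C a(1), of b "\<lambda>i. m (a i) (b i)"])
          (use Qj[OF b] in \<open>auto simp: m_def d_def\<close>)
    next
      assume "infinite (snd ` Q)"
      then obtain b :: "nat \<Rightarrow> nat set" where b: "inj b" "range b \<subseteq> snd ` Q"
        by (meson infinite_countable_subset)
      have "\<exists>a. (a, b i) \<in> Q" for i
      proof -
        have "b i \<in> snd ` Q" using b(2) by (rule subsetD) simp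
        then obtain j where "j \<in> Q" "b i = snd j" by blast
        then have "(fst j, b i) \<in> Q" by simp
        then show ?thesis by (rule exI)
      qed
      then obtain a where a: "\<And>i. (a i, b i) \<in> Q" by meson
      show False
        by (rule cf[OF C b(1), of a "\<lambda>i. m (a i) (b i)"])
          (use Qj[OF a] in \<open>auto simp: m_def d_def add.commute\<close>)
    qed
  qed
  then have cff: "compact_finite_family ?P J (\<lambda>j. {z j})"
    by (simp add: compact_finite_family_def)
  have "infinite {j \<in> J. z j \<in> U}" if U: "openin ?P U" "0 \<in> U" for U
  proof -
    obtain A B where AB: "openin ?P A" "openin ?P B" "0 \<in> A" "0 \<in> B"
        "\<And>x y. x \<in> A \<Longrightarrow> y \<in> B \<Longrightarrow> x + y \<in> U"
      using openin_PA_add[OF U(1), of 0 0] U(2) by auto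
    have "\<exists>N. \<forall>n\<ge>N. d a n \<in> A \<inter> B" if "a \<in> omega1" for a
      unfolding d_def using AB lim[OF that] by (intro eventually_PA_differences) auto
    then obtain N where N: "\<And>a n. a \<in> omega1 \<Longrightarrow> N a \<le> n \<Longrightarrow> d a n \<in> A \<inter> B" by metis
    have "uncountable omega1"
    proof
      assume "countable omega1"
      then have "|omega1| \<le>o natLeq" using countable_card_le_natLeq by blast
      then have "cardSuc natLeq \<le>o natLeq"
        using ordIso_symmetric[OF card_of_omega1] ordIso_ordLeq_trans by blast
      then show False
        using cardSuc_greater[OF natLeq_Card_order] not_ordLess_ordLeq by blast
    qed
    moreover have "omega1 = (\<Union>k::nat. {a \<in> omega1. N a \<le> k})" by auto
    ultimately have "\<not> (\<forall>k::nat. countable {a \<in> omega1. N a \<le> k})"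
      using countable_UN[of "UNIV :: nat set" "\<lambda>k. {a \<in> omega1. N a \<le> k}"] by auto
    then obtain k :: nat where k: "uncountable {a \<in> omega1. N a \<le> k}" by blast
    let ?A = "{a \<in> omega1. N a \<le> k}"
    obtain a where a: "a \<in> ?A" "infinite (R a \<inter> ?A)" using inf[OF k] by blast
    have "finite {b \<in> R a. e a b < k}"
    proof (rule inj_on_finite)
      show "inj_on (e a) {b \<in> R a. e a b < k}" using e[of a] a(1) by (auto intro: inj_on_subset)
      show "e a ` {b \<in> R a. e a b < k} \<subseteq> {..<k}" by auto
    qed simp
    then have "infinite ((R a \<inter> ?A) - {b \<in> R a. e a b < k})" using a(2) by (rule Diff_infinite_finite)
    moreover have "Pair a ` ((R a \<inter> ?A) - {b \<in> R a. e a b < k}) \<subseteq> {j \<in> J. z j \<in> U}"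
    proof (rule image_subsetI)
      fix b assume "b \<in> R a \<inter> ?A - {b \<in> R a. e a b < k}"
      then have b: "b \<in> R a" "\<not> e a b < k" "b \<in> omega1" "N b \<le> k" by auto
      then have "k \<le> m a b" by (simp add: m_def)
      then have "d a (m a b) \<in> A" "d b (m a b) \<in> B" using N[of a "m a b"] N[of b "m a b"] a(1) b by auto
      then have "z (a, b) \<in> U" using AB(5) by (simp add: z_def)
      then show "(a, b) \<in> {j \<in> J. z j \<in> U}" using a(1) b by (simp add: J_def)
    qed
    moreover have "inj (Pair a)" by (simp add: inj_def)
    ultimately show ?thesis
      by (meson finite_imageD finite_subset inj_on_subset subset_UNIV)
  qed
  then have "\<not> locally_finite_family ?P J (\<lambda>j. {z j})"
    unfolding locally_finite_family_def by force
  then have fan: "Fin_fan ?P J (\<lambda>j. {z j})"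
    using cff zX unfolding Fin_fan_def by auto
  have "infinite omega1"
    unfolding omega1_def using Field_cardSuc_not_empty natLeq_Card_order
    by (simp add: cardSuc_finite Field_natLeq)
  then have "|omega1 \<times> omega1| =o |omega1|" by (rule card_of_Times_same_infinite)
  then obtain g where g: "bij_betw g (omega1 \<times> omega1) omega1" using card_of_ordIso by blast
  have "inj_on g J" using bij_betw_imp_inj_on[OF g] J by (rule inj_on_subset)
  moreover have "g ` J \<subseteq> omega1" using image_mono[OF J, of g] bij_betw_imp_surj_on[OF g] by simp
  ultimately show ?thesis by (rule Fin_fan_reindex_omega1[OF fan])
qed

section \<open>Sequences and disjoint neighbourhoods\<close>

lemma continuous_map_indicator:
  assumes "openin Y S" "openin Y (topspace Y - S)"
  shows "continuous_map Y euclideanreal (\<lambda>x. if x \<in> S then c else d)"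
  unfolding continuous_map_def
proof (intro conjI allI impI)
  fix U :: "real set" assume "openin euclideanreal U"
  have "{x \<in> topspace Y. (if x \<in> S then c else d) \<in> U} =
     (if c \<in> U then S else {}) \<union> (if d \<in> U then topspace Y - S else {})"
    using openin_subset[OF assms(1)] by auto
  then show "openin Y {x \<in> topspace Y. (if x \<in> S then c else d) \<in> U}"
    using assms by auto
qed simp

lemma kR_space_openin:
  assumes X: "kR_space X" and L: "L \<subseteq> topspace X"
    and loc: "\<And>K. compactin X K \<Longrightarrow> openin (subtopology X K) (K \<inter> L) \<and> openin (subtopology X K) (K - L)"
  shows "openin X L"
proof -
  let ?f = "\<lambda>x. if x \<in> L then 1 else 0 :: real"
  have "continuous_map (subtopology X K) euclideanreal ?f" if K: "compactin X K" for K
  proof -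
    have KX: "K \<subseteq> topspace X" by (rule compactin_subset_topspace[OF K])
    then have "topspace (subtopology X K) = K" by auto
    then have "continuous_map (subtopology X K) euclideanreal (\<lambda>x. if x \<in> K \<inter> L then 1 else 0)"
      using loc[OF K] by (intro continuous_map_indicator) (auto simp: Diff_Int)
    then show ?thesis by (rule continuous_map_eq) (use KX in auto)
  qed
  then have "continuous_map X euclideanreal ?f" using X unfolding kR_space_def by blast
  then have "openin X {x \<in> topspace X. ?f x \<in> {1/2<..}}"
    by (rule openin_continuous_map_preimage) auto
  also have "{x \<in> topspace X. ?f x \<in> {1/2<..}} = L" using L by auto
  finally show ?thesis .
qed

text \<open>
  Otherwise the indicator of \<open>x\<close> would be continuous on every compact set, hence continuous.
\<close>

lemma nonisolated_in_compact:
  assumes X: "kR_space X" "t1_space X" and x: "x \<in> topspace X" "\<not> openin X {x}"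
  shows "\<exists>K. compactin X K \<and> x \<in> K \<and> x \<in> X closure_of (K - {x})"
proof (rule ccontr)
  assume no: "\<not> ?thesis"
  have n: "x \<notin> X closure_of (K - {x})" if "compactin X K" "x \<in> K" for K
    using no that by blast
  have "openin X {x}"
  proof (rule kR_space_openin[OF X(1)])
    fix K assume K: "compactin X K"
    then have KX: "K \<subseteq> topspace X" by (rule compactin_subset_topspace)
    have "openin X (topspace X - {x})" using X(2) x(1) by (simp add: t1_space_openin_delete_alt)
    moreover have "K - {x} = K \<inter> (topspace X - {x})" using KX by blast
    ultimately have 1: "openin (subtopology X K) (K - {x})"
      by (auto simp: openin_subtopology_Int2)
    have "openin (subtopology X K) (K \<inter> {x})"
    proof (cases "x \<in> K")
      case True
      let ?O = "topspace X - X closure_of (K - {x})"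
      have "K \<inter> {x} = K \<inter> ?O"
        using n[OF K True] True x KX closure_of_subset[of "K - {x}" X] by blast
      moreover have "openin X ?O" by (intro openin_diff) auto
      ultimately show ?thesis using openin_subtopology_Int2 by metis
    qed simp
    with 1 show "openin (subtopology X K) (K \<inter> {x}) \<and> openin (subtopology X K) (K - {x})" by blast
  qed (use x in simp)
  then show False using x(2) by blast
qed

lemma regular_space_shrink:
  assumes "regular_space X" "openin X U" "x \<in> U"
  shows "\<exists>W. openin X W \<and> x \<in> W \<and> X closure_of W \<subseteq> U"
proof -
  have "closedin X (topspace X - U)" "x \<in> topspace X - (topspace X - U)"
    using assms openin_subset[OF assms(2)] by auto
  then obtain W V where W: "openin X W" "openin X V" "x \<in> W" "topspace X - U \<subseteq> V" "disjnt W V"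
    using assms(1) unfolding regular_space_def by meson
  have "X closure_of W \<subseteq> topspace X - V"
    using W openin_subset[OF W(1)] by (intro closure_of_minimal) (auto simp: disjnt_def)
  then show ?thesis using W by blast
qed

lemma k_networkD:
  assumes "k_network X \<N>" "openin X U" "compactin X K" "K \<subseteq> U"
  shows "\<exists>F. finite F \<and> F \<subseteq> \<N> \<and> K \<subseteq> \<Union>F \<and> \<Union>F \<subseteq> U"
  using assms(1)[unfolded k_network_def, THEN conjunct2, rule_format, of U K] assms(2-4) by simp

text \<open>
  Only countably many network members meet \<open>K\<close>. The complements of the closures of their finite
  unions, as far as they contain \<open>x\<close>, form a countable neighbourhood base at \<open>x\<close> relative to \<open>K\<close>: a finite
  union of members covers \<open>K - U\<close> away from \<open>x\<close>. So a sequence can be chosen in the usual way.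
\<close>

lemma k_network_sequence:
  assumes N: "k_network X \<N>" "compact_countable X \<N>" and X: "regular_space X" "Hausdorff_space X"
    and K: "compactin X K" and x: "x \<in> K" "x \<in> X closure_of (A - {x})" and A: "A \<subseteq> K"
  obtains s where "range s \<subseteq> A - {x}" "limitin X s x sequentially"
proof -
  have KX: "K \<subseteq> topspace X" using K by (rule compactin_subset_topspace)
  define \<N>K where "\<N>K = {N \<in> \<N>. N \<inter> K \<noteq> {}}"
  have c: "countable \<N>K" using N(2) K unfolding compact_countable_def \<N>K_def by blast
  define \<FF> where "\<FF> = {F. finite F \<and> F \<subseteq> \<N>K \<and> x \<notin> X closure_of (\<Union>F)}"
  have "countable {F. finite F \<and> F \<subseteq> \<N>K}" using c by (rule countable_Collect_finite_subset)
  then have cF: "countable \<FF>" unfolding \<FF>_def by (rule countable_subset[rotated]) blast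
  have "{} \<in> \<FF>" by (simp add: \<FF>_def)
  then have ne: "\<FF> \<noteq> {}" by blast
  define F where "F = from_nat_into \<FF>"
  define V where "V n = topspace X - X closure_of (\<Union>(F n))" for n
  have V: "openin X (V n)" "x \<in> V n" for n
    using from_nat_into[OF ne, of n] x(1) KX unfolding V_def F_def \<FF>_def by auto
  have "\<exists>y. y \<in> A - {x} \<and> (\<forall>m\<le>n. y \<in> V m)" for n
  proof -
    have "openin X (\<Inter>m\<in>{..n}. V m)" using V(1) by (intro openin_Inter) auto
    moreover have "x \<in> (\<Inter>m\<in>{..n}. V m)" using V by blast
    ultimately show ?thesis using x(2) unfolding in_closure_of by (metis (no_types, lifting) INT_E atMost_iff)
  qed
  then obtain s where s: "\<And>n. s n \<in> A - {x}" "\<And>n m. m \<le> n \<Longrightarrow> s n \<in> V m" by metis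
  have "limitin X s x sequentially"
    unfolding limitin_sequentially
  proof (intro conjI allI impI)
    show "x \<in> topspace X" using x KX by blast
    fix U assume U: "openin X U \<and> x \<in> U"
    then obtain W where W: "openin X W" "x \<in> W" "X closure_of W \<subseteq> U"
      using regular_space_shrink[OF X(1)] by metis
    have "compactin X (K - U)" using K U by (intro compactin_Diff_open) auto
    moreover have "openin X (topspace X - X closure_of W)" by (intro openin_diff) auto
    moreover have "K - U \<subseteq> topspace X - X closure_of W" using W KX by blast
    ultimately obtain G where G: "finite G" "G \<subseteq> \<N>" "K - U \<subseteq> \<Union>G" "\<Union>G \<subseteq> topspace X - X closure_of W"
      using k_networkD[OF N(1)] by metis
    let ?G = "G \<inter> \<N>K"
    have "x \<notin> X closure_of (\<Union>?G)"
    proof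
      assume "x \<in> X closure_of (\<Union>?G)"
      then obtain y where y: "y \<in> \<Union>?G" "y \<in> W" using W(1,2) unfolding in_closure_of by blast
      have "W \<subseteq> X closure_of W" using closure_of_subset openin_subset[OF W(1)] by blast
      then show False using y G(4) by blast
    qed
    then have "?G \<in> \<FF>" using G by (simp add: \<FF>_def)
    then obtain m where m: "F m = ?G" unfolding F_def using from_nat_into_surj[OF cF] by blast
    have "s n \<in> U" if "m \<le> n" for n
    proof (rule ccontr)
      assume "s n \<notin> U"
      then have "s n \<in> K - U" using s(1) A by blast
      then obtain B where "B \<in> G" "s n \<in> B" using G by blast
      then have "s n \<in> \<Union>?G" using s(1)[of n] A unfolding \<N>K_def using G by blast
      moreover have "\<Union>?G \<subseteq> topspace X" using N(1) G unfolding k_network_def by blast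
      ultimately have "s n \<in> X closure_of (\<Union>?G)" using closure_of_subset by blast
      then show False using s(2)[OF that] m by (simp add: V_def)
    qed
    then show "\<exists>N. \<forall>n\<ge>N. s n \<in> U" by blast
  qed
  then show thesis using s(1) that by blast
qed

text \<open>
  Of two points of an infinite set \<open>B\<close> with neighbourhoods that have disjoint closures, at least one has a
  neighbourhood whose closure omits infinitely many points of \<open>B\<close>. Repeat inside the omitted part.
\<close>

lemma infinite_disjoint_open_neighbourhoods:
  assumes X: "regular_space X" "Hausdorff_space X" and A: "infinite A" "A \<subseteq> topspace X"
  obtains x U where "inj (x :: nat \<Rightarrow> 'a)" "range x \<subseteq> A" "\<And>n. openin X (U n)" "\<And>n. x n \<in> U n"
    "\<And>m n. m \<noteq> n \<Longrightarrow> U m \<inter> U n = {}"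
proof -
  have step: "\<exists>x U. x \<in> B \<and> openin X U \<and> x \<in> U \<and> infinite (B - X closure_of U)"
    if B: "infinite B" "B \<subseteq> A" for B
  proof -
    obtain u v where uv: "u \<in> B" "v \<in> B" "u \<noteq> v"
      using B(1) by (metis finite.emptyI finite_insert insert_iff subsetI finite_subset)
    then have "u \<in> topspace X" "v \<in> topspace X" using B A by auto
    then obtain P Q where PQ: "openin X P" "openin X Q" "u \<in> P" "v \<in> Q" "disjnt P Q"
      using X(2) uv(3) unfolding Hausdorff_space_def by metis
    obtain W where W: "openin X W" "u \<in> W" "X closure_of W \<subseteq> P"
      using regular_space_shrink[OF X(1) PQ(1,3)] by blast
    show ?thesis
    proof (cases "infinite (B - X closure_of W)")
      case True
      then show ?thesis using uv W by blast
    next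
      case False
      have "X closure_of Q \<subseteq> topspace X - P"
        using PQ closure_of_minimal[of Q "topspace X - P" X] openin_subset[OF PQ(2)]
        by (auto simp: disjnt_def)
      with W(3) have "B - (B - X closure_of W) \<subseteq> B - X closure_of Q" by blast
      moreover have "infinite (B - (B - X closure_of W))" using False B(1) Diff_infinite_finite by blast
      ultimately have "infinite (B - X closure_of Q)" using finite_subset by blast
      then show ?thesis using uv PQ by blast
    qed
  qed
  define Pr :: "nat \<Rightarrow> 'a set \<times> 'a \<times> 'a set \<Rightarrow> bool"
    where "Pr = (\<lambda>n (B, x, U). B \<subseteq> A \<and> x \<in> B \<and> openin X U \<and> x \<in> U \<and> infinite (B - X closure_of U))"
  define Qr :: "nat \<Rightarrow> 'a set \<times> 'a \<times> 'a set \<Rightarrow> 'a set \<times> 'a \<times> 'a set \<Rightarrow> bool"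
    where "Qr = (\<lambda>n (B, x, U) (B', x', U'). B' = B - X closure_of U)"
  have "\<exists>f. \<forall>n. Pr n (f n) \<and> Qr n (f n) (f (Suc n))"
  proof (rule dependent_nat_choice)
    obtain x U where "x \<in> A \<and> openin X U \<and> x \<in> U \<and> infinite (A - X closure_of U)"
      using step[OF A(1)] by blast
    then show "\<exists>t. Pr 0 t" by (intro exI[of _ "(A, x, U)"]) (simp add: Pr_def)
  next
    fix t and n :: nat assume t: "Pr n t"
    obtain B x U where t': "t = (B, x, U)" by (cases t)
    let ?B = "B - X closure_of U"
    have B: "infinite ?B" "?B \<subseteq> A" using t by (auto simp: Pr_def t')
    obtain x' U' where "x' \<in> ?B \<and> openin X U' \<and> x' \<in> U' \<and> infinite (?B - X closure_of U')"
      using step[OF B] by blast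
    then show "\<exists>t'. Pr (Suc n) t' \<and> Qr n t t'"
      using B by (intro exI[of _ "(?B, x', U')"]) (simp add: t' Pr_def Qr_def)
  qed
  then obtain f where f: "\<And>n. Pr n (f n)" "\<And>n. Qr n (f n) (f (Suc n))" by blast
  define B where "B n = fst (f n)" for n
  define x where "x n = fst (snd (f n))" for n
  define U where "U n = snd (snd (f n))" for n
  have B: "B n \<subseteq> A" "x n \<in> B n" "openin X (U n)" "x n \<in> U n" "B (Suc n) = B n - X closure_of (U n)" for n
    using f(1)[of n] f(2)[of n] by (auto simp: B_def x_def U_def Pr_def Qr_def case_prod_unfold)
  have Bm: "B n \<subseteq> B (Suc m)" if "m < n" for m n
    using that lift_Suc_antimono_le[of B "Suc m" n] B(5) by auto
  have cl: "x n \<notin> X closure_of (U m)" if "m < n" for m n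
    using Bm[OF that] B(2)[of n] B(5)[of m] by blast
  have UX: "U n \<subseteq> X closure_of (U n)" for n
    using closure_of_subset[OF openin_subset[OF B(3)]] .
  define V where "V n = U n - (\<Union>m\<in>{..<n}. X closure_of (U m))" for n
  have dis: "V m \<inter> V n = {}" if "m < n" for m n
  proof -
    have "V n \<inter> X closure_of (U m) = {}" using that unfolding V_def by auto
    moreover have "V m \<subseteq> X closure_of (U m)" using UX[of m] unfolding V_def by (rule order_trans[OF Diff_subset])
    ultimately show ?thesis by blast
  qed
  show thesis
  proof
    show "openin X (V n)" for n
      unfolding V_def by (intro openin_diff B(3) closedin_Union) auto
    show xV: "x n \<in> V n" for n
      unfolding V_def using B(4)[of n] cl by simp
    show disn: "V m \<inter> V n = {}" if "m \<noteq> n" for m n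
      using that dis[of m n] dis[of n m] by (metis Int_commute nat_neq_iff)
    show "inj x"
    proof (rule injI, rule ccontr)
      fix m n assume "x m = x n" "m \<noteq> n"
      then show False using xV[of m] xV[of n] disn[of m n] by auto
    qed
    show "range x \<subseteq> A"
    proof (rule image_subsetI)
      fix n show "x n \<in> A" using B(1)[of n] B(2)[of n] by (rule subsetD)
    qed
  qed
qed

section \<open>Fans forced by many non-isolated points\<close>

text \<open>
  Each of the elements that \<open>omega1_fan_in_PA\<close> uses has coefficient \<open>-1\<close> at the limit \<open>p a\<close>. Infinitely many distinct limits
  contain infinitely many with disjoint open neighbourhoods \<open>V k\<close>, which can be shrunk to
  avoid the finitely many points with positive coefficients in the \<open>k\<close>-th element. The functions
  equal to \<open>-k\<close> on \<open>V k\<close> and to \<open>0\<close> elsewhere are upper semicontinuous uniformly in \<open>k\<close>, but their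
  extensions take a value of at least \<open>k\<close> at the \<open>k\<close>-th element. Hence no compact set contains all
  these elements.
\<close>

lemma uncountable_nonisolated_imp_fan:
  assumes X: "Tychonoff_space X" "kR_space X" and N: "k_network X \<N>" "compact_countable X \<N>"
    and unc: "uncountable {x \<in> topspace X. \<not> openin X {x}}"
  shows "\<exists>F. Fin_fan (PA_topology X) omega1 F"
proof -
  have H: "Hausdorff_space X" by (rule Tychonoff_imp_Hausdorff[OF X(1)])
  have t1: "t1_space X" using X(1) by (simp add: Tychonoff_space_def)
  have reg: "regular_space X"
    using X(1) by (simp add: Tychonoff_space_def completely_regular_imp_regular_space)
  let ?X' = "{x \<in> topspace X. \<not> openin X {x}}"
  have "\<exists>s. range s \<subseteq> topspace X - {x} \<and> limitin X s x sequentially" if x: "x \<in> ?X'" for x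
  proof -
    obtain K where K: "compactin X K" "x \<in> K" "x \<in> X closure_of (K - {x})"
      using nonisolated_in_compact[OF X(2) t1, of x] x by blast
    obtain s where "range s \<subseteq> K - {x}" "limitin X s x sequentially"
      using k_network_sequence[OF N reg H K order_refl] by metis
    then show ?thesis using compactin_subset_topspace[OF K(1)] by blast
  qed
  then have "\<forall>x\<in>?X'. \<exists>s. range s \<subseteq> topspace X - {x} \<and> limitin X s x sequentially" by (rule ballI)
  from bchoice[OF this] obtain S where S: "\<forall>x\<in>?X'. range (S x) \<subseteq> topspace X - {x} \<and> limitin X (S x) x sequentially"
    by (rule exE)
  obtain p where p: "inj_on p omega1" "p ` omega1 \<subseteq> ?X'"
    using uncountable_imp_omega1_le[OF unc] by metis
  have pX': "p a \<in> ?X'" if "a \<in> omega1" for a using p(2) that by (rule image_subset_iff[THEN iffD1, rule_format])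
  define s where "s a = S (p a)" for a
  have lim: "limitin X (s a) (p a) sequentially" if "a \<in> omega1" for a
    unfolding s_def by (rule S[THEN bspec, OF pX'[OF that], THEN conjunct2])
  have sX: "s a n \<in> topspace X" "s a n \<noteq> p a" if "a \<in> omega1" for a n
    using S[THEN bspec, OF pX'[OF that], THEN conjunct1] unfolding s_def by (auto simp: image_subset_iff)
  have "\<exists>N. \<forall>n\<ge>N. s b n \<noteq> p a" if ab: "a \<in> omega1" "b \<in> omega1" "a \<noteq> b" for a b
  proof -
    have "p a \<noteq> p b" using inj_onD[OF p(1)] ab by metis
    then have pb: "p b \<in> topspace X - {p a}" using pX'[OF ab(2)] by auto
    have "openin X (topspace X - {p a})" using t1 pX'[OF ab(1)] by (simp add: t1_space_openin_delete_alt)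
    then have "\<exists>N. \<forall>n\<ge>N. s b n \<in> topspace X - {p a}"
      using lim[OF ab(2)] pb unfolding limitin_sequentially by metis
    then show ?thesis by auto
  qed
  \<comment> \<open>beyond \<open>M a b\<close> the positive point \<open>s b n\<close> does not cancel the coefficient at \<open>p a\<close>\<close>
  then obtain M where M: "\<And>a b n. a \<in> omega1 \<Longrightarrow> b \<in> omega1 \<Longrightarrow> a \<noteq> b \<Longrightarrow> M a b \<le> n \<Longrightarrow> s b n \<noteq> p a"
    by metis
  show ?thesis
  proof (rule omega1_fan_in_PA[of X s p M, OF lim sX(1)])
    fix C a b and n :: "nat \<Rightarrow> nat"
    assume C: "compactin (PA_topology X) C" and a: "inj a"
      and abn: "\<And>i::nat. a i \<in> omega1 \<and> b i \<in> omega1 \<and> a i \<noteq> b i \<and>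
         M (a i) (b i) \<le> n i \<and> M (b i) (a i) \<le> n i \<and>
         (frag_of (s (a i) (n i)) - frag_of (p (a i))) + (frag_of (s (b i) (n i)) - frag_of (p (b i))) \<in> C"
    have ao: "a i \<in> omega1" and bo: "b i \<in> omega1" and ab: "a i \<noteq> b i" and Mab: "M (a i) (b i) \<le> n i"
      and zC: "(frag_of (s (a i) (n i)) - frag_of (p (a i))) + (frag_of (s (b i) (n i)) - frag_of (p (b i))) \<in> C" for i
      using abn[of i] by auto
    have injpa: "inj (\<lambda>i. p (a i))"
    proof (rule injI)
      fix i j assume "p (a i) = p (a j)"
      then have "a i = a j" using inj_onD[OF p(1)] ao by metis
      then show "i = j" using a by (simp add: inj_eq)
    qed
    let ?A = "range (\<lambda>i. p (a i))"
    have "infinite ?A" using range_inj_infinite[OF injpa] .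
    moreover have "?A \<subseteq> topspace X" using pX'[OF ao] by auto
    ultimately obtain x U where x: "inj (x :: nat \<Rightarrow> 'a)" "range x \<subseteq> ?A" "\<And>k. openin X (U k)" "\<And>k. x k \<in> U k"
        "\<And>m k. m \<noteq> k \<Longrightarrow> U m \<inter> U k = {}"
      using infinite_disjoint_open_neighbourhoods[OF reg H] by metis
    have "\<exists>i. x k = p (a i)" for k using x(2) by auto
    then obtain i where i: "\<And>k. x k = p (a (i k))" by metis
    let ?u = "\<lambda>k. s (a (i k)) (n (i k))" and ?v = "\<lambda>k. s (b (i k)) (n (i k))"
    define V where "V k = U k - {?u k, ?v k}" for k
    have oV: "openin X (V k)" for k
    proof -
      have "closedin X {?u k, ?v k}"
        using sX(1)[OF ao] sX(1)[OF bo] t1 by (simp add: t1_space_closedin_finite)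
      then show ?thesis unfolding V_def by (intro openin_diff x(3))
    qed
    have xV: "x k \<in> V k" for k
      unfolding V_def i using x(4)[of k, unfolded i]
        sX(2)[OF ao, of "i k" "n (i k)", symmetric] M[OF ao bo ab Mab, of "i k", symmetric] by simp
    have uV: "?u k \<notin> V k" "?v k \<notin> V k" for k by (auto simp: V_def)
    have disj: "y \<in> V m \<Longrightarrow> y \<in> V k \<Longrightarrow> m = k" for y m k
      using x(5)[of m k] unfolding V_def by blast
    define \<phi> where "\<phi> k y = (if y \<in> V k then - real k else 0)" for k y
    have "equi_usc X UNIV \<phi>"
      unfolding equi_usc_def
    proof (intro ballI allI impI)
      fix z and \<epsilon> :: real assume z: "z \<in> topspace X" and \<epsilon>: "0 < \<epsilon>"
      show "\<exists>W. openin X W \<and> z \<in> W \<and> (\<forall>y\<in>W. \<forall>k\<in>UNIV. \<phi> k y \<le> \<phi> k z + \<epsilon>)"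
      proof (cases "\<exists>k. z \<in> V k")
        case True
        then obtain k where k: "z \<in> V k" by blast
        have "\<phi> j y \<le> \<phi> j z + \<epsilon>" if "y \<in> V k" for y j
        proof (cases "j = k")
          case True
          then show ?thesis using k that \<epsilon> by (simp add: \<phi>_def)
        next
          case False
          then have "z \<notin> V j" using disj[OF k, of j] by blast
          then show ?thesis using \<epsilon> by (simp add: \<phi>_def)
        qed
        then show ?thesis using k oV by blast
      next
        case False
        then have "\<phi> j y \<le> \<phi> j z + \<epsilon>" for y j using \<epsilon> by (simp add: \<phi>_def)
        then show ?thesis using z by (intro exI[of _ "topspace X"]) simp
      qed
    qed
    moreover have "\<exists>B. \<forall>k\<in>UNIV. \<bar>\<phi> k y\<bar> \<le> B" for y
    proof (cases "\<exists>k. y \<in> V k")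
      case True
      then obtain k where k: "y \<in> V k" by blast
      have "\<bar>\<phi> j y\<bar> \<le> real k" for j
        using disj[OF k, of j] by (cases "j = k") (auto simp: \<phi>_def)
      then show ?thesis by blast
    next
      case False
      then show ?thesis by (intro exI[of _ 0]) (simp add: \<phi>_def)
    qed
    ultimately obtain B where B: "\<And>g k. g \<in> C \<Longrightarrow> k \<in> UNIV \<Longrightarrow> frag_eval (\<phi> k) g \<le> B"
      using equi_usc_bounded_on_compact[OF _ _ C, of UNIV \<phi>] by metis
    obtain k :: nat where k: "B < real k" using reals_Archimedean2 by blast
    have "\<phi> k (p (a (i k))) = - real k" using xV[of k] by (simp add: \<phi>_def i)
    moreover have "\<phi> k (?u k) = 0" "\<phi> k (?v k) = 0" using uV[of k] by (simp_all add: \<phi>_def)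
    moreover have "\<phi> k y \<le> 0" for y by (simp add: \<phi>_def)
    ultimately have "frag_eval (\<phi> k) ((frag_of (?u k) - frag_of (p (a (i k)))) + (frag_of (?v k) - frag_of (p (b (i k))))) \<ge> real k"
      by simp
    then show False using B[OF zC, of k "i k"] k by simp
  qed
qed

text \<open>
  The closure is not bounded, and an open set that meets it also meets \<open>M\<close>. Indexing by an injective
  sequence turns local finiteness of the set of open sets into local finiteness of the family.
\<close>

lemma mu_complete_noncompact_closure:
  assumes mu: "mu_complete X" and M: "M \<subseteq> topspace X" "\<not> compactin X (X closure_of M)"
  shows "\<exists>(x :: nat \<Rightarrow> 'a) G. (\<forall>j. openin X (G j) \<and> x j \<in> G j \<and> x j \<in> M) \<and>
    (\<forall>z\<in>topspace X. \<exists>V. openin X V \<and> z \<in> V \<and> finite {j. G j \<inter> V \<noteq> {}})"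
proof -
  have "closedin X (X closure_of M)" by simp
  then have "\<not> bounded_in X (X closure_of M)" using mu M(2) unfolding mu_complete_def by blast
  moreover have "X closure_of M \<subseteq> topspace X" by (rule closure_of_subset_topspace)
  ultimately obtain \<U> where U: "locally_finite_in X \<U>" "infinite \<U>"
      and Uo: "\<And>U. U \<in> \<U> \<Longrightarrow> openin X U \<and> U \<inter> X closure_of M \<noteq> {}"
    unfolding bounded_in_def by auto
  obtain G :: "nat \<Rightarrow> 'a set" where G: "inj G" "range G \<subseteq> \<U>"
    using infinite_countable_subset[OF U(2)] by blast
  have GU: "G j \<in> \<U>" for j using G(2) by auto
  have "G j \<inter> M \<noteq> {}" for j
    using Uo[OF GU, of j] openin_Int_closure_of_eq_empty by metis
  then have "\<exists>x. x \<in> G j \<and> x \<in> M" for j by blast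
  then obtain x where x: "\<And>j. x j \<in> G j \<and> x j \<in> M" by metis
  show ?thesis
  proof (intro exI[of _ x] exI[of _ G] conjI ballI)
    fix z assume "z \<in> topspace X"
    then obtain V where V: "openin X V" "z \<in> V" "finite {U \<in> \<U>. U \<inter> V \<noteq> {}}"
      using U(1) unfolding locally_finite_in_def by blast
    have "finite (G -` {U \<in> \<U>. U \<inter> V \<noteq> {}})" using V(3) G(1) by (rule finite_vimageI)
    moreover have "{j. G j \<inter> V \<noteq> {}} \<subseteq> G -` {U \<in> \<U>. U \<inter> V \<noteq> {}}" using GU by auto
    ultimately have "finite {j. G j \<inter> V \<noteq> {}}" by (rule finite_subset[rotated])
    then show "\<exists>V. openin X V \<and> z \<in> V \<and> finite {j. G j \<inter> V \<noteq> {}}" using V by blast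
  qed (use Uo[OF GU] x in auto)
qed

text \<open>
  The positive points \<open>s a n\<close> of infinitely many fan elements lie in distinct sequences, so their
  closure is not compact and infinitely many of them have a locally finite family of neighbourhoods. The
  functionals that multiply the coefficient at the \<open>j\<close>-th of these points by \<open>j\<close> have no common bound on the
  fan, as \<open>x\<close> differs from all these points.
\<close>

lemma common_limit_imp_fan:
  fixes x :: 'a
  assumes X: "t1_space X" "mu_complete X"
    and lim: "\<And>a. a \<in> omega1 \<Longrightarrow> limitin X (s a) x sequentially"
    and sX: "\<And>a n. a \<in> omega1 \<Longrightarrow> s a n \<in> topspace X - {x}"
    and disj: "\<And>a b m n. a \<in> omega1 \<Longrightarrow> b \<in> omega1 \<Longrightarrow> s a m = s b n \<Longrightarrow> a = b"
    and cf: "\<And>K. compactin X K \<Longrightarrow> finite {a \<in> omega1. \<exists>n. s a n \<in> K}"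
  shows "\<exists>F. Fin_fan (PA_topology X) omega1 F"
proof (rule omega1_fan_in_PA[of X s "\<lambda>_. x" "\<lambda>_ _. 0", OF lim])
  show "s a n \<in> topspace X" if "a \<in> omega1" for a n using sX[OF that] by blast
  fix C a b and n :: "nat \<Rightarrow> nat"
  assume C: "compactin (PA_topology X) C" and a: "inj a"
    and abn: "\<And>i::nat. a i \<in> omega1 \<and> b i \<in> omega1 \<and> a i \<noteq> b i \<and> 0 \<le> n i \<and> 0 \<le> n i \<and>
         (frag_of (s (a i) (n i)) - frag_of x) + (frag_of (s (b i) (n i)) - frag_of x) \<in> C"
  have ao: "a i \<in> omega1"
    and zC: "(frag_of (s (a i) (n i)) - frag_of x) + (frag_of (s (b i) (n i)) - frag_of x) \<in> C" for i
    using abn[of i] by auto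
  let ?y = "\<lambda>i. s (a i) (n i)"
  have yX: "range ?y \<subseteq> topspace X" using sX[OF ao] by auto
  have "\<not> compactin X (X closure_of (range ?y))"
  proof
    assume "compactin X (X closure_of (range ?y))"
    then have "finite {c \<in> omega1. \<exists>n. s c n \<in> X closure_of (range ?y)}" by (rule cf)
    moreover have "range a \<subseteq> {c \<in> omega1. \<exists>n. s c n \<in> X closure_of (range ?y)}"
      using ao closure_of_subset[OF yX] by auto
    ultimately have "finite (range a)" by (rule finite_subset[rotated])
    then show False using range_inj_infinite[OF a] by blast
  qed
  from mu_complete_noncompact_closure[OF X(2) yX this]
  obtain w :: "nat \<Rightarrow> 'a" and G where wG: "\<forall>j. openin X (G j) \<and> w j \<in> G j \<and> w j \<in> range ?y"
    and G: "\<forall>z\<in>topspace X. \<exists>V. openin X V \<and> z \<in> V \<and> finite {j. G j \<inter> V \<noteq> {}}"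
    by (elim exE conjE)
  have w: "\<And>j. w j \<in> G j" "\<And>j. w j \<in> range ?y" using wG by simp_all
  have "\<exists>i. w j = ?y i" for j using w(2)[of j] by auto
  then obtain i where i: "\<And>j. w j = ?y (i j)" by metis
  have wX: "w j \<in> topspace X - {x}" for j unfolding i by (rule sX[OF ao])
  have G': "\<exists>V. openin X V \<and> z \<in> V \<and> finite {j. w j \<in> V}" if zX: "z \<in> topspace X" for z
  proof -
    obtain V where V: "openin X V" "z \<in> V" "finite {j. G j \<inter> V \<noteq> {}}" using bspec[OF G zX] by blast
    have "{j. w j \<in> V} \<subseteq> {j. G j \<inter> V \<noteq> {}}" using w(1) by auto
    then have "finite {j. w j \<in> V}" using V(3) by (rule finite_subset)
    then show ?thesis using V by blast
  qed
  define \<phi> where "\<phi> j y = (if y = w j then real j else 0)" for j y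
  have "equi_usc X UNIV \<phi>"
    unfolding equi_usc_def
  proof (intro ballI allI impI)
    fix z and \<epsilon> :: real assume z: "z \<in> topspace X" and \<epsilon>: "0 < \<epsilon>"
    obtain V where V: "openin X V" "z \<in> V" "finite {j. w j \<in> V}" using G'[OF z] by blast
    let ?D = "w ` {j. w j \<in> V} - {z}"
    have "finite ?D" "?D \<subseteq> topspace X" using V(3) wX by auto
    then have "closedin X ?D" using X(1) unfolding t1_space_closedin_finite by blast
    then have "openin X (V - ?D)" by (rule openin_diff[OF V(1)])
    moreover have "\<phi> j y \<le> \<phi> j z + \<epsilon>" if "y \<in> V - ?D" for y j
      using that \<epsilon> by (auto simp: \<phi>_def)
    ultimately show "\<exists>W. openin X W \<and> z \<in> W \<and> (\<forall>y\<in>W. \<forall>k\<in>UNIV. \<phi> k y \<le> \<phi> k z + \<epsilon>)"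
      using V(2) by (intro exI[of _ "V - ?D"]) simp
  qed
  moreover have "\<exists>B. \<forall>k\<in>UNIV. \<bar>\<phi> k y\<bar> \<le> B" if y: "y \<in> topspace X" for y
  proof -
    obtain V where V: "openin X V" "y \<in> V" "finite {j. w j \<in> V}" using G'[OF y] by blast
    have "\<bar>\<phi> k y\<bar> \<le> real (\<Sum>j\<in>{j. w j \<in> V}. j)" for k
      using V(2,3) member_le_sum[of k "{j. w j \<in> V}" "\<lambda>j. j"] by (auto simp: \<phi>_def simp del: of_nat_sum)
    then show ?thesis by blast
  qed
  ultimately obtain B where B: "\<And>g k. g \<in> C \<Longrightarrow> k \<in> UNIV \<Longrightarrow> frag_eval (\<phi> k) g \<le> B"
    using equi_usc_bounded_on_compact[OF _ _ C, of UNIV \<phi>] by metis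
  obtain k :: nat where k: "B < real k" using reals_Archimedean2 by blast
  have "\<phi> k (?y (i k)) = real k" by (simp add: \<phi>_def i)
  moreover have "\<phi> k x = 0" using wX[of k] by (auto simp: \<phi>_def)
  moreover have "\<phi> k y \<ge> 0" for y by (simp add: \<phi>_def)
  ultimately have "frag_eval (\<phi> k) ((frag_of (?y (i k)) - frag_of x) + (frag_of (s (b (i k)) (n (i k))) - frag_of x)) \<ge> real k"
    by simp
  then show False using B[OF zC, of k "i k"] k by simp
qed

section \<open>Strong fans forced by non-compact network members\<close>

text \<open>
  Nonnegative continuous functions of which, locally, only finitely many exceed a given positive number
  form a family to which \<open>equi_usc_bounded_on_compact\<close> applies.
\<close>

lemma vanishing_family_bounded:
  assumes cont: "\<And>i. i \<in> I \<Longrightarrow> continuous_map X euclideanreal (\<phi> i)"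
    and pos: "\<And>i y. i \<in> I \<Longrightarrow> 0 \<le> \<phi> i y"
    and van: "\<And>z \<epsilon>. z \<in> topspace X \<Longrightarrow> 0 < \<epsilon> \<Longrightarrow>
       \<exists>V. openin X V \<and> z \<in> V \<and> finite {i \<in> I. \<exists>y\<in>V. \<epsilon> < \<phi> i y}"
    and C: "compactin (PA_topology X) C"
  obtains B where "\<And>g i. g \<in> C \<Longrightarrow> i \<in> I \<Longrightarrow> frag_eval (\<phi> i) g \<le> B"
proof -
  have "equi_usc X I \<phi>"
    unfolding equi_usc_def
  proof (intro ballI allI impI)
    fix z and \<epsilon> :: real assume z: "z \<in> topspace X" and \<epsilon>: "0 < \<epsilon>"
    obtain V where V: "openin X V" "z \<in> V" "finite {i \<in> I. \<exists>y\<in>V. \<epsilon> < \<phi> i y}"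
      using van[OF z \<epsilon>] by blast
    let ?J = "{i \<in> I. \<exists>y\<in>V. \<epsilon> < \<phi> i y}"
    define W where "W i = {y \<in> topspace X. \<phi> i y \<in> {..< \<phi> i z + \<epsilon>}}" for i
    have "openin X (W i)" if "i \<in> ?J" for i
      unfolding W_def using that by (intro openin_continuous_map_preimage[OF cont]) auto
    then have "openin X ((\<Inter>i\<in>?J. W i) \<inter> topspace X)" using V(3) by (intro openin_INT) auto
    then have o: "openin X (V \<inter> ((\<Inter>i\<in>?J. W i) \<inter> topspace X))" using V(1) by (rule openin_Int[rotated])
    have "\<phi> i y \<le> \<phi> i z + \<epsilon>" if y: "y \<in> V \<inter> ((\<Inter>i\<in>?J. W i) \<inter> topspace X)" and i: "i \<in> I" for y i
    proof (cases "i \<in> ?J")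
      case True
      then have "y \<in> W i" using y by blast
      then show ?thesis by (simp add: W_def)
    next
      case False
      moreover have "y \<in> V" using y by (rule IntD1)
      ultimately have "\<not> \<epsilon> < \<phi> i y" using i by blast
      then show ?thesis using pos[OF i, of z] by simp
    qed
    moreover have "z \<in> V \<inter> ((\<Inter>i\<in>?J. W i) \<inter> topspace X)" using V(2) z \<epsilon> by (auto simp: W_def)
    ultimately show "\<exists>W. openin X W \<and> z \<in> W \<and> (\<forall>y\<in>W. \<forall>i\<in>I. \<phi> i y \<le> \<phi> i z + \<epsilon>)"
      using o by (intro exI[of _ "V \<inter> ((\<Inter>i\<in>?J. W i) \<inter> topspace X)"] conjI ballI)
  qed
  moreover have "\<exists>B. \<forall>i\<in>I. \<bar>\<phi> i z\<bar> \<le> B" if z: "z \<in> topspace X" for z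
  proof -
    obtain V where V: "openin X V" "z \<in> V" "finite {i \<in> I. \<exists>y\<in>V. 1 < \<phi> i y}"
      using van[OF z, of 1] by auto
    let ?J = "{i \<in> I. \<exists>y\<in>V. 1 < \<phi> i y}"
    have "\<bar>\<phi> i z\<bar> \<le> (\<Sum>i\<in>?J. \<phi> i z) + 1" if i: "i \<in> I" for i
    proof (cases "i \<in> ?J")
      case True
      then have "\<phi> i z \<le> (\<Sum>i\<in>?J. \<phi> i z)" using V(3) pos by (intro member_le_sum) auto
      then show ?thesis using pos[OF i, of z] by simp
    next
      case False
      then have "\<not> 1 < \<phi> i z" using i V(2) by blast
      moreover have "0 \<le> (\<Sum>i\<in>?J. \<phi> i z)" using pos by (intro sum_nonneg) auto
      ultimately show ?thesis using pos[OF i, of z] by simp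
    qed
    then show ?thesis by blast
  qed
  ultimately show thesis using equi_usc_bounded_on_compact[OF _ _ C, of I \<phi>] that by metis
qed

lemma R_open_superlevel:
  assumes f: "continuous_map Y euclideanreal f" and g: "continuous_map Y euclideanreal g"
  shows "R_open Y {y \<in> topspace Y. c < f y \<and> d < g y}"
  unfolding R_open_def
proof (intro conjI ballI)
  let ?U = "{y \<in> topspace Y. c < f y \<and> d < g y}"
  fix y assume y: "y \<in> ?U"
  define m where "m = min (f y - c) (g y - d)"
  have m: "0 < m" using y by (simp add: m_def)
  define h where "h z = min 1 (max 0 (inverse m * min (f z - c) (g z - d)))" for z
  have "continuous_map Y euclideanreal h"
    unfolding h_def
    by (intro continuous_map_real_min continuous_map_real_max continuous_map_real_mult_left
        continuous_map_diff continuous_map_const[THEN iffD2] f g) auto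
  then have "continuous_map Y (top_of_set {0..1}) h"
    by (auto simp: continuous_map_in_subtopology h_def)
  moreover have "h y = 1" unfolding h_def m_def[symmetric] using m by simp
  moreover have "h ` (topspace Y - ?U) \<subseteq> {0}"
  proof (rule image_subsetI)
    fix z assume "z \<in> topspace Y - ?U"
    then have "min (f z - c) (g z - d) \<le> 0" by auto
    then have "inverse m * min (f z - c) (g z - d) \<le> 0" using m by (simp add: mult_le_0_iff)
    then show "h z \<in> {0}" by (simp add: h_def)
  qed
  ultimately show "\<exists>h. continuous_map Y (top_of_set {0..1::real}) h \<and> h y = 1 \<and> h ` (topspace Y - ?U) \<subseteq> {0}"
    by blast
qed auto

lemma continuous_map_frag_cmul: "continuous_map (PA_topology X) (PA_topology X) (frag_cmul (int n))"
proof (induction n)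
  case 0
  then show ?case by simp
next
  case (Suc n)
  have "continuous_map (PA_topology X) (PA_topology X) (\<lambda>g. g + frag_cmul (int n) g)"
    by (intro continuous_map_PA_add Suc) auto
  then show ?case by (rule continuous_map_eq) (simp add: frag_cmul_distrib distrib_right)
qed

text \<open>
  A locally finite family meets a compact set finitely often, so finitely many members can be dropped.
\<close>

lemma mu_complete_noncompact_closure_avoiding:
  fixes X :: "'a topology"
  assumes mu: "mu_complete X" and M: "M \<subseteq> topspace X" "\<not> compactin X (X closure_of M)" and Y: "compactin X Y"
  shows "\<exists>(x :: nat \<Rightarrow> 'a) G. \<forall>j. openin X (G j) \<and> x j \<in> G j \<and> x j \<in> M \<and> G j \<inter> Y = {} \<and>
     (\<forall>z\<in>topspace X. \<exists>V. openin X V \<and> z \<in> V \<and> finite {j. G j \<inter> V \<noteq> {}})"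
proof -
  from mu_complete_noncompact_closure[OF mu M]
  obtain x :: "nat \<Rightarrow> 'a" and G where G: "\<forall>j. openin X (G j) \<and> x j \<in> G j \<and> x j \<in> M"
     and Glf: "\<forall>z\<in>topspace X. \<exists>V. openin X V \<and> z \<in> V \<and> finite {j. G j \<inter> V \<noteq> {}}"
    by (elim exE conjE)
  from bchoice[OF Glf]
  obtain V where V': "\<forall>z\<in>topspace X. openin X (V z) \<and> z \<in> V z \<and> finite {j. G j \<inter> V z \<noteq> {}}"
    by (rule exE)
  have V: "openin X (V z)" "z \<in> V z" "finite {j. G j \<inter> V z \<noteq> {}}" if "z \<in> topspace X" for z
    using bspec[OF V' that] by simp_all
  have YX: "Y \<subseteq> topspace X" by (rule compactin_subset_topspace[OF Y])
  have "openin X (V z) \<and> z \<in> V z" if "z \<in> Y" for z using V(1,2) subsetD[OF YX that] by blast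
  from compactin_pointwise_cover[OF Y this]
  obtain D where D: "D \<subseteq> Y" "finite D" "Y \<subseteq> \<Union>(V ` D)" by blast
  have "finite {j. G j \<inter> V z \<noteq> {}}" if "z \<in> D" for z
  proof -
    have "z \<in> topspace X" using that D(1) YX by blast
    then show ?thesis by (rule V(3))
  qed
  then have "finite (\<Union>z\<in>D. {j. G j \<inter> V z \<noteq> {}})" using D(2) by blast
  moreover have "{j. G j \<inter> Y \<noteq> {}} \<subseteq> (\<Union>z\<in>D. {j. G j \<inter> V z \<noteq> {}})"
  proof
    fix j assume "j \<in> {j. G j \<inter> Y \<noteq> {}}"
    then obtain t where t: "t \<in> G j" "t \<in> Y" by blast
    then obtain z where "z \<in> D" "t \<in> V z" using D(3) by blast
    then show "j \<in> (\<Union>z\<in>D. {j. G j \<inter> V z \<noteq> {}})" using t(1) by blast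
  qed
  ultimately have "finite {j. G j \<inter> Y \<noteq> {}}" by (rule finite_subset[rotated])
  then obtain m where m: "\<And>j. G j \<inter> Y \<noteq> {} \<Longrightarrow> j < m"
    unfolding finite_nat_set_iff_bounded by blast
  have lf: "\<exists>V. openin X V \<and> z \<in> V \<and> finite {j. G (j + m) \<inter> V \<noteq> {}}" if "z \<in> topspace X" for z
  proof -
    have "finite ((\<lambda>j. j + m) -` {j. G j \<inter> V z \<noteq> {}})"
      using V(3)[OF that] by (intro finite_vimageI) auto
    then show ?thesis using V(1,2)[OF that] by (intro exI[of _ "V z"]) (simp add: vimage_def)
  qed
  have "G (j + m) \<inter> Y = {}" for j using m[of "j + m"] by auto
  then show ?thesis
    using G lf by (intro exI[of _ "\<lambda>j. x (j + m)"] exI[of _ "\<lambda>j. G (j + m)"]) simp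
qed

text \<open>
  For fixed \<open>k\<close>, local finiteness of \<open>G k\<close> lets the functions \<open>j f k j\<close> form a vanishing family, so only finitely many
  \<open>j\<close> occur. Given that, the functions \<open>h j / (k + 1)\<close> form a vanishing family on the set of pairs that
  occur, and this bounds \<open>k\<close> because \<open>(k + 1)\<^sup>2 / (k + 1)\<close> is unbounded.
\<close>

lemma far_superlevels_compact_finite:
  fixes f :: "nat \<Rightarrow> nat \<Rightarrow> 'a \<Rightarrow> real" and h :: "nat \<Rightarrow> 'a \<Rightarrow> real"
  assumes f: "\<And>k j. continuous_map X euclideanreal (f k j)" "\<And>k j t. 0 \<le> f k j t"
      "\<And>k j t. t \<notin> G k j \<Longrightarrow> f k j t = 0"
    and Glf: "\<And>z k. z \<in> topspace X \<Longrightarrow> \<exists>V. openin X V \<and> z \<in> V \<and> finite {j. G k j \<inter> V \<noteq> {}}"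
    and h: "\<And>j. continuous_map X euclideanreal (h j)" "\<And>j t. 0 \<le> h j t" "\<And>j t. h j t \<le> 1"
    and C: "compactin (PA_topology X) C"
  shows "finite {(k, j). {g \<in> topspace (PA_topology X). 1/2 < frag_eval (f k j) g \<and>
     real ((k + 1)\<^sup>2) - 1/2 < frag_eval (h j) g} \<inter> C \<noteq> {}}"
proof -
  define U where "U k j = {g \<in> topspace (PA_topology X). 1/2 < frag_eval (f k j) g \<and>
     real ((k + 1)\<^sup>2) - 1/2 < frag_eval (h j) g}" for k j
  define R where "R = {(k, j). U k j \<inter> C \<noteq> {}}"
  \<comment> \<open>if \<open>(k, j) \<in> R\<close>, the functional with weight \<open>j\<close> takes a value of at least \<open>j / 2\<close> on \<open>C\<close>\<close>
  have Rk: "finite {j. (k, j) \<in> R}" for k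
  proof -
    obtain B where B: "\<And>g j. g \<in> C \<Longrightarrow> j \<in> UNIV \<Longrightarrow> frag_eval (\<lambda>t. real j * f k j t) g \<le> B"
    proof (rule vanishing_family_bounded[OF _ _ _ C, of UNIV "\<lambda>j t. real j * f k j t"])
      show "continuous_map X euclideanreal (\<lambda>t. real j * f k j t)" for j
        by (intro continuous_map_real_mult_left f)
      show "0 \<le> real j * f k j t" for j t using f(2) by simp
      fix t and \<epsilon> :: real assume t: "t \<in> topspace X" and \<epsilon>: "0 < \<epsilon>"
      obtain V where V: "openin X V" "t \<in> V" "finite {j. G k j \<inter> V \<noteq> {}}" using Glf[OF t] by blast
      have "{j \<in> UNIV. \<exists>u\<in>V. \<epsilon> < real j * f k j u} \<subseteq> {j. G k j \<inter> V \<noteq> {}}"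
      proof
        fix j assume "j \<in> {j \<in> UNIV. \<exists>u\<in>V. \<epsilon> < real j * f k j u}"
        then obtain u where u: "u \<in> V" "\<epsilon> < real j * f k j u" by blast
        then have "f k j u \<noteq> 0" using \<epsilon> by auto
        then have "u \<in> G k j" using f(3) by blast
        then show "j \<in> {j. G k j \<inter> V \<noteq> {}}" using u(1) by blast
      qed
      then have "finite {j \<in> UNIV. \<exists>u\<in>V. \<epsilon> < real j * f k j u}" using V(3) by (rule finite_subset)
      then show "\<exists>V. openin X V \<and> t \<in> V \<and> finite {j \<in> UNIV. \<exists>u\<in>V. \<epsilon> < real j * f k j u}" using V by blast
    qed blast
    have "{j. (k, j) \<in> R} \<subseteq> {..nat \<lceil>2 * B\<rceil>}"
    proof
      fix j assume "j \<in> {j. (k, j) \<in> R}"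
      then obtain g where g: "g \<in> U k j" "g \<in> C" by (auto simp: R_def)
      have "real j * (1/2) \<le> real j * frag_eval (f k j) g" using g(1) by (intro mult_left_mono) (auto simp: U_def)
      also have "\<dots> \<le> B" using B[OF g(2), of j] by (simp add: frag_eval_scale)
      finally show "j \<in> {..nat \<lceil>2 * B\<rceil>}" by simp linarith
    qed
    then show ?thesis by (rule finite_subset) simp
  qed
  \<comment> \<open>\<open>h j\<close> is at most \<open>1\<close>, so \<open>h j / (k + 1)\<close> exceeds \<open>\<epsilon>\<close> for finitely many pairs in \<open>R\<close> only\<close>
  obtain B where B: "\<And>g p. g \<in> C \<Longrightarrow> p \<in> R \<Longrightarrow> frag_eval (\<lambda>t. 1 / (real (fst p) + 1) * h (snd p) t) g \<le> B"
  proof (rule vanishing_family_bounded[OF _ _ _ C, of R "\<lambda>p t. 1 / (real (fst p) + 1) * h (snd p) t"])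
    show "continuous_map X euclideanreal (\<lambda>t. 1 / (real (fst p) + 1) * h (snd p) t)" for p
      by (intro continuous_map_real_mult_left h)
    show "0 \<le> 1 / (real (fst p) + 1) * h (snd p) t" for p t using h(2) by simp
    fix t and \<epsilon> :: real assume t: "t \<in> topspace X" and \<epsilon>: "0 < \<epsilon>"
    let ?S = "{p \<in> R. \<exists>u\<in>topspace X. \<epsilon> < 1 / (real (fst p) + 1) * h (snd p) u}"
    have "?S \<subseteq> (SIGMA k:{..nat \<lceil>1/\<epsilon>\<rceil>}. {j. (k, j) \<in> R})"
    proof
      fix p assume "p \<in> ?S"
      then obtain k j u where p: "p = (k, j)" "(k, j) \<in> R" "\<epsilon> < 1 / (real k + 1) * h j u"
        by (cases p) auto
      have "1 / (real k + 1) * h j u \<le> 1 / (real k + 1) * 1" using h(3) by (intro mult_left_mono) auto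
      then have "\<epsilon> < 1 / (real k + 1)" using p(3) by simp
      then have "real k < 1 / \<epsilon>" using \<epsilon> by (simp add: field_simps)
      then have "k \<le> nat \<lceil>1/\<epsilon>\<rceil>" by linarith
      then show "p \<in> (SIGMA k:{..nat \<lceil>1/\<epsilon>\<rceil>}. {j. (k, j) \<in> R})" using p by simp
    qed
    moreover have "finite (SIGMA k:{..nat \<lceil>1/\<epsilon>\<rceil>}. {j. (k, j) \<in> R})" by (intro finite_SigmaI Rk) simp
    ultimately have "finite ?S" by (rule finite_subset)
    then show "\<exists>V. openin X V \<and> t \<in> V \<and> finite {p \<in> R. \<exists>u\<in>V. \<epsilon> < 1 / (real (fst p) + 1) * h (snd p) u}"
      using t by (intro exI[of _ "topspace X"]) simp
  qed blast
  have "R \<subseteq> (SIGMA k:{..nat \<lceil>B\<rceil>}. {j. (k, j) \<in> R})"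
  proof
    fix p assume pR: "p \<in> R"
    obtain k j where p: "p = (k, j)" by (cases p)
    then obtain g where g: "g \<in> U k j" "g \<in> C" using pR by (auto simp: R_def)
    have "real k * (real k + 1) \<le> real ((k + 1)\<^sup>2) - 1/2" by (simp add: power2_eq_square algebra_simps)
    also have "\<dots> < frag_eval (h j) g" using g(1) by (simp add: U_def)
    also have "frag_eval (h j) g \<le> B * (real k + 1)"
      using B[OF g(2) pR] unfolding frag_eval_scale p by (simp add: field_simps)
    finally have "real k < B" by (simp add: mult_less_cancel_right)
    then have "k \<le> nat \<lceil>B\<rceil>" by linarith
    then show "p \<in> (SIGMA k:{..nat \<lceil>B\<rceil>}. {j. (k, j) \<in> R})" using p pR by simp
  qed
  moreover have "finite (SIGMA k:{..nat \<lceil>B\<rceil>}. {j. (k, j) \<in> R})" by (intro finite_SigmaI Rk) simp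
  ultimately show ?thesis unfolding U_def[symmetric] R_def[symmetric] by (rule finite_subset)
qed

text \<open>
  Let \<open>M k\<close> enumerate the finite unions of network members that meet and together cover \<open>K\<close>. Their closures
  are not compact, so \<open>M k\<close> contains points \<open>x k j\<close> with neighbourhoods \<open>G k j\<close>, locally finite in
  \<open>j\<close>. The fan consists of \<open>z k j = x k j + (k + 1)\<^sup>2 (s j - y)\<close>; its neighbourhoods ask that the coefficients near
  \<open>x k j\<close> and near \<open>s j\<close> are large.

  The fan cannot be locally finite at all points of \<open>K\<close>: finitely many neighbourhoods that meet only finitely
  many fan elements, thickened by a common neighbourhood of zero, would cover some \<open>M k\<close>, and for that \<open>k\<close>
  the summand \<open>(k + 1)\<^sup>2 (s j - y)\<close> tends to zero as \<open>j\<close> grows.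
\<close>

lemma noncompact_network_imp_strong_fan:
  assumes X: "Tychonoff_space X" "mu_complete X" and N: "k_network X \<N>" "compact_countable X \<N>"
    and s: "limitin X s y sequentially" "range s \<subseteq> topspace X - {y}"
    and K: "compactin X K"
    and no: "\<nexists>F. finite F \<and> F \<subseteq> {N \<in> \<N>. compactin X (X closure_of N)} \<and> K \<subseteq> \<Union>F"
  shows "\<exists>F. strong_Fin_fan (PA_topology X) (UNIV :: nat set) F"
proof -
  let ?P = "PA_topology X"
  have t1: "t1_space X" using X(1) by (simp add: Tychonoff_space_def)
  have KX: "K \<subseteq> topspace X" by (rule compactin_subset_topspace[OF K])
  have yX: "y \<in> topspace X" by (rule limitin_topspace[OF s(1)])
  have sX: "s j \<in> topspace X" "s j \<noteq> y" for j using s(2) by (auto simp: image_subset_iff)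
  define \<N>K where "\<N>K = {N \<in> \<N>. N \<inter> K \<noteq> {}}"
  have cK: "countable \<N>K" using N(2) K unfolding compact_countable_def \<N>K_def by blast
  define \<FF> where "\<FF> = {F. finite F \<and> F \<subseteq> \<N>K \<and> K \<subseteq> \<Union>F}"
  have "countable {F. finite F \<and> F \<subseteq> \<N>K}" using cK by (rule countable_Collect_finite_subset)
  then have cF: "countable \<FF>" unfolding \<FF>_def by (rule countable_subset[rotated]) blast
  have fine: "\<exists>F\<in>\<FF>. \<Union>F \<subseteq> U" if U: "openin X U" "K \<subseteq> U" for U
  proof -
    obtain F where F: "finite F" "F \<subseteq> \<N>" "K \<subseteq> \<Union>F" "\<Union>F \<subseteq> U"
      using k_networkD[OF N(1) U(1) K U(2)] by metis
    have "K \<subseteq> \<Union>(F \<inter> \<N>K)"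
    proof
      fix t assume t: "t \<in> K"
      then obtain N where "N \<in> F" "t \<in> N" using F(3) by blast
      then show "t \<in> \<Union>(F \<inter> \<N>K)" using t F(2) unfolding \<N>K_def by blast
    qed
    then have "F \<inter> \<N>K \<in> \<FF>" using F(1) by (simp add: \<FF>_def)
    then show ?thesis using F(4) by blast
  qed
  have ne: "\<FF> \<noteq> {}" using fine[OF openin_topspace KX] by blast
  define M where "M k = \<Union>(from_nat_into \<FF> k)" for k
  have Mx: "\<exists>x G. \<forall>j::nat. openin X (G j) \<and> x j \<in> G j \<and> x j \<in> M k \<and> G j \<inter> insert y (range s) = {} \<and>
     (\<forall>z\<in>topspace X. \<exists>V. openin X V \<and> z \<in> V \<and> finite {j. G j \<inter> V \<noteq> {}})" for k
  proof -
    let ?F = "from_nat_into \<FF> k"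
    have F: "?F \<in> \<FF>" by (rule from_nat_into[OF ne])
    then have F': "finite ?F" "?F \<subseteq> \<N>" "K \<subseteq> \<Union>?F" unfolding \<FF>_def \<N>K_def by auto
    have MX: "M k \<subseteq> topspace X" using F'(2) N(1) unfolding M_def k_network_def by blast
    have "\<not> compactin X (X closure_of (M k))"
    proof
      assume c: "compactin X (X closure_of (M k))"
      have "compactin X (X closure_of N)" if "N \<in> ?F" for N
      proof (rule closed_compactin[OF c])
        have "N \<subseteq> M k" using that by (auto simp: M_def)
        then show "X closure_of N \<subseteq> X closure_of (M k)" by (rule closure_of_mono)
      qed simp
      then have "?F \<subseteq> {N \<in> \<N>. compactin X (X closure_of N)}" using F'(2) by blast
      then show False using no F' by blast
    qed
    moreover have "compactin X (insert y (range s))"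
      using sX by (intro compactin_sequence_with_limit[OF s(1)]) auto
    ultimately show ?thesis by (rule mu_complete_noncompact_closure_avoiding[OF X(2) MX])
  qed
  obtain x G where xG: "\<forall>k j. openin X (G k j) \<and> x k j \<in> G k j \<and> x k j \<in> M k \<and> G k j \<inter> insert y (range s) = {} \<and>
     (\<forall>z\<in>topspace X. \<exists>V. openin X V \<and> z \<in> V \<and> finite {j::nat. G k j \<inter> V \<noteq> {}})"
    using Mx by metis
  have G: "openin X (G k j)" "x k j \<in> G k j" "x k j \<in> M k" "y \<notin> G k j" "s i \<notin> G k j" for k j i
  proof -
    note q = xG[rule_format, of k j]
    show "openin X (G k j)" "x k j \<in> G k j" "x k j \<in> M k" using q by simp_all
    have "G k j \<inter> insert y (range s) = {}" using q by simp
    then show "y \<notin> G k j" "s i \<notin> G k j" by auto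
  qed
  have Glf: "\<exists>V. openin X V \<and> z \<in> V \<and> finite {j. G k j \<inter> V \<noteq> {}}" if "z \<in> topspace X" for z k
    using xG that by blast
  have xX: "x k j \<in> topspace X" for k j using openin_subset[OF G(1)] G(2) by blast
  have "\<exists>f. continuous_map X euclideanreal f \<and> f (x k j) = 1 \<and> (\<forall>y. 0 \<le> f y \<and> f y \<le> 1) \<and> (\<forall>y. y \<notin> G k j \<longrightarrow> f y = 0)" for k j
    using Tychonoff_function[OF X(1) G(1,2)] by metis
  then obtain f where "\<forall>k j. continuous_map X euclideanreal (f k j) \<and> f k j (x k j) = 1 \<and>
      (\<forall>y. 0 \<le> f k j y \<and> f k j y \<le> 1) \<and> (\<forall>y. y \<notin> G k j \<longrightarrow> f k j y = 0)" by metis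
  then have f: "continuous_map X euclideanreal (f k j)" "f k j (x k j) = 1"
      "0 \<le> f k j t" "f k j t \<le> 1" "t \<notin> G k j \<Longrightarrow> f k j t = 0" for k j t by auto
  have "\<exists>h. continuous_map X euclideanreal h \<and> h (s j) = 1 \<and> (\<forall>y. 0 \<le> h y \<and> h y \<le> 1) \<and> h y = 0" for j
  proof -
    have "openin X (topspace X - {y})" using t1 yX by (simp add: t1_space_openin_delete_alt)
    moreover have "s j \<in> topspace X - {y}" using sX by simp
    ultimately obtain h where "continuous_map X euclideanreal h" "h (s j) = 1" "\<And>y. 0 \<le> h y \<and> h y \<le> 1"
      "\<And>t. t \<notin> topspace X - {y} \<Longrightarrow> h t = 0" using Tychonoff_function[OF X(1)] by metis
    then show ?thesis by auto
  qed
  then obtain h where "\<forall>j. continuous_map X euclideanreal (h j) \<and> h j (s j) = 1 \<and> (\<forall>y. 0 \<le> h j y \<and> h j y \<le> 1) \<and> h j y = 0"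
    by metis
  then have h: "continuous_map X euclideanreal (h j)" "h j (s j) = 1" "0 \<le> h j t" "h j t \<le> 1" "h j y = 0" for j t
    by auto
  \<comment> \<open>\<open>f k j\<close> detects \<open>x k j\<close> and vanishes at \<open>y\<close> and all \<open>s i\<close>; \<open>h j\<close> detects \<open>s j\<close> and vanishes at \<open>y\<close>\<close>
  define z where "z k j = frag_of (x k j) + frag_cmul (int ((k + 1)\<^sup>2)) (frag_of (s j) - frag_of y)" for k j
  define U where "U k j = {g \<in> topspace ?P. 1/2 < frag_eval (f k j) g \<and> real ((k + 1)\<^sup>2) - 1/2 < frag_eval (h j) g}" for k j
  have zX: "keys (z k j) \<subseteq> topspace X" for k j
  proof -
    have "keys (frag_of (s j) - frag_of y) \<subseteq> topspace X" using sX yX by (intro keys_diff_subset) auto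
    then have "keys (frag_cmul (int ((k + 1)\<^sup>2)) (frag_of (s j) - frag_of y)) \<subseteq> topspace X"
      by (rule order_trans[OF keys_cmul])
    then show ?thesis unfolding z_def using xX by (intro keys_add_subset) auto
  qed
  have zU: "z k j \<in> U k j" for k j
  proof -
    have "frag_eval (f k j) (z k j) = 1" using f(2) f(5)[OF G(4)] f(5)[OF G(5)] by (simp add: z_def)
    moreover have "frag_eval (h j) (z k j) = h j (x k j) + real ((k + 1)\<^sup>2)" using h(2,5) by (simp add: z_def)
    ultimately show ?thesis using zX h(3)[of j "x k j"] by (simp add: U_def)
  qed
  have UR: "R_open ?P (U k j)" for k j
    unfolding U_def by (intro R_open_superlevel continuous_map_frag_eval f h)
  have Ufin: "finite {(k, j). U k j \<inter> C \<noteq> {}}" if "compactin ?P C" for C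
    unfolding U_def using f(1,3,5) Glf h(1,3,4) that by (rule far_superlevels_compact_finite)
  have nlf: "\<exists>g\<in>topspace ?P. \<forall>O'. openin ?P O' \<longrightarrow> g \<in> O' \<longrightarrow> infinite {(k, j). z k j \<in> O'}"
  proof (rule ccontr)
    assume "\<not> ?thesis"
    then have fin: "\<exists>O'. openin ?P O' \<and> g \<in> O' \<and> finite {(k, j). z k j \<in> O'}" if "g \<in> topspace ?P" for g
      using that by blast
    define d where "d k j = frag_cmul (int ((k + 1)\<^sup>2)) (frag_of (s j) - frag_of y)" for k j
    have "\<exists>q. openin X (fst q) \<and> a \<in> fst q \<and> openin ?P (snd q) \<and> 0 \<in> snd q \<and>
        finite {(k, j). x k j \<in> fst q \<and> d k j \<in> snd q}" if a: "a \<in> topspace X" for a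
    proof -
      obtain O' where O': "openin ?P O'" "frag_of a \<in> O'" "finite {(k, j). z k j \<in> O'}"
        using fin[of "frag_of a"] a by auto
      obtain A B where AB: "openin ?P A" "openin ?P B" "frag_of a \<in> A" "0 \<in> B"
          "\<And>u v. u \<in> A \<Longrightarrow> v \<in> B \<Longrightarrow> u + v \<in> O'"
        using openin_PA_add[OF O'(1), of "frag_of a" 0] O'(2) a by auto
      let ?V = "{t \<in> topspace X. frag_of t \<in> A}"
      have "{(k, j). x k j \<in> ?V \<and> d k j \<in> B} \<subseteq> {(k, j). z k j \<in> O'}"
        using AB(5) by (auto simp: z_def d_def)
      then have "finite {(k, j). x k j \<in> ?V \<and> d k j \<in> B}" using O'(3) by (rule finite_subset)
      moreover have "openin X ?V" by (rule openin_continuous_map_preimage[OF continuous_frag_of AB(1)])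
      ultimately show ?thesis using a AB by (intro exI[of _ "(?V, B)"]) simp
    qed
    then have "\<forall>a\<in>topspace X. \<exists>q. openin X (fst q) \<and> a \<in> fst q \<and> openin ?P (snd q) \<and> 0 \<in> snd q \<and>
        finite {(k, j). x k j \<in> fst q \<and> d k j \<in> snd q}" by (rule ballI)
    from bchoice[OF this] obtain q where
      q: "\<forall>a\<in>topspace X. openin X (fst (q a)) \<and> a \<in> fst (q a) \<and> openin ?P (snd (q a)) \<and> 0 \<in> snd (q a) \<and>
        finite {(k, j). x k j \<in> fst (q a) \<and> d k j \<in> snd (q a)}" by (rule exE)
    define V where "V a = fst (q a)" for a
    define B where "B a = snd (q a)" for a
    have V: "openin X (V a)" "a \<in> V a" and B: "openin ?P (B a)" "0 \<in> B a"
      and VB: "finite {(k, j). x k j \<in> V a \<and> d k j \<in> B a}" if "a \<in> topspace X" for a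
      using bspec[OF q that] unfolding V_def B_def by simp_all
    have "openin X (V a) \<and> a \<in> V a" if "a \<in> K" for a using V subsetD[OF KX that] by blast
    from compactin_pointwise_cover[OF K this]
    obtain D where D: "D \<subseteq> K" "finite D" "K \<subseteq> \<Union>(V ` D)" by blast
    have DX: "a \<in> topspace X" if "a \<in> D" for a using that D(1) KX by blast
    have "openin X (\<Union>(V ` D))" using V(1) DX by (intro openin_Union) auto
    from fine[OF this D(3)] obtain F where F: "F \<in> \<FF>" "\<Union>F \<subseteq> \<Union>(V ` D)" by (rule bexE)
    obtain k where k: "from_nat_into \<FF> k = F" using from_nat_into_surj[OF cF F(1)] by (rule exE)
    have Mk: "M k \<subseteq> \<Union>(V ` D)" using F(2) by (simp add: M_def k)
    define W where "W = (\<Inter>a\<in>D. B a) \<inter> topspace ?P"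
    have W: "openin ?P W" unfolding W_def by (intro openin_INT D(2) B(1) DX)
    have W0: "0 \<in> W" unfolding W_def using B(2) DX by simp
    let ?c = "frag_cmul (int ((k + 1)\<^sup>2))"
    have "openin ?P {g \<in> topspace ?P. ?c g \<in> W}"
      by (rule openin_continuous_map_preimage[OF continuous_map_frag_cmul W])
    moreover have "0 \<in> {g \<in> topspace ?P. ?c g \<in> W}" using W0 by simp
    ultimately obtain n where n: "\<forall>j\<ge>n. frag_of (s j) - frag_of y \<in> {g \<in> topspace ?P. ?c g \<in> W}"
      using eventually_PA_differences[OF s(1)] by blast
    have "Pair k ` {n..} \<subseteq> (\<Union>a\<in>D. {(k, j). x k j \<in> V a \<and> d k j \<in> B a})"
    proof (rule image_subsetI)
      fix j assume "j \<in> {n..}"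
      then have cW: "d k j \<in> W" using n by (simp add: d_def)
      have "x k j \<in> \<Union>(V ` D)" by (rule subsetD[OF Mk G(3)])
      then obtain a where a: "a \<in> D" "x k j \<in> V a" by (rule UN_E)
      have "d k j \<in> B a" using cW a(1) by (simp add: W_def)
      then show "(k, j) \<in> (\<Union>a\<in>D. {(k, j). x k j \<in> V a \<and> d k j \<in> B a})" using a by (intro UN_I[of a]) simp_all
    qed
    moreover have "finite (\<Union>a\<in>D. {(k, j). x k j \<in> V a \<and> d k j \<in> B a})" by (intro finite_UN_I D(2) VB DX)
    ultimately have "finite (Pair k ` {n..})" by (rule finite_subset)
    then have "finite {n..}" by (rule finite_imageD) (simp add: inj_on_def)
    then show False by (simp add: infinite_Ici)
  qed
  have re: "finite {i \<in> UNIV. Q (fst (prod_decode i)) (snd (prod_decode i))} \<longleftrightarrow> finite {(k, j). Q k j}" for Q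
  proof -
    have "{(k, j). Q k j} = prod_decode ` {i \<in> UNIV. Q (fst (prod_decode i)) (snd (prod_decode i))}"
    proof (intro equalityI subsetI)
      fix p assume "p \<in> {(k, j). Q k j}"
      then show "p \<in> prod_decode ` {i \<in> UNIV. Q (fst (prod_decode i)) (snd (prod_decode i))}"
        by (intro image_eqI[of _ _ "prod_encode p"]) auto
    qed (auto simp: case_prod_unfold)
    then show ?thesis by (simp add: finite_image_iff[OF inj_on_subset[OF inj_prod_decode subset_UNIV]])
  qed
  let ?F = "\<lambda>i. {z (fst (prod_decode i)) (snd (prod_decode i))}"
  let ?U = "\<lambda>i. U (fst (prod_decode i)) (snd (prod_decode i))"
  have cU: "compact_finite_family ?P UNIV ?U"
    unfolding compact_finite_family_def re[of "\<lambda>k j. U k j \<inter> C \<noteq> {}" for C] using Ufin by blast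
  have "compact_finite_family ?P UNIV ?F"
    unfolding compact_finite_family_def
  proof (intro allI impI)
    fix C assume C: "compactin ?P C"
    have "{i \<in> UNIV. ?F i \<inter> C \<noteq> {}} \<subseteq> {i \<in> UNIV. ?U i \<inter> C \<noteq> {}}" using zU by blast
    then show "finite {i \<in> UNIV. ?F i \<inter> C \<noteq> {}}"
      by (rule finite_subset) (use cU C in \<open>simp add: compact_finite_family_def\<close>)
  qed
  moreover have "\<not> locally_finite_family ?P UNIV ?F"
  proof
    assume "locally_finite_family ?P UNIV ?F"
    moreover obtain g where g: "g \<in> topspace ?P" "\<And>O'. openin ?P O' \<Longrightarrow> g \<in> O' \<Longrightarrow> infinite {(k, j). z k j \<in> O'}"
      using nlf by metis
    ultimately obtain O' where O': "openin ?P O'" "g \<in> O'" "finite {i \<in> UNIV. ?F i \<inter> O' \<noteq> {}}"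
      unfolding locally_finite_family_def by blast
    then have "finite {i \<in> UNIV. z (fst (prod_decode i)) (snd (prod_decode i)) \<in> O'}" by simp
    then show False using re[of "\<lambda>k j. z k j \<in> O'"] g(2)[OF O'(1,2)] by blast
  qed
  ultimately have "Fin_fan ?P UNIV ?F" using zX by (simp add: Fin_fan_def)
  then have "strong_Fin_fan ?P UNIV ?F"
    unfolding strong_Fin_fan_def using cU UR zU by (intro conjI exI[of _ ?U]) auto
  then show ?thesis by blast
qed

section \<open>The countable clopen part\<close>

text \<open>
  Let \<open>F\<close> be a subset of \<open>L\<close> with closed traces on the compact sets and \<open>x\<close> a point outside \<open>F\<close>. On an increasing
  exhaustion \<open>K n\<close>, Tietze's theorem yields functions that are \<open>0\<close> at \<open>x\<close>, \<open>1\<close> on \<open>F \<inter> K n\<close>, and agree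
  with the previous one on \<open>K n\<close>. Their limit is continuous on every compact set, since each lies
  in some \<open>K n\<close>; by the \<open>k\<^sub>R\<close>-property it is continuous, and it separates \<open>x\<close> from \<open>F\<close>.
\<close>

lemma clopen_kR_imp_k_omega:
  assumes X: "Tychonoff_space X" "kR_space X"
    and L: "openin X L" "closedin X L"
    and KK: "countable \<K>" "\<And>K. K \<in> \<K> \<Longrightarrow> compactin X K" "\<Union>\<K> = L"
    and hemi: "\<And>C. compactin X C \<Longrightarrow> C \<subseteq> L \<Longrightarrow> \<exists>\<F>. finite \<F> \<and> \<F> \<subseteq> \<K> \<and> C \<subseteq> \<Union>\<F>"
  shows "k_omega_space (subtopology X L)"
proof -
  have H: "Hausdorff_space X" by (rule Tychonoff_imp_Hausdorff[OF X(1)])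
  have cr: "completely_regular_space X" using X(1) by (simp add: Tychonoff_space_def)
  have LX: "L \<subseteq> topspace X" by (rule openin_subset[OF L(1)])
  have cl: "closedin (subtopology X L) F"
    if FL: "F \<subseteq> L" and Fc: "\<forall>K\<in>\<K>. closedin (subtopology X K) (F \<inter> K)" for F
  proof -
    \<comment> \<open>the empty set is added so that the enumeration makes sense when there are no compact sets\<close>
    define E where "E = from_nat_into (insert {} \<K>)"
    have E: "E n \<in> insert {} \<K>" for n unfolding E_def by (rule from_nat_into) simp
    have Ec: "compactin X (E n)" for n using E[of n] KK(2) by auto
    define K where "K n = (\<Union>i\<in>{..n}. E i)" for n
    have Kc: "compactin X (K n)" for n unfolding K_def using Ec by (intro compactin_Union) auto
    have FE: "compactin X (F \<inter> E n)" for n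
    proof (cases "E n = {}")
      case False
      then have "E n \<in> \<K>" using E[of n] by blast
      then have "closedin (subtopology X (E n)) (F \<inter> E n)" using Fc by blast
      then have "compactin (subtopology X (E n)) (F \<inter> E n)"
        using Ec[of n] by (intro closedin_compact_space) (auto simp: compactin_subspace)
      then show ?thesis by (simp add: compactin_subtopology)
    qed simp
    have FK: "compactin X (F \<inter> K n)" for n
    proof -
      have "F \<inter> K n = \<Union>((\<lambda>i. F \<inter> E i) ` {..n})" by (auto simp: K_def)
      moreover have "compactin X (\<Union>((\<lambda>i. F \<inter> E i) ` {..n}))" using FE by (intro compactin_Union) auto
      ultimately show ?thesis by simp
    qed
    have Kmono: "K m \<subseteq> K n" if "m \<le> n" for m n using that unfolding K_def by (intro UN_mono) auto
    have Kcov: "\<exists>n. C \<subseteq> K n" if C: "compactin X C" "C \<subseteq> L" for C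
    proof -
      obtain \<F> where F: "finite \<F>" "\<F> \<subseteq> \<K>" "C \<subseteq> \<Union>\<F>" using hemi[OF C] by blast
      have "\<forall>A\<in>\<F>. \<exists>i. E i = A"
      proof
        fix A assume "A \<in> \<F>"
        then have "A \<in> insert {} \<K>" using F(2) by blast
        then show "\<exists>i. E i = A" unfolding E_def using KK(1) by (intro from_nat_into_surj) auto
      qed
      from bchoice[OF this] obtain i where i: "\<forall>A\<in>\<F>. E (i A) = A" by (rule exE)
      define n where "n = Max (insert 0 (i ` \<F>))"
      have "C \<subseteq> K n"
      proof
        fix c assume "c \<in> C"
        then obtain A where A: "A \<in> \<F>" "c \<in> A" using F(3) by blast
        have "i A \<le> n" unfolding n_def using A(1) F(1) by (intro Max_ge) auto
        moreover have "c \<in> E (i A)" using i A by simp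
        ultimately show "c \<in> K n" unfolding K_def by (intro UN_I[of "i A"]) auto
      qed
      then show ?thesis by blast
    qed
    have sep: "\<exists>V. openin X V \<and> x \<in> V \<and> V \<inter> F = {}" if x: "x \<in> L - F" for x
    proof -
      have xX: "x \<in> topspace X" using x LX by blast
      define Pr where "Pr n g \<longleftrightarrow> continuous_map X euclideanreal g \<and> g x = 0 \<and> (\<forall>y\<in>F \<inter> K n. g y = 1)"
        for n and g :: "'a \<Rightarrow> real"
      define Qr where "Qr n g g' \<longleftrightarrow> (\<forall>y\<in>K n. g' y = g y)" for n and g g' :: "'a \<Rightarrow> real"
      have "\<exists>f. \<forall>n. Pr n (f n) \<and> Qr n (f n) (f (Suc n))"
      proof (rule dependent_nat_choice)
        have "compactin X {x}" "closedin X (F \<inter> K 0)" "disjnt {x} (F \<inter> K 0)"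
          using x xX FK[of 0] H by (auto simp: compactin_imp_closedin disjnt_def)
        then obtain g where "continuous_map X euclideanreal g" "g ` (F \<inter> K 0) \<subseteq> {1}" "g ` {x} \<subseteq> {0}"
          using Urysohn_completely_regular_compact_closed_alt[OF cr, of "{x}" "F \<inter> K 0" 1 0] by blast
        then show "\<exists>g. Pr 0 g" unfolding Pr_def by (intro exI[of _ g]) auto
      next
        fix g n assume g: "Pr n g"
        let ?S1 = "insert x (K n)" and ?S2 = "F \<inter> K (Suc n)"
        have S1: "compactin X ?S1"
        proof -
          have "compactin X {x}" using xX by simp
          from compactin_Un[OF this Kc[of n]] show ?thesis by simp
        qed
        have S: "compactin X (?S1 \<union> ?S2)" by (rule compactin_Un[OF S1 FK])
        have cS1: "closedin X ?S1" and cS2: "closedin X ?S2"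
          using S1 FK H by (auto intro: compactin_imp_closedin)
        define \<phi> where "\<phi> y = (if y \<in> F then 1 else g y)" for y
        have \<phi>1: "\<phi> y = g y" if "y \<in> ?S1" for y
          using that g x by (auto simp: \<phi>_def Pr_def)
        have \<phi>2: "\<phi> y = 1" if "y \<in> ?S2" for y using that by (simp add: \<phi>_def)
        have gc: "continuous_map X euclideanreal g" using g by (simp add: Pr_def)
        have "continuous_map (subtopology X (?S1 \<union> ?S2)) euclideanreal \<phi>"
          unfolding continuous_map_closedin
        proof (intro conjI allI impI)
          fix C :: "real set" assume C: "closedin euclideanreal C"
          have "closedin X {y \<in> topspace X. g y \<in> C}" by (rule closedin_continuous_map_preimage[OF gc C])
          then have "closedin X ((?S1 \<inter> {y \<in> topspace X. g y \<in> C}) \<union> (if 1 \<in> C then ?S2 else {}))"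
            using cS1 cS2 by auto
          moreover have "{y \<in> topspace (subtopology X (?S1 \<union> ?S2)). \<phi> y \<in> C} =
              (?S1 \<inter> {y \<in> topspace X. g y \<in> C}) \<union> (if 1 \<in> C then ?S2 else {})" (is "?A = ?B")
          proof (rule Set.set_eqI)
            fix y
            have "?S1 \<union> ?S2 \<subseteq> topspace X" using compactin_subset_topspace[OF S] .
            then have "y \<in> ?A \<longleftrightarrow> y \<in> ?S1 \<union> ?S2 \<and> \<phi> y \<in> C" by auto
            also have "\<dots> \<longleftrightarrow> (y \<in> ?S1 \<and> g y \<in> C) \<or> (y \<in> ?S2 \<and> 1 \<in> C)"
              using \<phi>1[of y] \<phi>2[of y] by auto
            also have "\<dots> \<longleftrightarrow> y \<in> ?B" using \<open>?S1 \<union> ?S2 \<subseteq> topspace X\<close> by auto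
            finally show "y \<in> ?A \<longleftrightarrow> y \<in> ?B" .
          qed
          ultimately have "closedin X {y \<in> topspace (subtopology X (?S1 \<union> ?S2)). \<phi> y \<in> C}" by simp
          then show "closedin (subtopology X (?S1 \<union> ?S2)) {y \<in> topspace (subtopology X (?S1 \<union> ?S2)). \<phi> y \<in> C}"
            by (rule closedin_subset_topspace) auto
        qed simp
        then obtain g' where g': "continuous_map X euclideanreal g'" "\<And>y. y \<in> ?S1 \<union> ?S2 \<Longrightarrow> g' y = \<phi> y"
          using Tietze_extension_completely_regular[OF cr S is_interval_univ, of \<phi>] by auto
        have "Pr (Suc n) g' \<and> Qr n g g'"
          unfolding Pr_def Qr_def
        proof (intro conjI ballI g'(1))
          show "g' x = 0" using g'(2)[of x] \<phi>1[of x] g by (simp add: Pr_def)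
          show "g' y = 1" if "y \<in> ?S2" for y using g'(2)[of y] \<phi>2[of y] that by simp
          show "g' y = g y" if "y \<in> K n" for y using g'(2)[of y] \<phi>1[of y] that by simp
        qed
        then show "\<exists>g'. Pr (Suc n) g' \<and> Qr n g g'" by blast
      qed
      then obtain g where g: "\<And>n. Pr n (g n)" "\<And>n. Qr n (g n) (g (Suc n))" by blast
      have gK: "g n y = g m y" if "m \<le> n" "y \<in> K m" for m n y
        using that(1)
      proof (induction rule: dec_induct)
        case (step n)
        have "y \<in> K n" using Kmono[OF step.hyps(1)] that(2) by blast
        then have "g (Suc n) y = g n y" using g(2)[of n] unfolding Qr_def by blast
        then show ?case using step.IH by simp
      qed simp
      define f where "f y = (if y \<in> L then 1 else 0) * g (LEAST n. y \<in> K n) y" for y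
      have fK: "f y = (if y \<in> L then 1 else 0) * g n y" if "y \<in> K n" for n y
      proof -
        have "y \<in> K (LEAST n. y \<in> K n)" by (rule LeastI[of "\<lambda>n. y \<in> K n", OF that])
        moreover have "(LEAST n. y \<in> K n) \<le> n" by (rule Least_le[of "\<lambda>n. y \<in> K n", OF that])
        ultimately show ?thesis using gK by (simp add: f_def)
      qed
      have ind: "continuous_map X euclideanreal (\<lambda>y. if y \<in> L then 1 else 0)"
        using L by (intro continuous_map_indicator) auto
      have "\<forall>C. compactin X C \<longrightarrow> continuous_map (subtopology X C) euclideanreal f"
      proof (intro allI impI)
        fix C assume C: "compactin X C"
        have "compactin X (L \<inter> C)" by (rule closed_Int_compactin[OF L(2) C])
        then obtain n where n: "L \<inter> C \<subseteq> K n" using Kcov[of "L \<inter> C"] by blast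
        have "continuous_map X euclideanreal (\<lambda>y. (if y \<in> L then 1 else 0) * g n y)"
          using ind g(1)[of n] unfolding Pr_def by (intro continuous_map_real_mult) auto
        then have "continuous_map (subtopology X C) euclideanreal (\<lambda>y. (if y \<in> L then 1 else 0) * g n y)"
          by (rule continuous_map_from_subtopology)
        then show "continuous_map (subtopology X C) euclideanreal f"
        proof (rule continuous_map_eq)
          fix y assume "y \<in> topspace (subtopology X C)"
          then have "y \<in> L \<Longrightarrow> y \<in> K n" using n by auto
          then show "(if y \<in> L then 1 else 0) * g n y = f y" using fK[of y n] by (cases "y \<in> L") (auto simp: f_def)
        qed
      qed
      then have "continuous_map X euclideanreal f" using X(2) by (simp add: kR_space_def)
      then have "openin X {y \<in> topspace X. f y \<in> {..<1/2}}"
        by (rule openin_continuous_map_preimage) auto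
      then have "openin X (L \<inter> {y \<in> topspace X. f y \<in> {..<1/2}})" by (rule openin_Int[OF L(1)])
      moreover have "x \<in> L \<inter> {y \<in> topspace X. f y \<in> {..<1/2}}"
        using x xX g(1) by (simp add: f_def Pr_def)
      moreover have "L \<inter> {y \<in> topspace X. f y \<in> {..<1/2}} \<inter> F = {}"
      proof -
        have "f y = 1" if y: "y \<in> F" for y
        proof -
          have "compactin X {y}" "{y} \<subseteq> L" using y FL LX by auto
          then obtain n where "y \<in> K n" using Kcov[of "{y}"] by blast
          then show ?thesis using fK[of y n] g(1)[of n] y FL unfolding Pr_def by auto
        qed
        then show ?thesis by auto
      qed
      ultimately show ?thesis by blast
    qed
    have "openin X (L - F)"
    proof (subst openin_subopen, intro ballI)
      fix x assume x: "x \<in> L - F"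
      then obtain V where V: "openin X V" "x \<in> V" "V \<inter> F = {}" using sep by blast
      show "\<exists>T. openin X T \<and> x \<in> T \<and> T \<subseteq> L - F"
        using V x openin_Int[OF L(1) V(1)] by (intro exI[of _ "L \<inter> V"]) auto
    qed
    then have "openin (subtopology X L) (L - F)" by (simp add: openin_open_subtopology[OF L(1)])
    moreover have "topspace (subtopology X L) = L" using LX by auto
    ultimately show ?thesis using FL by (simp add: closedin_def)
  qed
  show ?thesis
    unfolding k_omega_space_def
  proof (intro exI[of _ \<K>] conjI allI impI ballI iffI)
    show "countable \<K>" by (rule KK(1))
    show tL: "\<Union>\<K> = topspace (subtopology X L)" using KK(3) LX by auto
    show "compactin (subtopology X L) K" if "K \<in> \<K>" for K
      using KK(2)[OF that] KK(3) that by (auto simp: compactin_subtopology)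
    have sub: "subtopology (subtopology X L) K = subtopology X K" if "K \<in> \<K>" for K
    proof -
      have "L \<inter> K = K" using that KK(3) by blast
      then show ?thesis by (simp add: subtopology_subtopology)
    qed
    show "closedin (subtopology (subtopology X L) K) (F \<inter> K)"
      if "closedin (subtopology X L) F" "K \<in> \<K>" for F K
      using that by (auto simp: closedin_subtopology)
    show "closedin (subtopology X L) F" if "F \<subseteq> topspace (subtopology X L)"
      "\<forall>K\<in>\<K>. closedin (subtopology (subtopology X L) K) (F \<inter> K)" for F
      using that sub by (intro cl) auto
  qed
qed

text \<open>
  If \<open>x\<close> is isolated, then \<open>{x}\<close> is open and compact, hence itself a network member, and a compact set meets only
  countably many of those.
\<close>

lemma compact_countable_of_nonisolated:
  assumes N: "k_network X \<N>" "compact_countable X \<N>"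
    and cX': "countable {x \<in> topspace X. \<not> openin X {x}}" and K: "compactin X K"
  shows "countable K"
proof -
  have KX: "K \<subseteq> topspace X" by (rule compactin_subset_topspace[OF K])
  have "{x} \<in> \<N>" if x: "x \<in> K" "openin X {x}" for x
  proof -
    have "compactin X {x}" using x KX by auto
    then obtain F where F: "finite F" "F \<subseteq> \<N>" "{x} \<subseteq> \<Union>F" "\<Union>F \<subseteq> {x}"
      using k_networkD[OF N(1) x(2), of "{x}"] by auto
    then obtain N where "N \<in> F" "x \<in> N" by blast
    then have "N = {x}" using F(4) by blast
    then show ?thesis using \<open>N \<in> F\<close> F(2) by blast
  qed
  then have "(\<lambda>x. {x}) ` {x \<in> K. openin X {x}} \<subseteq> {N \<in> \<N>. N \<inter> K \<noteq> {}}" by auto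
  moreover have "countable {N \<in> \<N>. N \<inter> K \<noteq> {}}" using N(2) K by (simp add: compact_countable_def)
  ultimately have "countable ((\<lambda>x. {x}) ` {x \<in> K. openin X {x}})" by (rule countable_subset)
  then have "countable {x \<in> K. openin X {x}}" by (rule countable_image_inj_on) (simp add: inj_on_def)
  then have "countable ({x \<in> K. openin X {x}} \<union> {x \<in> topspace X. \<not> openin X {x}})" using cX' by simp
  moreover have "K \<subseteq> {x \<in> K. openin X {x}} \<union> {x \<in> topspace X. \<not> openin X {x}}" using KX by blast
  ultimately show ?thesis by (rule countable_subset[rotated])
qed

text \<open>
  The members of the network with compact closure are countable sets, so the equivalence relation
  generated by lying in a common member has countable classes \<open>E x\<close>; a compact set, covered by finitely many
  members, meets only finitely many classes. The clopen set \<open>L\<close> is the union of the classes that meet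
  the set \<open>X'\<close> of non-isolated points and of the classes in \<open>\<E>\<close>, which miss \<open>X'\<close> but have infinite
  trace on some compact set. Outside \<open>L\<close> compact sets have only finitely many points, all isolated,
  so \<open>L\<close> is clopen by the \<open>k\<^sub>R\<close>-property.

  Were \<open>\<E>\<close> uncountable, then uncountably many classes in it would contain sequences with
  the same limit in the countable set \<open>X'\<close>, and \<open>common_limit_imp_fan\<close> would give a fan.
\<close>

lemma no_fan_imp_clopen_countable:
  assumes X: "Tychonoff_space X" "kR_space X" "mu_complete X"
    and N: "k_network X \<N>" "compact_countable X \<N>"
    and cX': "countable {x \<in> topspace X. \<not> openin X {x}}"
    and cov: "\<And>K. compactin X K \<Longrightarrow> \<exists>F. finite F \<and> F \<subseteq> {N \<in> \<N>. compactin X (X closure_of N)} \<and> K \<subseteq> \<Union>F"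
    and nofan: "\<nexists>F. Fin_fan (PA_topology X) omega1 F"
  obtains L \<K> where "openin X L" "closedin X L" "countable L" "{x \<in> topspace X. \<not> openin X {x}} \<subseteq> L"
    "countable \<K>" "\<And>K. K \<in> \<K> \<Longrightarrow> compactin X K" "\<Union>\<K> = L"
    "\<And>C. compactin X C \<Longrightarrow> C \<subseteq> L \<Longrightarrow> \<exists>\<F>. finite \<F> \<and> \<F> \<subseteq> \<K> \<and> C \<subseteq> \<Union>\<F>"
proof -
  have H: "Hausdorff_space X" by (rule Tychonoff_imp_Hausdorff[OF X(1)])
  have t1: "t1_space X" using X(1) by (simp add: Tychonoff_space_def)
  have reg: "regular_space X"
    using X(1) by (simp add: Tychonoff_space_def completely_regular_imp_regular_space)
  define X' where "X' = {x \<in> topspace X. \<not> openin X {x}}"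
  define \<C> where "\<C> = {N \<in> \<N>. compactin X (X closure_of N)}"
  have NX: "N \<subseteq> topspace X" if "N \<in> \<C>" for N
    using that N(1) unfolding \<C>_def k_network_def by blast
  have Nc: "countable N" if "N \<in> \<C>" for N
  proof -
    have "countable (X closure_of N)"
      using that by (intro compact_countable_of_nonisolated[OF N cX']) (simp add: \<C>_def)
    then show ?thesis by (rule countable_subset[OF closure_of_subset[OF NX[OF that]]])
  qed
  have Np: "countable {N \<in> \<C>. x \<in> N}" for x
  proof (cases "x \<in> topspace X")
    case True
    then have "compactin X {x}" by simp
    then have "countable {N \<in> \<N>. N \<inter> {x} \<noteq> {}}" using N(2) unfolding compact_countable_def by blast
    then show ?thesis by (rule countable_subset[rotated]) (auto simp: \<C>_def)
  next
    case False
    then have "{N \<in> \<C>. x \<in> N} = {}" using NX by blast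
    then show ?thesis by (simp only: countable_empty)
  qed
  have cov': "\<exists>F. finite F \<and> F \<subseteq> \<C> \<and> K \<subseteq> \<Union>F" if "compactin X K" for K
    using cov[OF that] by (simp add: \<C>_def)
  define r where "r = {(x, y). \<exists>N\<in>\<C>. x \<in> N \<and> y \<in> N}"
  have rs: "sym r" unfolding r_def sym_def by blast
  define E where "E x = r\<^sup>* `` {x}" for x
  have Eself: "x \<in> E x" for x by (simp add: E_def)
  have Eeq: "E x = E y" if "y \<in> E x" for x y
  proof -
    have xy: "(x, y) \<in> r\<^sup>*" using that by (simp add: E_def)
    then have yx: "(y, x) \<in> r\<^sup>*" using symD[OF sym_rtrancl[OF rs]] by blast
    show ?thesis using rtrancl_trans[OF xy] rtrancl_trans[OF yx] by (auto simp: E_def)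
  qed
  have Ec: "countable (E x)" for x
    unfolding E_def
  proof (rule countable_rtrancl)
    fix Y :: "'a set" assume Y: "countable Y"
    have "r `` Y = (\<Union>y\<in>Y. \<Union>{N \<in> \<C>. y \<in> N})" by (auto simp: r_def)
    moreover have "countable (\<Union>{N \<in> \<C>. y \<in> N})" for y
    proof -
      have "\<Union>{N \<in> \<C>. y \<in> N} = (\<Union>N\<in>{N \<in> \<C>. y \<in> N}. N)" by blast
      then show ?thesis using Nc by (simp only:) (intro countable_UN Np, simp)
    qed
    ultimately show "countable (r `` Y)" using Y by simp
  qed simp
  have EN: "N \<subseteq> E x" if "N \<in> \<C>" "x \<in> N" for N x
  proof
    fix y assume "y \<in> N"
    then have "(x, y) \<in> r" using that by (auto simp: r_def)
    then show "y \<in> E x" by (auto simp: E_def)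
  qed
  have Efin: "finite (E ` K)" if K: "compactin X K" for K
  proof -
    obtain F where F: "finite F" "F \<subseteq> \<C>" "K \<subseteq> \<Union>F" using cov'[OF K] by blast
    have "E ` K \<subseteq> (\<lambda>N. E (SOME x. x \<in> N)) ` F"
    proof (rule image_subsetI)
      fix x assume "x \<in> K"
      then obtain N where N: "N \<in> F" "x \<in> N" using F(3) by blast
      have "(SOME x. x \<in> N) \<in> N" using N(2) by (rule someI)
      then have "(SOME x. x \<in> N) \<in> E x" using EN[of N x] N F(2) by blast
      then have "E x = E (SOME x. x \<in> N)" by (rule Eeq)
      then show "E x \<in> (\<lambda>N. E (SOME x. x \<in> N)) ` F" using N(1) by (rule image_eqI)
    qed
    then show ?thesis using F(1) by (rule finite_subset[OF _ finite_imageI])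
  qed
  define \<E> where "\<E> = {A. \<exists>x. A = E x \<and> E x \<inter> X' = {} \<and> (\<exists>K. compactin X K \<and> infinite (K \<inter> E x))}"
  have "countable \<E>"
  proof (rule ccontr)
    assume unc: "\<not> countable \<E>"
    have "\<forall>A\<in>\<E>. \<exists>x. x \<in> X' \<and> (\<exists>s. range s \<subseteq> A \<and> limitin X s x sequentially)"
    proof
      fix A assume "A \<in> \<E>"
      then obtain K where A: "A \<inter> X' = {}" "compactin X K" "infinite (K \<inter> A)" by (auto simp: \<E>_def)
      obtain x where x: "x \<in> K" "x \<in> X derived_set_of (K \<inter> A)"
        using compactin_imp_Bolzano_Weierstrass[OF A(2), of "K \<inter> A"] A(3) by auto
      have xd: "\<And>T. x \<in> T \<Longrightarrow> openin X T \<Longrightarrow> \<exists>y. y \<noteq> x \<and> y \<in> K \<inter> A \<and> y \<in> T" and xX: "x \<in> topspace X"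
        using x(2) unfolding in_derived_set_of by blast+
      have "\<not> openin X {x}" using xd[of "{x}"] by blast
      then have "x \<in> X'" using xX by (simp add: X'_def)
      have "x \<in> X closure_of (K \<inter> A - {x})"
        unfolding in_closure_of
      proof (intro conjI xX allI impI)
        fix T assume "x \<in> T \<and> openin X T"
        then show "\<exists>y. y \<in> K \<inter> A - {x} \<and> y \<in> T" using xd[of T] by blast
      qed
      from k_network_sequence[OF N reg H A(2) x(1) this Int_lower1]
      obtain s where "range s \<subseteq> K \<inter> A - {x}" "limitin X s x sequentially" .
      then show "\<exists>x. x \<in> X' \<and> (\<exists>s. range s \<subseteq> A \<and> limitin X s x sequentially)"
        using \<open>x \<in> X'\<close> by (intro exI[of _ x] conjI exI[of _ s]) auto
    qed
    from bchoice[OF this] obtain l where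
      l: "\<forall>A\<in>\<E>. l A \<in> X' \<and> (\<exists>s. range s \<subseteq> A \<and> limitin X s (l A) sequentially)" by (rule exE)
    then have "\<forall>A\<in>\<E>. \<exists>s. range s \<subseteq> A \<and> limitin X s (l A) sequentially" by blast
    from bchoice[OF this] obtain S where
      S: "\<forall>A\<in>\<E>. range (S A) \<subseteq> A \<and> limitin X (S A) (l A) sequentially" by (rule exE)
    have "\<exists>x\<in>X'. \<not> countable {A \<in> \<E>. l A = x}"
    proof (rule ccontr)
      assume "\<not> ?thesis"
      then have "countable (\<Union>x\<in>X'. {A \<in> \<E>. l A = x})"
        using cX' unfolding X'_def[symmetric] by (intro countable_UN) auto
      moreover have "\<E> \<subseteq> (\<Union>x\<in>X'. {A \<in> \<E>. l A = x})" using l by auto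
      ultimately show False using unc countable_subset by blast
    qed
    then obtain x where x: "x \<in> X'" "\<not> countable {A \<in> \<E>. l A = x}" by (rule bexE)
    obtain \<epsilon> where \<epsilon>: "inj_on \<epsilon> omega1" "\<epsilon> ` omega1 \<subseteq> {A \<in> \<E>. l A = x}"
      using uncountable_imp_omega1_le[OF x(2)] .
    have \<epsilon>E: "\<epsilon> a \<in> \<E>" "l (\<epsilon> a) = x" if "a \<in> omega1" for a
      using subsetD[OF \<epsilon>(2) imageI[OF that]] by simp_all
    define s where "s a = S (\<epsilon> a)" for a
    have sE: "s a n \<in> \<epsilon> a" if "a \<in> omega1" for a n
      using S[THEN bspec, OF \<epsilon>E(1)[OF that]] unfolding s_def by (auto simp: image_subset_iff)
    have lim: "limitin X (s a) x sequentially" if "a \<in> omega1" for a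
      using S[THEN bspec, OF \<epsilon>E(1)[OF that]] \<epsilon>E(2)[OF that] unfolding s_def by simp
    have \<epsilon>eq: "\<epsilon> a = E y" if "a \<in> omega1" "y \<in> \<epsilon> a" for a y
      using \<epsilon>E(1)[OF that(1)] that(2) Eeq by (auto simp: \<E>_def)
    \<comment> \<open>the reflexive closure puts points outside the space into classes of their own\<close>
    have EsubX: "E y \<subseteq> topspace X \<union> {y}" for y
    proof
      fix w assume "w \<in> E y"
      then have "(y, w) \<in> r\<^sup>*" by (simp add: E_def)
      then show "w \<in> topspace X \<union> {y}"
        by (cases rule: rtrancl.cases) (use NX in \<open>auto simp: r_def\<close>)
    qed
    have "\<exists>F. Fin_fan (PA_topology X) omega1 F"
    proof (rule common_limit_imp_fan[OF t1 X(3) lim])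
      fix a n assume a: "a \<in> omega1"
      have "\<epsilon> a \<inter> X' = {}" using \<epsilon>E(1)[OF a] by (auto simp: \<E>_def)
      then have "s a n \<noteq> x" using sE[OF a, of n] x(1) by auto
      moreover have "s a n \<in> topspace X"
      proof (rule ccontr)
        assume no: "s a n \<notin> topspace X"
        obtain K where K: "compactin X K" "infinite (K \<inter> \<epsilon> a)" using \<epsilon>E(1)[OF a] by (auto simp: \<E>_def)
        have KX: "K \<subseteq> topspace X" by (rule compactin_subset_topspace[OF K(1)])
        obtain t where t: "t \<in> K \<inter> \<epsilon> a" using K(2) by (metis ex_in_conv finite.emptyI)
        have "s a n \<in> E t" using sE[OF a, of n] \<epsilon>eq[OF a, of t] t by simp
        then show False using EsubX[of t] t KX no by blast
      qed
      ultimately show "s a n \<in> topspace X - {x}" by simp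
    next
      fix a b m n assume ab: "a \<in> omega1" "b \<in> omega1" "s a m = s b n"
      have "\<epsilon> a = E (s a m)" by (rule \<epsilon>eq[OF ab(1) sE[OF ab(1)]])
      moreover have "\<epsilon> b = E (s b n)" by (rule \<epsilon>eq[OF ab(2) sE[OF ab(2)]])
      ultimately have "\<epsilon> a = \<epsilon> b" using ab(3) by simp
      then show "a = b" by (rule inj_onD[OF \<epsilon>(1) _ ab(1,2)])
    next
      fix K assume K: "compactin X K"
      have "\<epsilon> ` {a \<in> omega1. \<exists>n. s a n \<in> K} \<subseteq> E ` K"
      proof (rule image_subsetI)
        fix a assume "a \<in> {a \<in> omega1. \<exists>n. s a n \<in> K}"
        then obtain n where a: "a \<in> omega1" "s a n \<in> K" by blast
        show "\<epsilon> a \<in> E ` K" using \<epsilon>eq[OF a(1) sE[OF a(1)]] a(2) by (rule image_eqI)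
      qed
      then have "finite (\<epsilon> ` {a \<in> omega1. \<exists>n. s a n \<in> K})" by (rule finite_subset[OF _ Efin[OF K]])
      then show "finite {a \<in> omega1. \<exists>n. s a n \<in> K}"
        by (rule finite_imageD) (rule inj_on_subset[OF \<epsilon>(1)], blast)
    qed
    then show False using nofan by blast
  qed
  define \<G> where "\<G> = \<E> \<union> E ` X'"
  define L where "L = topspace X \<inter> \<Union>\<G>"
  have "countable \<G>" using \<open>countable \<E>\<close> cX' unfolding \<G>_def X'_def by simp
  moreover have "countable A" if "A \<in> \<G>" for A using that Ec by (auto simp: \<G>_def \<E>_def)
  ultimately have "countable (\<Union>\<G>)" using countable_UN[of \<G> "\<lambda>A. A"] by simp
  then have cL: "countable L" unfolding L_def by (rule countable_subset[rotated]) blast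
  have LX: "L \<subseteq> topspace X" by (simp add: L_def)
  have X'L: "X' \<subseteq> L" using Eself by (auto simp: L_def \<G>_def X'_def)
  have ELsub: "y \<in> L" if y: "y \<in> E x" and x: "x \<in> L" and "y \<in> topspace X" for x y
  proof -
    obtain A where A: "A \<in> \<G>" "x \<in> A" using x by (auto simp: L_def)
    then obtain w where w: "A = E w" by (auto simp: \<G>_def \<E>_def)
    have "E w = E x" using A(2) w Eeq by simp
    then have "y \<in> A" using y w by simp
    then show ?thesis using A(1) \<open>y \<in> topspace X\<close> by (auto simp: L_def)
  qed
  have KL: "finite (K - L)" if K: "compactin X K" for K
  proof -
    have KX: "K \<subseteq> topspace X" by (rule compactin_subset_topspace[OF K])
    have fE: "finite (K \<inter> E x)" if x: "x \<in> K - L" for x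
    proof (rule ccontr)
      assume inf: "infinite (K \<inter> E x)"
      have "E x \<in> \<G>"
      proof (cases "E x \<inter> X' = {}")
        case True
        then show ?thesis using inf K by (auto simp: \<G>_def \<E>_def)
      next
        case False
        then obtain w where w: "w \<in> E x" "w \<in> X'" by blast
        then have "E x = E w" by (intro Eeq)
        then show ?thesis using w(2) by (simp add: \<G>_def)
      qed
      then have "x \<in> L" using Eself[of x] x KX by (auto simp: L_def)
      then show False using x by blast
    qed
    have "finite (E ` (K - L))" by (rule finite_subset[OF _ Efin[OF K]]) blast
    moreover have "finite (K \<inter> A)" if "A \<in> E ` (K - L)" for A using that fE by blast
    ultimately have "finite (\<Union>A\<in>E ` (K - L). K \<inter> A)" by (rule finite_UN_I)
    moreover have "K - L \<subseteq> (\<Union>A\<in>E ` (K - L). K \<inter> A)" using Eself by blast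
    ultimately show ?thesis by (rule finite_subset[rotated])
  qed
  have iso: "openin X A" if A: "A \<subseteq> topspace X - L" for A
  proof -
    have "openin X {x}" if "x \<in> A" for x using A that X'L by (auto simp: X'_def)
    then have "openin X (\<Union>x\<in>A. {x})" by blast
    then show ?thesis by simp
  qed
  have oL: "openin X L"
  proof (rule kR_space_openin[OF X(2) LX])
    fix K assume K: "compactin X K"
    have KX: "K \<subseteq> topspace X" by (rule compactin_subset_topspace[OF K])
    have o: "openin X (K - L)" using KX by (intro iso) blast
    have "K - L \<subseteq> topspace X" using KX by blast
    then have "closedin X (K - L)" using KL[OF K] t1 unfolding t1_space_closedin_finite by blast
    then have o2: "openin X (topspace X - (K - L))" by (rule openin_diff[OF openin_topspace])
    have "K \<inter> (topspace X - (K - L)) = K \<inter> L" "K \<inter> (K - L) = K - L" using KX by blast+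
    then show "openin (subtopology X K) (K \<inter> L) \<and> openin (subtopology X K) (K - L)"
      using openin_subtopology_Int2[OF o, of K] openin_subtopology_Int2[OF o2, of K] by simp
  qed
  have cLL: "closedin X L" using iso[of "topspace X - L"] LX by (simp add: closedin_def)
  define \<K> where "\<K> = (\<lambda>N. X closure_of N) ` {N \<in> \<C>. N \<inter> L \<noteq> {}}"
  have NL: "X closure_of N \<subseteq> L" if N: "N \<in> \<C>" "N \<inter> L \<noteq> {}" for N
  proof -
    obtain x where x: "x \<in> N" "x \<in> L" using N(2) by blast
    have "N \<subseteq> L" using EN[OF N(1) x(1)] NX[OF N(1)] ELsub[OF _ x(2)] by blast
    then show ?thesis using cLL by (rule closure_of_minimal)
  qed
  have hemi: "\<exists>\<F>. finite \<F> \<and> \<F> \<subseteq> \<K> \<and> C \<subseteq> \<Union>\<F>" if C: "compactin X C" "C \<subseteq> L" for C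
  proof -
    obtain F where F: "finite F" "F \<subseteq> \<C>" "C \<subseteq> \<Union>F" using cov'[OF C(1)] by blast
    let ?F = "(\<lambda>N. X closure_of N) ` {N \<in> F. N \<inter> L \<noteq> {}}"
    have "finite ?F" using F(1) by simp
    moreover have "?F \<subseteq> \<K>" using F(2) by (auto simp: \<K>_def)
    moreover have "C \<subseteq> \<Union>?F"
    proof
      fix c assume c: "c \<in> C"
      then obtain N where N: "N \<in> F" "c \<in> N" using F(3) by blast
      have "c \<in> X closure_of N" using closure_of_subset[OF NX, of N] N F(2) by blast
      moreover have "N \<in> {N \<in> F. N \<inter> L \<noteq> {}}" using N c C(2) by blast
      ultimately show "c \<in> \<Union>?F" by blast
    qed
    ultimately show ?thesis by blast
  qed
  show thesis
  proof (rule that[OF oL cLL cL])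
    show "{x \<in> topspace X. \<not> openin X {x}} \<subseteq> L" using X'L by (simp add: X'_def)
    have "{N \<in> \<C>. N \<inter> L \<noteq> {}} = (\<Union>x\<in>L. {N \<in> \<C>. x \<in> N})" by blast
    then have "countable {N \<in> \<C>. N \<inter> L \<noteq> {}}" using countable_UN[OF cL Np] by simp
    then show "countable \<K>" by (simp add: \<K>_def)
    show "compactin X K" if "K \<in> \<K>" for K using that by (auto simp: \<K>_def \<C>_def)
    show "\<Union>\<K> = L"
    proof
      show "\<Union>\<K> \<subseteq> L" using NL by (auto simp: \<K>_def)
      show "L \<subseteq> \<Union>\<K>"
      proof
        fix x assume x: "x \<in> L"
        then have "compactin X {x}" "{x} \<subseteq> L" using LX by auto
        from hemi[OF this] show "x \<in> \<Union>\<K>" by blast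
      qed
    qed
  qed (rule hemi)
qed

section \<open>The free group of a countable \<open>k\<^sub>\<omega>\<close>-space plus a discrete space\<close>

lemma closedin_PA_translation:
  assumes "keys g \<subseteq> topspace X" "closedin (PA_topology X) C"
  shows "closedin (PA_topology X) ((\<lambda>h. g + h) ` C)"
  using homeomorphic_map_closedness[OF homeomorphic_map_PA_translation[OF assms(1)]] assms(2)
  by (metis closedin_subset)

definition sumset :: "('a \<Rightarrow>\<^sub>0 int) set \<Rightarrow> ('a \<Rightarrow>\<^sub>0 int) set \<Rightarrow> ('a \<Rightarrow>\<^sub>0 int) set" where
  "sumset S T = {x. \<exists>a\<in>S. \<exists>b\<in>T. x = a + b}"

lemma sumsetI: "a \<in> S \<Longrightarrow> b \<in> T \<Longrightarrow> a + b \<in> sumset S T"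
  by (auto simp: sumset_def)

lemma sumset_assoc: "sumset (sumset R S) T = sumset R (sumset S T)"
proof (intro equalityI subsetI)
  fix x assume "x \<in> sumset (sumset R S) T"
  then obtain a b c where abc: "a \<in> R" "b \<in> S" "c \<in> T" "x = a + b + c" by (auto simp: sumset_def)
  then show "x \<in> sumset R (sumset S T)"
    using sumsetI[OF abc(1) sumsetI[OF abc(2,3)]] by (simp add: add.assoc)
next
  fix x assume "x \<in> sumset R (sumset S T)"
  then obtain a b c where abc: "a \<in> R" "b \<in> S" "c \<in> T" "x = a + (b + c)" by (auto simp: sumset_def)
  then show "x \<in> sumset (sumset R S) T"
    using sumsetI[OF sumsetI[OF abc(1,2)] abc(3)] by (simp add: add.assoc)
qed

lemma sumset_0 [simp]: "sumset S {0} = S" "sumset {0} S = S"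
  by (auto simp: sumset_def)

lemma sumset_single: "sumset {g} S = (\<lambda>h. g + h) ` S"
  by (auto simp: sumset_def)

lemma compactin_sumset:
  assumes "compactin (PA_topology X) S" "compactin (PA_topology X) T"
  shows "compactin (PA_topology X) (sumset S T)"
proof -
  let ?P = "PA_topology X"
  have "compactin (prod_topology ?P ?P) (S \<times> T)" using assms by (simp add: compactin_Times)
  moreover have "continuous_map (prod_topology ?P ?P) ?P (\<lambda>p. fst p + snd p)"
    by (intro continuous_map_PA_add continuous_map_fst continuous_map_snd)
  ultimately have "compactin ?P ((\<lambda>p. fst p + snd p) ` (S \<times> T))" by (rule image_compactin)
  moreover have "(\<lambda>p. fst p + snd p) ` (S \<times> T) = sumset S T" by (force simp: sumset_def)
  ultimately show ?thesis by simp
qed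

definition frags :: "'a set \<Rightarrow> ('a \<Rightarrow>\<^sub>0 int) set" where
  "frags S = {g. keys g \<subseteq> S}"

lemma frags_0 [simp]: "0 \<in> frags S" by (simp add: frags_def)
lemma frags_add: "g \<in> frags S \<Longrightarrow> h \<in> frags S \<Longrightarrow> g + h \<in> frags S"
  by (simp add: frags_def keys_add_subset)
lemma frags_diff: "g \<in> frags S \<Longrightarrow> h \<in> frags S \<Longrightarrow> g - h \<in> frags S"
  by (simp add: frags_def keys_diff_subset)
lemma frags_uminus: "g \<in> frags S \<Longrightarrow> - g \<in> frags S"
  by (simp add: frags_def)
lemma frags_of [simp]: "frag_of x \<in> frags S \<longleftrightarrow> x \<in> S"
  by (simp add: frags_def)
lemma frags_mono: "S \<subseteq> T \<Longrightarrow> frags S \<subseteq> frags T"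
  by (auto simp: frags_def)

lemma frags_induct [consumes 1, case_names zero diff of]:
  assumes "g \<in> frags S" "P 0" "\<And>g h. g \<in> frags S \<Longrightarrow> h \<in> frags S \<Longrightarrow> P g \<Longrightarrow> P h \<Longrightarrow> P (g - h)"
    "\<And>x. x \<in> S \<Longrightarrow> P (frag_of x)"
  shows "P g"
  using assms(1) unfolding frags_def mem_Collect_eq
  by (rule free_Abelian_group_induct) (use assms(2-4) in \<open>auto simp: frags_def\<close>)

lemma countable_frags:
  assumes S: "countable S"
  shows "countable (frags S)"
proof -
  let ?G = "frag_of ` S \<union> uminus ` frag_of ` S"
  have "\<exists>xs\<in>lists ?G. g = sum_list xs" if "g \<in> frags S" for g
    using that
  proof (induction rule: frags_induct)
    case zero
    show ?case by (rule bexI[of _ "[]"]) auto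
  next
    case (diff g h)
    then obtain xs ys where xs: "xs \<in> lists ?G" "g = sum_list xs" and ys: "ys \<in> lists ?G" "h = sum_list ys" by blast
    have neg: "sum_list (map uminus zs) = - sum_list zs" for zs :: "('a \<Rightarrow>\<^sub>0 int) list"
      by (induction zs) auto
    have "map uminus ys \<in> lists ?G" using ys(1) by (auto simp: in_lists_conv_set)
    then have "xs @ map uminus ys \<in> lists ?G" using xs(1) by simp
    moreover have "g - h = sum_list (xs @ map uminus ys)" using xs(2) ys(2) neg by simp
    ultimately show ?case by (rule rev_bexI)
  next
    case (of x)
    then show ?case by (intro bexI[of _ "[frag_of x]"]) auto
  qed
  then have "frags S \<subseteq> sum_list ` lists ?G" by auto
  moreover have "countable (sum_list ` lists ?G)" using S by (intro countable_image countable_lists) auto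
  ultimately show ?thesis by (rule countable_subset)
qed

lemma frags_split:
  assumes "g \<in> frags (S \<union> T)"
  shows "\<exists>h\<in>frags S. \<exists>d\<in>frags T. g = h + d"
  using assms
proof (induction rule: frags_induct)
  case zero
  show ?case by (intro bexI[of _ 0]) auto
next
  case (diff g g')
  then obtain h d h' d' where "h \<in> frags S" "d \<in> frags T" "g = h + d"
    "h' \<in> frags S" "d' \<in> frags T" "g' = h' + d'" by blast
  then show ?case
    by (intro bexI[of _ "h - h'"] bexI[of _ "d - d'"] frags_diff) (simp_all add: algebra_simps)
next
  case (of x)
  then show ?case
  proof
    assume "x \<in> S"
    then show ?case by (intro bexI[of _ "frag_of x"] bexI[of _ 0]) auto
  next
    assume "x \<in> T"
    then show ?case by (intro bexI[of _ 0] bexI[of _ "frag_of x"]) auto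
  qed
qed

lemma frags_disjoint: "S \<inter> T = {} \<Longrightarrow> g \<in> frags S \<Longrightarrow> g \<in> frags T \<Longrightarrow> g = 0"
  unfolding frags_def by (metis Int_subset_iff keys_eq_empty mem_Collect_eq subset_empty)

text \<open>
  The family \<open>\<K>\<close> witnesses that the clopen part \<open>L\<close> is a \<open>k\<^sub>\<omega>\<close>-space. Its members are compact, hence
  closed in \<open>X\<close>, so closedness of traces can be stated in \<open>X\<close>.
\<close>

locale clopen_k_omega =
  fixes X :: "'a topology" and L :: "'a set" and \<K> :: "'a set set"
  assumes X: "Tychonoff_space X" and Lo: "openin X L" and Lc: "countable L"
    and iso: "\<And>x. x \<in> topspace X - L \<Longrightarrow> openin X {x}"
    and cK: "countable \<K>" and KL: "\<And>K. K \<in> \<K> \<Longrightarrow> compactin X K \<and> K \<subseteq> L"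
    and KF: "\<And>F. F \<subseteq> L \<Longrightarrow> (\<And>K. K \<in> \<K> \<Longrightarrow> closedin X (F \<inter> K)) \<Longrightarrow> closedin (subtopology X L) F"
    and KU: "\<Union>\<K> = L"
begin

abbreviation "P \<equiv> PA_topology X"
abbreviation "A \<equiv> frags L"

text \<open>
  \<open>\<C>\<close> consists of the finite sums of sets from \<open>\<Q>\<close>. It is closed under sums and contains the singletons of \<open>A\<close>, hence is also closed under
  translation by elements of \<open>A\<close>; it is countable because \<open>L\<close> is.
\<close>

definition "\<Q> = (\<lambda>g. {g}) ` A \<union> (\<lambda>K. frag_of ` K) ` \<K>"
definition "csum Qs = foldr sumset Qs {0}"
definition "\<C> = csum ` lists \<Q>"

lemma LX: "L \<subseteq> topspace X" by (rule openin_subset[OF Lo])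

lemma HP: "Hausdorff_space P" by (rule Hausdorff_PA[OF X])

lemma AP: "A \<subseteq> topspace P" using LX by (auto simp: frags_def)

lemma keysA: "g \<in> A \<Longrightarrow> keys g \<subseteq> topspace X" using LX by (auto simp: frags_def)

lemma csum_append: "csum (Qs @ Rs) = sumset (csum Qs) (csum Rs)"
  by (induction Qs) (simp_all add: csum_def sumset_assoc)

lemma C_sum: "C \<in> \<C> \<Longrightarrow> D \<in> \<C> \<Longrightarrow> sumset C D \<in> \<C>"
  unfolding \<C>_def
proof (elim imageE)
  fix Qs Rs assume "C = csum Qs" "Qs \<in> lists \<Q>" "D = csum Rs" "Rs \<in> lists \<Q>"
  then show "sumset C D \<in> csum ` lists \<Q>"
    by (intro image_eqI[of _ _ "Qs @ Rs"]) (simp_all add: csum_append)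
qed

lemma Q_C: "Q \<in> \<Q> \<Longrightarrow> Q \<in> \<C>"
  unfolding \<C>_def by (rule image_eqI[of _ _ "[Q]"]) (auto simp: csum_def)

lemma C_single: "g \<in> A \<Longrightarrow> {g} \<in> \<C>"
  by (rule Q_C) (simp add: \<Q>_def)

lemma C_K: "K \<in> \<K> \<Longrightarrow> frag_of ` K \<in> \<C>"
  by (rule Q_C) (simp add: \<Q>_def)

lemma C_countable: "countable \<C>"
  unfolding \<C>_def \<Q>_def
  by (intro countable_image countable_lists countable_Un cK countable_frags Lc)

lemma C_compact: "C \<in> \<C> \<Longrightarrow> compactin P C"
proof -
  have Q: "compactin P Q" if "Q \<in> \<Q>" for Q
    using that keysA KL unfolding \<Q>_def
    by (auto intro: image_compactin[OF _ continuous_frag_of])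
  have "compactin P (csum Qs)" if "Qs \<in> lists \<Q>" for Qs
    using that by (induction Qs) (auto simp: csum_def intro: compactin_sumset Q)
  then show "C \<in> \<C> \<Longrightarrow> compactin P C" by (auto simp: \<C>_def)
qed

lemma C_closed: "C \<in> \<C> \<Longrightarrow> closedin P C"
  using C_compact HP by (blast intro: compactin_imp_closedin)

lemma C_A: "C \<in> \<C> \<Longrightarrow> C \<subseteq> A"
proof -
  have Q: "Q \<subseteq> A" if "Q \<in> \<Q>" for Q
    using that unfolding \<Q>_def
  proof (elim UnE imageE)
    fix K assume "K \<in> \<K>" "Q = frag_of ` K"
    then show "Q \<subseteq> A" using KL[of K] by auto
  qed simp
  have "csum Qs \<subseteq> A" if "Qs \<in> lists \<Q>" for Qs
    using that
  proof (induction Qs)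
    case (Cons R Qs)
    then have "csum Qs \<subseteq> A" "R \<subseteq> A" using Q by auto
    moreover have "csum (R # Qs) = sumset R (csum Qs)" by (simp add: csum_def)
    ultimately show ?case by (auto simp: sumset_def intro!: frags_add)
  qed (simp add: csum_def)
  then show "C \<in> \<C> \<Longrightarrow> C \<subseteq> A" by (auto simp: \<C>_def)
qed

text \<open>
  Open relative to every member of \<open>\<C>\<close>. As these are closed, this can be said without subspaces.
\<close>

definition k_open :: "('a \<Rightarrow>\<^sub>0 int) set \<Rightarrow> bool" where
  "k_open U \<longleftrightarrow> U \<subseteq> A \<and> (\<forall>C\<in>\<C>. closedin P (C - U))"

lemma k_open_translation:
  assumes U: "k_open U" and g: "g \<in> A"
  shows "k_open ((\<lambda>h. - g + h) ` U)"
  unfolding k_open_def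
proof (intro conjI ballI)
  show "(\<lambda>h. - g + h) ` U \<subseteq> A"
    using U frags_add[OF frags_uminus[OF g]] unfolding k_open_def by blast
  fix C assume C: "C \<in> \<C>"
  have "sumset {g} C \<in> \<C>" by (intro C_sum C_single g C)
  then have "closedin P (sumset {g} C - U)" using U by (simp add: k_open_def)
  then have cl: "closedin P ((\<lambda>h. - g + h) ` (sumset {g} C - U))"
    using keysA[OF frags_uminus[OF g]] by (intro closedin_PA_translation)
  have "(\<lambda>h. - g + h) ` (sumset {g} C - U) = C - (\<lambda>h. - g + h) ` U"
  proof (intro equalityI subsetI)
    fix x assume "x \<in> (\<lambda>h. - g + h) ` (sumset {g} C - U)"
    then obtain c where c: "c \<in> C" "g + c \<notin> U" "x = - g + (g + c)" by (auto simp: sumset_single)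
    then have x: "x = c" by simp
    have "x \<notin> (\<lambda>h. - g + h) ` U"
    proof
      assume "x \<in> (\<lambda>h. - g + h) ` U"
      then obtain u where u: "u \<in> U" "x = - g + u" by blast
      then have "g + c = u" using x by simp
      then show False using u c by simp
    qed
    then show "x \<in> C - (\<lambda>h. - g + h) ` U" using c x by simp
  next
    fix x assume x: "x \<in> C - (\<lambda>h. - g + h) ` U"
    have "g + x \<notin> U"
    proof
      assume "g + x \<in> U"
      then have "- g + (g + x) \<in> (\<lambda>h. - g + h) ` U" by (rule imageI)
      then show False using x by simp
    qed
    then have "g + x \<in> sumset {g} C - U" using x by (simp add: sumset_single)
    then have "- g + (g + x) \<in> (\<lambda>h. - g + h) ` (sumset {g} C - U)" by (rule imageI)
    then show "x \<in> (\<lambda>h. - g + h) ` (sumset {g} C - U)" by simp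
  qed
  with cl show "closedin P (C - (\<lambda>h. - g + h) ` U)" by simp
qed

text \<open>
  Addition is continuous on the product of any two members of \<open>\<C>\<close>, but one set has to work for all of
  them. Along an exhaustion \<open>K n\<close> one builds compact sets \<open>B n \<subseteq> K n\<close> with
  \<open>B n + B n \<subseteq> U\<close> such that \<open>B (n + 1)\<close> is a neighbourhood of \<open>B n\<close> relative to \<open>K (n + 1)\<close>.
  The step is the tube lemma for \<open>B n \<times> B n\<close> followed by separation of disjoint compact sets. The union of the \<open>B n\<close>
  is then relatively open in every member of \<open>\<C>\<close>.
\<close>

lemma k_open_halve:
  assumes U: "k_open U" "0 \<in> U"
  obtains W where "k_open W" "0 \<in> W" "\<And>a b. a \<in> W \<Longrightarrow> b \<in> W \<Longrightarrow> a + b \<in> U"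
proof -
  have C0: "{0} \<in> \<C>" by (intro C_single) simp
  \<comment> \<open>\<open>{0}\<close> comes first so that the construction can start with \<open>B 0 = {0}\<close>\<close>
  define E where "E = case_nat {0} (from_nat_into \<C>)"
  have E0: "E 0 = {0}" by (simp add: E_def)
  have EC: "E n \<in> \<C>" for n
    using C0 from_nat_into[of \<C>] unfolding E_def by (cases n) auto
  have Esurj: "\<exists>n. E n = C" if C: "C \<in> \<C>" for C
  proof -
    obtain n where "from_nat_into \<C> n = C" using from_nat_into_surj[OF C_countable C] by blast
    then have "E (Suc n) = C" by (simp add: E_def)
    then show ?thesis by blast
  qed
  define K where "K n = \<Union>(E ` {..n})" for n
  have Kc: "compactin P (K n)" for n
    unfolding K_def using C_compact[OF EC] by (intro compactin_Union) auto
  have Kmono: "K m \<subseteq> K n" if "m \<le> n" for m n using that unfolding K_def by (intro Union_mono image_mono) auto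
  have KA: "K n \<subseteq> A" for n using C_A[OF EC] by (auto simp: K_def)
  \<comment> \<open>an open set whose trace on \<open>K n + K n\<close> is that of \<open>U\<close>\<close>
  define Oo where "Oo n = topspace P - (sumset (K n) (K n) - U)" for n
  have Oo: "openin P (Oo n)" for n
  proof -
    have "sumset (K n) (K n) - U = \<Union>((\<lambda>(i, j). sumset (E i) (E j) - U) ` ({..n} \<times> {..n}))"
      by (auto simp: K_def sumset_def)
    moreover have "closedin P (sumset (E i) (E j) - U)" for i j
      using U(1) C_sum[OF EC EC] by (simp add: k_open_def)
    ultimately have "closedin P (sumset (K n) (K n) - U)" by (auto intro!: closedin_Union)
    then show ?thesis unfolding Oo_def by (rule openin_diff[OF openin_topspace])
  qed
  define Pr where "Pr n B \<longleftrightarrow> compactin P B \<and> B \<subseteq> K n \<and> 0 \<in> B \<and> (\<forall>a\<in>B. \<forall>b\<in>B. a + b \<in> U)" for n B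
  define Qr where "Qr n B B' \<longleftrightarrow> (\<exists>G. openin P G \<and> B \<subseteq> G \<and> G \<inter> K (Suc n) \<subseteq> B')" for n B B'
  have "\<exists>B. \<forall>n. Pr n (B n) \<and> Qr n (B n) (B (Suc n))"
  proof (rule dependent_nat_choice)
    have "Pr 0 {0}" using U(2) by (simp add: Pr_def K_def E0)
    then show "\<exists>B. Pr 0 B" by blast
  next
    fix B n assume B: "Pr n B"
    let ?K = "K (Suc n)" and ?O = "Oo (Suc n)"
    have BK: "B \<subseteq> ?K" using B Kmono[of n "Suc n"] by (auto simp: Pr_def)
    have Bc: "compactin P B" using B by (simp add: Pr_def)
    have add: "continuous_map (prod_topology P P) P (\<lambda>p. fst p + snd p)"
      by (intro continuous_map_PA_add continuous_map_fst continuous_map_snd)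
    let ?W = "{p \<in> topspace (prod_topology P P). fst p + snd p \<in> ?O}"
    have oW: "openin (prod_topology P P) ?W" by (rule openin_continuous_map_preimage[OF add Oo])
    have BW: "B \<times> B \<subseteq> ?W"
    proof
      fix p assume p: "p \<in> B \<times> B"
      have "fst p + snd p \<in> U" using p B by (auto simp: Pr_def)
      moreover have "U \<subseteq> topspace P" using U(1) AP by (auto simp: k_open_def)
      ultimately have "fst p + snd p \<in> ?O" unfolding Oo_def by blast
      moreover have "p \<in> topspace (prod_topology P P)"
        using p compactin_subset_topspace[OF Bc] unfolding topspace_prod_topology by blast
      ultimately show "p \<in> ?W" by blast
    qed
    obtain V1 V2 where V: "openin P V1" "openin P V2" "B \<subseteq> V1" "B \<subseteq> V2" "V1 \<times> V2 \<subseteq> ?W"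
      by (rule Wallace_theorem_prod_topology[OF Bc Bc oW BW])
    have "openin P (V1 \<inter> V2)" using V by blast
    then have cK': "compactin P (?K - (V1 \<inter> V2))" by (rule compactin_Diff_open[OF Kc])
    have "disjnt B (?K - (V1 \<inter> V2))" using V by (auto simp: disjnt_def)
    then obtain G G' where G: "openin P G" "openin P G'" "B \<subseteq> G" "?K - (V1 \<inter> V2) \<subseteq> G'" "disjnt G G'"
      using Hausdorff_space_compact_separation[OF HP Bc cK'] by metis
    define B' where "B' = (topspace P - G') \<inter> ?K"
    have cB': "compactin P B'" unfolding B'_def using G(2) by (intro closed_Int_compactin Kc) blast
    have GB': "G \<inter> ?K \<subseteq> B'" using G(5) openin_subset[OF G(1)] by (auto simp: B'_def disjnt_def)
    have B'V: "B' \<subseteq> V1 \<inter> V2" using G(4) by (auto simp: B'_def)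
    have "a + b \<in> U" if "a \<in> B'" "b \<in> B'" for a b
    proof -
      have "(a, b) \<in> ?W" using that B'V V(5) by blast
      then have "a + b \<in> ?O" by simp
      moreover have "a + b \<in> sumset ?K ?K" using that by (intro sumsetI) (auto simp: B'_def)
      ultimately show ?thesis by (simp add: Oo_def)
    qed
    moreover have "0 \<in> B'" using GB' G(3) BK B by (auto simp: Pr_def)
    ultimately have "Pr (Suc n) B'" using cB' by (simp add: Pr_def B'_def)
    moreover have "Qr n B B'" using G GB' by (auto simp: Qr_def)
    ultimately show "\<exists>B'. Pr (Suc n) B' \<and> Qr n B B'" by blast
  qed
  then obtain B where B: "\<And>n. Pr n (B n)" "\<And>n. Qr n (B n) (B (Suc n))" by blast
  have "\<forall>n. \<exists>G. openin P G \<and> B n \<subseteq> G \<and> G \<inter> K (Suc n) \<subseteq> B (Suc n)" using B(2) by (simp add: Qr_def)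
  from choice[OF this] obtain G where G: "\<forall>n. openin P (G n) \<and> B n \<subseteq> G n \<and> G n \<inter> K (Suc n) \<subseteq> B (Suc n)"
    by (rule exE)
  have Bmono1: "B n \<subseteq> B (Suc n)" for n
  proof -
    have "B n \<subseteq> K (Suc n)" using B(1)[of n] Kmono[of n "Suc n"] by (auto simp: Pr_def)
    then show ?thesis using G[rule_format, of n] by blast
  qed
  have Bmono: "B m \<subseteq> B n" if "m \<le> n" for m n using Bmono1 that by (rule lift_Suc_mono_le)
  define W where "W = \<Union>(range B)"
  show thesis
  proof (rule that[of W])
    show "k_open W"
      unfolding k_open_def
    proof (intro conjI ballI)
      show "W \<subseteq> A" using B(1) KA by (fastforce simp: W_def Pr_def)
      fix C assume C: "C \<in> \<C>"
      then obtain m where m: "E m = C" using Esurj by blast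
      have CK: "C \<subseteq> K n" if "m \<le> n" for n using that m by (auto simp: K_def)
      have "C - W = C - \<Union>(G ` {m..})"
      proof (intro equalityI subsetI)
        fix c assume c: "c \<in> C - W"
        have "c \<notin> G n" if "m \<le> n" for n
        proof
          assume "c \<in> G n"
          moreover have "c \<in> K (Suc n)" using c CK[of "Suc n"] that by auto
          ultimately have "c \<in> B (Suc n)" using G by blast
          then show False using c by (auto simp: W_def)
        qed
        then show "c \<in> C - \<Union>(G ` {m..})" using c by auto
      next
        fix c assume c: "c \<in> C - \<Union>(G ` {m..})"
        have "c \<notin> B n" for n
        proof
          assume "c \<in> B n"
          then have "c \<in> B (max m n)" using Bmono[of n "max m n"] by auto
          then have "c \<in> G (max m n)" using G by blast
          then show False using c by auto
        qed
        then show "c \<in> C - W" using c by (auto simp: W_def)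
      qed
      moreover have "openin P (\<Union>(G ` {m..}))" using G by (intro openin_Union) auto
      ultimately show "closedin P (C - W)" using C_closed[OF C] by (simp add: closedin_diff)
    qed
    show "0 \<in> W" using B(1)[of 0] by (auto simp: W_def Pr_def)
    fix a b assume "a \<in> W" "b \<in> W"
    then obtain i j where "a \<in> B i" "b \<in> B j" by (auto simp: W_def)
    then have "a \<in> B (max i j)" "b \<in> B (max i j)" using Bmono[of i "max i j"] Bmono[of j "max i j"] by auto
    then show "a + b \<in> U" using B(1)[of "max i j"] by (simp add: Pr_def)
  qed
qed

text \<open>
  Near a point of \<open>L\<close> this is the \<open>k\<^sub>\<omega>\<close>-property of \<open>L\<close>, as \<open>\<C>\<close> contains the images of the sets in \<open>\<K>\<close>;
  all other points are isolated.
\<close>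

lemma k_open_preimage:
  assumes U: "k_open U" and z: "z \<in> topspace X" and U0: "0 \<in> U"
  shows "\<exists>V. openin X V \<and> z \<in> V \<and> (\<forall>y\<in>V. frag_of y - frag_of z \<in> U)"
proof (cases "z \<in> L")
  case False
  then show ?thesis using iso[of z] z U0 by (intro exI[of _ "{z}"]) simp
next
  case True
  let ?W = "(\<lambda>h. - (- frag_of z) + h) ` U"
  have W: "k_open ?W" using True by (intro k_open_translation U frags_uminus) simp
  let ?V = "{y \<in> L. frag_of y \<in> ?W}"
  have "closedin (subtopology X L) (L - ?V)"
  proof (rule KF)
    fix K assume K: "K \<in> \<K>"
    have "closedin P (frag_of ` K - ?W)" using W C_K[OF K] by (simp add: k_open_def)
    then have "closedin X {y \<in> topspace X. frag_of y \<in> frag_of ` K - ?W}"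
      by (rule closedin_continuous_map_preimage[OF continuous_frag_of])
    moreover have "{y \<in> topspace X. frag_of y \<in> frag_of ` K - ?W} = (L - ?V) \<inter> K"
      using KL[OF K] LX by (auto simp: frag_of_eq)
    ultimately show "closedin X ((L - ?V) \<inter> K)" by simp
  qed blast
  moreover have "topspace (subtopology X L) = L" using LX by auto
  ultimately have "openin (subtopology X L) (L - (L - ?V))"
    using openin_diff[OF openin_topspace, of "subtopology X L" "L - ?V"] by simp
  moreover have "L - (L - ?V) = ?V" by blast
  ultimately have "openin X ?V" using openin_trans_full[OF _ Lo] by simp
  moreover have "z \<in> ?V"
  proof -
    have "- (- frag_of z) + 0 \<in> ?W" using U0 by (rule imageI)
    then show ?thesis using True by simp
  qed
  moreover have "frag_of y - frag_of z \<in> U" if y: "y \<in> ?V" for y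
  proof -
    obtain u where "u \<in> U" "frag_of y = frag_of z + u" using y by auto
    then show ?thesis by simp
  qed
  ultimately show ?thesis by blast
qed

text \<open>
  Translate to zero and halve repeatedly; the resulting sets satisfy the hypotheses of \<open>PA_nhd_of_zero\<close>.
\<close>

lemma k_open_imp_open:
  assumes U: "k_open U"
  shows "openin P U"
proof (subst openin_subopen, intro ballI)
  fix g assume g: "g \<in> U"
  have gA: "g \<in> A" using g U by (auto simp: k_open_def)
  let ?U = "(\<lambda>h. - g + h) ` U"
  have U0: "k_open ?U" "0 \<in> ?U"
    using k_open_translation[OF U gA] g by (auto intro: image_eqI[of _ _ g])
  have "\<exists>W. \<forall>n. (k_open (W n) \<and> 0 \<in> W n \<and> W n \<subseteq> ?U) \<and> (\<forall>a\<in>W (Suc n). \<forall>b\<in>W (Suc n). a + b \<in> W n)"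
  proof (rule dependent_nat_choice)
    show "\<exists>W. k_open W \<and> 0 \<in> W \<and> W \<subseteq> ?U" using U0 by blast
    fix W and n :: nat assume W: "k_open W \<and> 0 \<in> W \<and> W \<subseteq> ?U"
    then obtain W' where W': "k_open W'" "0 \<in> W'" "\<And>a b. a \<in> W' \<Longrightarrow> b \<in> W' \<Longrightarrow> a + b \<in> W"
      using k_open_halve by metis
    then have "W' \<subseteq> W" by fastforce
    then show "\<exists>W'. (k_open W' \<and> 0 \<in> W' \<and> W' \<subseteq> ?U) \<and> (\<forall>a\<in>W'. \<forall>b\<in>W'. a + b \<in> W)"
      using W W' by (intro exI[of _ W']) auto
  qed
  then obtain W where W: "\<And>n. k_open (W n)" "\<And>n. 0 \<in> W n" "\<And>n. W n \<subseteq> ?U"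
      "\<And>n a b. a \<in> W (Suc n) \<Longrightarrow> b \<in> W (Suc n) \<Longrightarrow> a + b \<in> W n" by blast
  obtain O' where O': "openin P O'" "0 \<in> O'" "O' \<subseteq> W 0"
  proof (rule PA_nhd_of_zero[of W X])
    show "W n \<subseteq> {g. keys g \<subseteq> topspace X}" for n using W(1)[of n] AP by (auto simp: k_open_def)
    show "\<exists>V. openin X V \<and> z \<in> V \<and> (\<forall>y\<in>V. frag_of y - frag_of z \<in> W n)" if "z \<in> topspace X" for n z
      by (rule k_open_preimage[OF W(1) that W(2)])
  qed (use W in auto)
  have "openin P ((\<lambda>h. g + h) ` O')" by (rule openin_PA_translation[OF keysA[OF gA] O'(1)])
  moreover have "g \<in> (\<lambda>h. g + h) ` O'" using O'(2) by (intro image_eqI[of _ _ 0]) auto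
  moreover have "(\<lambda>h. g + h) ` O' \<subseteq> U"
  proof (rule image_subsetI)
    fix h assume "h \<in> O'"
    then have "h \<in> ?U" using O'(3) W(3) by blast
    then obtain u where "u \<in> U" "h = - g + u" by blast
    then show "g + h \<in> U" by simp
  qed
  ultimately show "\<exists>T. openin P T \<and> g \<in> T \<and> T \<subseteq> U" by blast
qed

lemma A_open: "openin P A"
proof (rule k_open_imp_open)
  show "k_open A"
    unfolding k_open_def
  proof (intro conjI ballI)
    fix C assume "C \<in> \<C>"
    then have "C - A = {}" using C_A by blast
    then show "closedin P (C - A)" by (simp only: closedin_empty)
  qed simp
qed

lemma A_k_omega: "k_omega_space (subtopology P A)"
  unfolding k_omega_space_def
proof (intro exI[of _ \<C>] conjI allI impI ballI iffI)
  show "countable \<C>" by (rule C_countable)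
  show "compactin (subtopology P A) C" if "C \<in> \<C>" for C
    using C_compact[OF that] C_A[OF that] by (simp add: compactin_subtopology)
  have tA: "topspace (subtopology P A) = A" using AP by auto
  show "\<Union>\<C> = topspace (subtopology P A)"
    unfolding tA using C_A C_single by blast
  fix F assume F: "F \<subseteq> topspace (subtopology P A)"
  show "closedin (subtopology (subtopology P A) C) (F \<inter> C)" if "closedin (subtopology P A) F" for C
    using that by (auto simp: closedin_subtopology)
  assume cl: "\<forall>C\<in>\<C>. closedin (subtopology (subtopology P A) C) (F \<inter> C)"
  have "k_open (A - F)"
    unfolding k_open_def
  proof (intro conjI ballI)
    fix C assume C: "C \<in> \<C>"
    have "subtopology (subtopology P A) C = subtopology P C"
      using C_A[OF C] by (simp add: subtopology_subtopology Int_absorb1)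
    then have "closedin (subtopology P C) (F \<inter> C)" using cl C by metis
    then have "closedin P (F \<inter> C)" using C_closed[OF C] by (rule closedin_trans_full)
    moreover have "C - (A - F) = F \<inter> C" using C_A[OF C] by blast
    ultimately show "closedin P (C - (A - F))" by simp
  qed blast
  then have "openin P (A - F)" by (rule k_open_imp_open)
  then have "openin (subtopology P A) (A - F)" by (simp add: openin_open_subtopology[OF A_open])
  then show "closedin (subtopology P A) F" using F unfolding closedin_def tA by blast
qed

text \<open>
  The subgroup \<open>A\<close> is open and the isolated points generate an algebraic complement, which meets each coset of
  \<open>A\<close> in one point.
\<close>

lemma PA_homeomorphic_product:
  "homeomorphic_map (prod_topology (subtopology P A) (discrete_topology (frags (topspace X - L)))) P
     (\<lambda>(h, d). h + d)"
proof (rule bijective_open_imp_homeomorphic_map)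
  let ?D = "frags (topspace X - L)"
  let ?Y = "prod_topology (subtopology P A) (discrete_topology ?D)"
  have tA: "topspace (subtopology P A) = A" using AP by auto
  have tP: "topspace P = frags (topspace X)" by (simp add: frags_def)
  have DP: "?D \<subseteq> topspace P" unfolding tP by (rule frags_mono) blast
  have "continuous_map (discrete_topology ?D) P (\<lambda>d. d)" using DP by auto
  from continuous_map_compose[OF continuous_map_snd this, of "subtopology P A"]
  have 1: "continuous_map ?Y P snd" by (simp add: o_def)
  have "continuous_map (subtopology P A) P (\<lambda>h. h)" by (intro continuous_map_from_subtopology) simp
  from continuous_map_compose[OF continuous_map_fst this, of "discrete_topology ?D"]
  have 2: "continuous_map ?Y P fst" by (simp add: o_def)
  show "continuous_map ?Y P (\<lambda>(h, d). h + d)"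
    using continuous_map_PA_add[OF 2 1] by (simp add: case_prod_unfold)
  have LL: "L \<union> (topspace X - L) = topspace X" using LX by blast
  show "(\<lambda>(h, d). h + d) ` topspace ?Y = topspace P"
  proof (intro equalityI subsetI)
    fix g assume "g \<in> (\<lambda>(h, d). h + d) ` topspace ?Y"
    then obtain h d where "h \<in> A" "d \<in> ?D" "g = h + d" using tA by auto
    then show "g \<in> topspace P" using AP DP frags_add unfolding tP by blast
  next
    fix g assume "g \<in> topspace P"
    then have "g \<in> frags (L \<union> (topspace X - L))" by (simp only: LL tP)
    then obtain h d where "h \<in> A" "d \<in> ?D" "g = h + d" using frags_split by blast
    then show "g \<in> (\<lambda>(h, d). h + d) ` topspace ?Y" using tA by (intro image_eqI[of _ _ "(h, d)"]) auto
  qed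
  show "inj_on (\<lambda>(h, d). h + d) (topspace ?Y)"
  proof (rule inj_onI)
    fix p q assume "p \<in> topspace ?Y" "q \<in> topspace ?Y" and eq: "(case p of (h, d) \<Rightarrow> h + d) = (case q of (h, d) \<Rightarrow> h + d)"
    then obtain h d h' d' where p: "p = (h, d)" "q = (h', d')" "h \<in> A" "h' \<in> A" "d \<in> ?D" "d' \<in> ?D"
      using tA by auto
    have "h - h' = d' - d" using eq p(1,2) by (simp add: algebra_simps)
    then have "h - h' \<in> A" "h - h' \<in> ?D" using frags_diff p by metis+
    then have "h - h' = 0" by (intro frags_disjoint[of L "topspace X - L"]) auto
    then show "p = q" using p eq by simp
  qed
  show "open_map ?Y P (\<lambda>(h, d). h + d)"
    unfolding open_map_def
  proof (intro allI impI)
    fix U assume U: "openin ?Y U"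
    show "openin P ((\<lambda>(h, d). h + d) ` U)"
    proof (subst openin_subopen, intro ballI)
      fix g assume "g \<in> (\<lambda>(h, d). h + d) ` U"
      then obtain h d where hd: "(h, d) \<in> U" "g = h + d" by auto
      then obtain V W where V: "openin (subtopology P A) V" "openin (discrete_topology ?D) W" "h \<in> V" "d \<in> W" "V \<times> W \<subseteq> U"
        using openin_prod_topology_alt[THEN iffD1, rule_format, OF U hd(1)] by blast
      have "openin P V" using V(1) A_open by (rule openin_trans_full)
      moreover have "d \<in> ?D" using V(2,4) by auto
      then have "keys d \<subseteq> topspace X" by (auto simp: frags_def)
      ultimately have "openin P ((\<lambda>h. d + h) ` V)" by (intro openin_PA_translation)
      moreover have "g \<in> (\<lambda>h. d + h) ` V" using V(3) hd(2) by (intro image_eqI[of _ _ h]) (auto simp: add.commute)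
      moreover have "(\<lambda>h. d + h) ` V \<subseteq> (\<lambda>(h, d). h + d) ` U"
      proof (rule image_subsetI)
        fix v assume "v \<in> V"
        then have "(v, d) \<in> U" using V(4,5) by blast
        then show "d + v \<in> (\<lambda>(h, d). h + d) ` U" by (rule rev_image_eqI) (simp add: add.commute)
      qed
      ultimately show "\<exists>T. openin P T \<and> g \<in> T \<and> T \<subseteq> (\<lambda>(h, d). h + d) ` U" by blast
    qed
  qed
qed

end

section \<open>Transport along homeomorphisms\<close>

lemma k_omega_homeomorphic:
  assumes f: "homeomorphic_map Y Z f" and Y: "k_omega_space Y"
  shows "k_omega_space Z"
proof -
  obtain \<K> where K: "countable \<K>" "\<forall>K\<in>\<K>. compactin Y K" "\<Union>\<K> = topspace Y"
    and F: "\<And>F. F \<subseteq> topspace Y \<Longrightarrow> closedin Y F \<longleftrightarrow> (\<forall>K\<in>\<K>. closedin (subtopology Y K) (F \<inter> K))"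
    using Y unfolding k_omega_space_def by blast
  have fc: "continuous_map Y Z f" and fs: "f ` topspace Y = topspace Z" and fi: "inj_on f (topspace Y)"
    using f by (auto simp: homeomorphic_eq_everything_map)
  have KY: "K \<subseteq> topspace Y" if "K \<in> \<K>" for K using K(3) that by blast
  show ?thesis
    unfolding k_omega_space_def
  proof (intro exI[of _ "(\<lambda>K. f ` K) ` \<K>"] conjI allI impI)
    show "countable ((\<lambda>K. f ` K) ` \<K>)" using K(1) by simp
    show "\<forall>K\<in>(\<lambda>K. f ` K) ` \<K>. compactin Z K" using K(2) image_compactin[OF _ fc] by blast
    show "\<Union>((\<lambda>K. f ` K) ` \<K>) = topspace Z"
      unfolding image_Union[symmetric] K(3) by (rule fs)
    fix G assume G: "G \<subseteq> topspace Z"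
    define F0 where "F0 = {y \<in> topspace Y. f y \<in> G}"
    have F0: "F0 \<subseteq> topspace Y" "f ` F0 = G" using G fs by (auto simp: F0_def)
    have loc: "closedin (subtopology Z (f ` K)) (G \<inter> f ` K) \<longleftrightarrow> closedin (subtopology Y K) (F0 \<inter> K)"
      if "K \<in> \<K>" for K
    proof -
      have h: "homeomorphic_map (subtopology Y K) (subtopology Z (f ` K)) f"
      proof (rule homeomorphic_map_subtopologies[OF f])
        show "f ` (topspace Y \<inter> K) = topspace Z \<inter> f ` K"
          unfolding fs[symmetric] using KY[OF that] by (simp add: Int_absorb1 image_mono)
      qed
      have "f ` (F0 \<inter> K) = G \<inter> f ` K" using KY[OF that] by (auto simp: F0_def)
      then show ?thesis
        using homeomorphic_map_closedness[OF h, of "F0 \<inter> K"] F0(1) by auto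
    qed
    have "closedin Z G \<longleftrightarrow> closedin Y F0"
      using homeomorphic_map_closedness[OF f F0(1)] F0(2) by simp
    also have "\<dots> \<longleftrightarrow> (\<forall>K\<in>\<K>. closedin (subtopology Y K) (F0 \<inter> K))" by (rule F[OF F0(1)])
    also have "\<dots> \<longleftrightarrow> (\<forall>K\<in>(\<lambda>K. f ` K) ` \<K>. closedin (subtopology Z K) (G \<inter> K))"
      using loc by simp
    finally show "closedin Z G \<longleftrightarrow> (\<forall>K\<in>(\<lambda>K. f ` K) ` \<K>. closedin (subtopology Z K) (G \<inter> K))" .
  qed
qed

lemma compact_finite_family_image:
  assumes \<xi>: "continuous_map T P \<xi>" "\<And>x. x \<in> topspace P \<Longrightarrow> \<xi> (\<psi> x) = x"
    and F: "compact_finite_family P I F" "\<And>i. i \<in> I \<Longrightarrow> F i \<subseteq> topspace P"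
  shows "compact_finite_family T I (\<lambda>i. \<psi> ` F i)"
  unfolding compact_finite_family_def
proof (intro allI impI)
  fix K assume "compactin T K"
  then have "compactin P (\<xi> ` K)" using \<xi>(1) by (rule image_compactin)
  then have "finite {i \<in> I. F i \<inter> \<xi> ` K \<noteq> {}}" using F(1) by (simp add: compact_finite_family_def)
  moreover have "{i \<in> I. \<psi> ` F i \<inter> K \<noteq> {}} \<subseteq> {i \<in> I. F i \<inter> \<xi> ` K \<noteq> {}}"
  proof
    fix i assume "i \<in> {i \<in> I. \<psi> ` F i \<inter> K \<noteq> {}}"
    then obtain x where x: "i \<in> I" "x \<in> F i" "\<psi> x \<in> K" by blast
    have "\<xi> (\<psi> x) = x" using F(2)[OF x(1)] x(2) \<xi>(2) by blast
    then have "x \<in> \<xi> ` K" using x(3) by (intro image_eqI[of _ _ "\<psi> x"]) simp_all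
    then show "i \<in> {i \<in> I. F i \<inter> \<xi> ` K \<noteq> {}}" using x by blast
  qed
  ultimately show "finite {i \<in> I. \<psi> ` F i \<inter> K \<noteq> {}}" by (rule finite_subset[rotated])
qed

lemma Fin_fan_image:
  assumes h: "homeomorphic_maps P T \<psi> \<xi>" and F: "Fin_fan P I F"
  shows "Fin_fan T I (\<lambda>i. \<psi> ` F i)"
proof -
  have \<psi>: "continuous_map P T \<psi>" and \<xi>: "continuous_map T P \<xi>" "\<And>x. x \<in> topspace P \<Longrightarrow> \<xi> (\<psi> x) = x"
    using h by (auto simp: homeomorphic_maps_def)
  have F': "\<And>i. i \<in> I \<Longrightarrow> finite (F i) \<and> F i \<subseteq> topspace P" "compact_finite_family P I F"
    "\<not> locally_finite_family P I F" using F by (auto simp: Fin_fan_def)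
  have "\<not> locally_finite_family T I (\<lambda>i. \<psi> ` F i)"
  proof
    assume lf: "locally_finite_family T I (\<lambda>i. \<psi> ` F i)"
    have "locally_finite_family P I F"
      unfolding locally_finite_family_def
    proof
      fix x assume x: "x \<in> topspace P"
      then have "\<psi> x \<in> topspace T" using \<psi> by (rule continuous_map_image_subset_topspace[THEN subsetD, OF _ imageI, rotated])
      then obtain V where V: "openin T V" "\<psi> x \<in> V" "finite {i \<in> I. \<psi> ` F i \<inter> V \<noteq> {}}"
        using lf unfolding locally_finite_family_def by blast
      let ?V = "{y \<in> topspace P. \<psi> y \<in> V}"
      have "openin P ?V" by (rule openin_continuous_map_preimage[OF \<psi> V(1)])
      moreover have "{i \<in> I. F i \<inter> ?V \<noteq> {}} \<subseteq> {i \<in> I. \<psi> ` F i \<inter> V \<noteq> {}}" by blast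
      then have "finite {i \<in> I. F i \<inter> ?V \<noteq> {}}" using V(3) by (rule finite_subset)
      ultimately show "\<exists>U. openin P U \<and> x \<in> U \<and> finite {i \<in> I. F i \<inter> U \<noteq> {}}"
        using x V(2) by (intro exI[of _ ?V]) simp
    qed
    then show False using F'(3) by blast
  qed
  moreover have "compact_finite_family T I (\<lambda>i. \<psi> ` F i)"
    using F' by (intro compact_finite_family_image[OF \<xi>]) auto
  moreover have "\<psi> ` F i \<subseteq> topspace T" if "i \<in> I" for i
    using continuous_map_image_subset_topspace[OF \<psi>] F'(1)[OF that] by blast
  ultimately show ?thesis using F'(1) by (simp add: Fin_fan_def)
qed

lemma strong_Fin_fan_image:
  assumes h: "homeomorphic_maps P T \<psi> \<xi>" and F: "strong_Fin_fan P I F"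
  shows "strong_Fin_fan T I (\<lambda>i. \<psi> ` F i)"
proof -
  have \<psi>: "continuous_map P T \<psi>" and \<xi>: "continuous_map T P \<xi>" "\<And>x. x \<in> topspace P \<Longrightarrow> \<xi> (\<psi> x) = x"
      "\<And>y. y \<in> topspace T \<Longrightarrow> \<psi> (\<xi> y) = y"
    using h by (auto simp: homeomorphic_maps_def)
  have F1: "Fin_fan P I F" using F by (simp add: strong_Fin_fan_def)
  obtain U where U: "\<And>i. i \<in> I \<Longrightarrow> R_open P (U i) \<and> F i \<subseteq> U i" "compact_finite_family P I U"
    using F unfolding strong_Fin_fan_def by blast
  have UP: "U i \<subseteq> topspace P" if "i \<in> I" for i using U(1)[OF that] by (simp add: R_open_def)
  have "R_open T (\<psi> ` U i)" if i: "i \<in> I" for i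
    unfolding R_open_def
  proof (intro conjI ballI)
    show "\<psi> ` U i \<subseteq> topspace T"
      using continuous_map_image_subset_topspace[OF \<psi>] UP[OF i] by blast
    fix y assume "y \<in> \<psi> ` U i"
    then obtain x where x: "x \<in> U i" "y = \<psi> x" by blast
    then obtain f where f: "continuous_map P (top_of_set {0..1::real}) f" "f x = 1" "f ` (topspace P - U i) \<subseteq> {0}"
      using U(1)[OF i] unfolding R_open_def by blast
    have "continuous_map T (top_of_set {0..1::real}) (f \<circ> \<xi>)"
      using \<xi>(1) f(1) by (rule continuous_map_compose)
    moreover have "(f \<circ> \<xi>) y = 1" using x UP[OF i] \<xi>(2) f(2) by auto
    moreover have "(f \<circ> \<xi>) ` (topspace T - \<psi> ` U i) \<subseteq> {0}"
    proof (rule image_subsetI)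
      fix z assume z: "z \<in> topspace T - \<psi> ` U i"
      then have "\<xi> z \<in> topspace P" using continuous_map_image_subset_topspace[OF \<xi>(1)] by blast
      moreover have "\<xi> z \<notin> U i"
      proof
        assume "\<xi> z \<in> U i"
        then have "\<psi> (\<xi> z) \<in> \<psi> ` U i" by (rule imageI)
        then show False using z \<xi>(3) by simp
      qed
      ultimately show "(f \<circ> \<xi>) z \<in> {0}" using f(3) by auto
    qed
    ultimately show "\<exists>f. continuous_map T (top_of_set {0..1::real}) f \<and> f y = 1 \<and> f ` (topspace T - \<psi> ` U i) \<subseteq> {0}"
      by blast
  qed
  moreover have "\<psi> ` F i \<subseteq> \<psi> ` U i" if "i \<in> I" for i using U(1)[OF that] by blast
  moreover have "compact_finite_family T I (\<lambda>i. \<psi> ` U i)"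
    by (rule compact_finite_family_image[OF \<xi>(1,2) U(2) UP])
  ultimately show ?thesis
    unfolding strong_Fin_fan_def using Fin_fan_image[OF h F1] by (intro conjI exI[of _ "\<lambda>i. \<psi> ` U i"]) auto
qed

text \<open>
  The two extensions of the canonical maps are mutually inverse by uniqueness on either side.
\<close>

lemma free_paratop_Abelian_group_homeomorphic:
  fixes X :: "'a topology" and G :: "'g monoid"
  assumes free: "free_paratop_Abelian_group X G T \<delta>"
  obtains \<psi> \<phi> where "homeomorphic_maps (PA_topology X) T \<psi> \<phi>"
proof -
  have free1: "free_paratop_Abelian_group_wrt TYPE('g) X G T \<delta>"
    and free2: "free_paratop_Abelian_group_wrt TYPE('a \<Rightarrow>\<^sub>0 int) X G T \<delta>"
    using free by (auto simp: free_paratop_Abelian_group_def)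
  have GT: "paratop_Abelian_group G T" and d: "continuous_map X T \<delta>"
    using free1 by (auto simp: free_paratop_Abelian_group_wrt_def)
  then have tT: "topspace T = carrier G" by (simp add: paratop_Abelian_group_def)
  let ?P = "PA_group X" and ?S = "PA_topology X"
  obtain \<phi> where \<phi>: "\<phi> \<in> hom G ?P" "continuous_map T ?S \<phi>"
      "\<And>x. x \<in> topspace X \<Longrightarrow> \<phi> (\<delta> x) = frag_of x"
    using free_wrtD[OF free2 paratop_PA continuous_frag_of] by metis
  obtain \<psi> where \<psi>: "\<psi> \<in> hom ?P G" "continuous_map ?S T \<psi>"
      "\<And>x. x \<in> topspace X \<Longrightarrow> \<psi> (frag_of x) = \<delta> x"
    using free_wrtD[OF PA_universal GT d] by metis
  have 1: "\<psi> (\<phi> y) = y" if "y \<in> carrier G" for y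
  proof -
    have "(\<psi> \<circ> \<phi>) y = id y"
    proof (rule free_wrt_unique[OF free1 GT _ _ _ _ _ that])
      show "\<psi> \<circ> \<phi> \<in> hom G G" using \<phi>(1) \<psi>(1) by (rule hom_compose)
      show "continuous_map T T (\<psi> \<circ> \<phi>)" using \<phi>(2) \<psi>(2) by (rule continuous_map_compose)
      show "id \<in> hom G G" by (simp add: hom_def)
    qed (use \<phi>(3) \<psi>(3) in simp_all)
    then show ?thesis by simp
  qed
  have 2: "\<phi> (\<psi> y) = y" if "y \<in> carrier ?P" for y
  proof -
    have "(\<phi> \<circ> \<psi>) y = id y"
    proof (rule hom_PA_unique[OF comm_group_PA _ _ _ that])
      show "\<phi> \<circ> \<psi> \<in> hom ?P ?P" using \<psi>(1) \<phi>(1) by (rule hom_compose)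
      show "id \<in> hom ?P ?P" by (simp add: hom_def)
    qed (use \<phi>(3) \<psi>(3) in simp_all)
    then show ?thesis by simp
  qed
  have "homeomorphic_maps ?S T \<psi> \<phi>"
    unfolding homeomorphic_maps_def topspace_PA_topology tT using 1 2 \<phi>(2) \<psi>(2) by blast
  then show thesis by (rule that)
qed

section \<open>Topological sums, networks and k-spaces\<close>

text \<open>
  The summands can be taken inside \<open>X\<close>, where the constructions of both directions take place.
\<close>

lemma sum_decomposition_iff:
  fixes X :: "'a topology"
  shows "(\<exists>(K :: 'a topology) (D :: 'a set). k_omega_space K \<and> countable (topspace K) \<and>
      X homeomorphic_space sum_topology (case_bool K (discrete_topology D)) UNIV) \<longleftrightarrow>
    (\<exists>L. openin X L \<and> closedin X L \<and> countable L \<and> (\<forall>x\<in>topspace X - L. openin X {x}) \<and>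
      k_omega_space (subtopology X L))" (is "?l \<longleftrightarrow> ?r")
proof
  assume ?l
  then obtain K :: "'a topology" and D :: "'a set" where K: "k_omega_space K" "countable (topspace K)"
    and "X homeomorphic_space sum_topology (case_bool K (discrete_topology D)) UNIV" by blast
  moreover define S where "S = sum_topology (case_bool K (discrete_topology D)) UNIV"
  ultimately obtain f g where fg: "homeomorphic_maps X S f g" by (auto simp: homeomorphic_space_def)
  have f: "continuous_map X S f" and g: "continuous_map S X g"
    and gf: "\<And>x. x \<in> topspace X \<Longrightarrow> g (f x) = x" and fg': "\<And>y. y \<in> topspace S \<Longrightarrow> f (g y) = y"
    using fg by (auto simp: homeomorphic_maps_def)
  have hf: "homeomorphic_map X S f" using fg by (rule homeomorphic_maps_imp_map)
  have tS: "topspace S = Pair True ` topspace K \<union> Pair False ` D"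
    by (auto simp: S_def split: bool.splits)
  have open1: "openin S (Pair True ` topspace K)" and open2: "openin S (Pair False ` E)" if "E \<subseteq> D" for E
    using that unfolding S_def openin_sum_topology by (auto split: bool.split simp: image_iff)
  define L where "L = {x \<in> topspace X. f x \<in> Pair True ` topspace K}"
  have fX: "f x \<in> topspace S" if "x \<in> topspace X" for x
    using continuous_map_image_subset_topspace[OF f] that by blast
  have oL: "openin X L" unfolding L_def by (rule openin_continuous_map_preimage[OF f open1[of "{}"]]) simp
  have "topspace X - L = {x \<in> topspace X. f x \<in> Pair False ` D}"
    using fX tS by (auto simp: L_def)
  then have "openin X (topspace X - L)"
    using openin_continuous_map_preimage[OF f open2[OF order_refl]] by simp
  then have cL: "closedin X L" using oL by (simp add: closedin_def openin_subset)
  have inj: "inj_on f (topspace X)" using gf by (rule inj_on_inverseI)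
  have "inj_on f L" by (rule inj_on_subset[OF inj]) (auto simp: L_def)
  moreover have "countable (f ` L)"
    by (rule countable_subset[of _ "Pair True ` topspace K"]) (use K(2) in \<open>auto simp: L_def\<close>)
  ultimately have "countable L" by (rule countable_image_inj_on[rotated])
  moreover have "openin X {x}" if x: "x \<in> topspace X - L" for x
  proof -
    have "f x \<in> Pair False ` D" using x fX[of x] tS by (auto simp: L_def)
    then obtain d where d: "d \<in> D" "f x = (False, d)" by blast
    have "openin S {f x}" using open2[of "{d}"] d by simp
    then have "openin X {y \<in> topspace X. f y \<in> {f x}}" by (rule openin_continuous_map_preimage[OF f])
    moreover have "{y \<in> topspace X. f y \<in> {f x}} = {x}" using x inj by (auto simp: inj_on_def)
    ultimately show ?thesis by simp
  qed
  moreover have "k_omega_space (subtopology X L)"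
  proof -
    have "embedding_map K S (Pair True)"
      using embedding_map_component_injection[of True UNIV "case_bool K (discrete_topology D)"] by (simp add: S_def)
    then have "homeomorphic_map K (subtopology S (Pair True ` topspace K)) (Pair True)"
      by (simp add: embedding_map_def)
    then have k: "k_omega_space (subtopology S (Pair True ` topspace K))" using K(1) by (rule k_omega_homeomorphic)
    have hg: "homeomorphic_map S X g" using fg homeomorphic_maps_sym homeomorphic_maps_imp_map by blast
    have "g ` (topspace S \<inter> Pair True ` topspace K) = topspace X \<inter> L"
    proof (intro equalityI subsetI)
      fix x assume "x \<in> g ` (topspace S \<inter> Pair True ` topspace K)"
      then obtain y where y: "y \<in> topspace S" "y \<in> Pair True ` topspace K" "x = g y" by blast
      then have "x \<in> topspace X" using continuous_map_image_subset_topspace[OF g] by blast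
      then show "x \<in> topspace X \<inter> L" using y fg'[of y] by (simp add: L_def)
    next
      fix x assume "x \<in> topspace X \<inter> L"
      then show "x \<in> g ` (topspace S \<inter> Pair True ` topspace K)"
        using gf[of x] fX[of x] by (intro image_eqI[of _ _ "f x"]) (auto simp: L_def)
    qed
    then have "homeomorphic_map (subtopology S (Pair True ` topspace K)) (subtopology X L) g"
      by (rule homeomorphic_map_subtopologies[OF hg])
    then show ?thesis using k by (rule k_omega_homeomorphic)
  qed
  ultimately show ?r using oL cL by blast
next
  assume ?r
  then obtain L where L: "openin X L" "closedin X L" "countable L" "\<And>x. x \<in> topspace X - L \<Longrightarrow> openin X {x}"
    "k_omega_space (subtopology X L)" by blast
  have LX: "L \<subseteq> topspace X" by (rule openin_subset[OF L(1)])
  let ?K = "subtopology X L" and ?D = "topspace X - L"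
  let ?S = "sum_topology (case_bool ?K (discrete_topology ?D)) UNIV"
  have tK: "topspace ?K = L" using LX by auto
  have oS: "openin ?S U \<longleftrightarrow> openin X {x. (True, x) \<in> U} \<and> {x. (True, x) \<in> U} \<subseteq> L \<and> {x. (False, x) \<in> U} \<subseteq> ?D" for U
  proof -
    have "openin ?S U \<longleftrightarrow> U \<subseteq> Sigma UNIV (topspace \<circ> case_bool ?K (discrete_topology ?D)) \<and>
       openin ?K {x. (True, x) \<in> U} \<and> {x. (False, x) \<in> U} \<subseteq> ?D"
      by (simp add: openin_sum_topology all_bool_eq)
    also have "\<dots> \<longleftrightarrow> openin ?K {x. (True, x) \<in> U} \<and> {x. (False, x) \<in> U} \<subseteq> ?D"
    proof -
      have "U \<subseteq> Sigma UNIV (topspace \<circ> case_bool ?K (discrete_topology ?D))"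
        if o: "openin ?K {x. (True, x) \<in> U}" and D: "{x. (False, x) \<in> U} \<subseteq> ?D"
      proof
        fix p assume p: "p \<in> U"
        obtain b x where bx: "p = (b, x)" by (cases p)
        show "p \<in> Sigma UNIV (topspace \<circ> case_bool ?K (discrete_topology ?D))"
          using p bx openin_subset[OF o] D by (cases b) auto
      qed
      then show ?thesis by blast
    qed
    finally show ?thesis by (simp add: openin_open_subtopology[OF L(1)])
  qed
  have od: "openin X A" if "A \<subseteq> ?D" for A
  proof -
    have "openin X (\<Union>x\<in>A. {x})" using that L(4) by blast
    then show ?thesis by simp
  qed
  let ?f = "\<lambda>x. (x \<in> L, x)"
  have "homeomorphic_map X ?S ?f"
  proof (rule bijective_open_imp_homeomorphic_map)
    have tS: "topspace ?S = ?f ` topspace X"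
      using LX by (auto split: bool.splits simp: tK)
    then show "?f ` topspace X = topspace ?S" by simp
    show "inj_on ?f (topspace X)" by (auto simp: inj_on_def)
    show "continuous_map X ?S ?f"
      unfolding continuous_map_def
    proof (intro conjI allI impI)
      show "?f \<in> topspace X \<rightarrow> topspace ?S" using tS by blast
      fix U assume "openin ?S U"
      then have U: "openin X {x. (True, x) \<in> U}" "{x. (True, x) \<in> U} \<subseteq> L" "{x. (False, x) \<in> U} \<subseteq> ?D"
        by (simp_all add: oS)
      have "{x \<in> topspace X. ?f x \<in> U} = {x. (True, x) \<in> U} \<union> {x. (False, x) \<in> U}"
      proof (intro equalityI subsetI)
        fix x assume "x \<in> {x \<in> topspace X. ?f x \<in> U}"
        then show "x \<in> {x. (True, x) \<in> U} \<union> {x. (False, x) \<in> U}" by (cases "x \<in> L") auto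
      next
        fix x assume "x \<in> {x. (True, x) \<in> U} \<union> {x. (False, x) \<in> U}"
        then show "x \<in> {x \<in> topspace X. ?f x \<in> U}" using U(2,3) LX by auto
      qed
      then show "openin X {x \<in> topspace X. ?f x \<in> U}"
        using openin_Un[OF U(1) od[OF U(3)]] by simp
    qed
    show "open_map X ?S ?f"
      unfolding open_map_def
    proof (intro allI impI)
      fix U assume U: "openin X U"
      have "{x. (True, x) \<in> ?f ` U} = U \<inter> L" "{x. (False, x) \<in> ?f ` U} = U - L" by auto
      then show "openin ?S (?f ` U)"
        unfolding oS using openin_Int[OF U L(1)] openin_subset[OF U] by auto
    qed
  qed
  then have "X homeomorphic_space ?S" by (rule homeomorphic_map_imp_homeomorphic_space)
  then show ?l using L(3,5) tK by (intro exI[of _ ?K] exI[of _ ?D]) simp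
qed

text \<open>
  Otherwise choose \<open>x n \<in> C\<close> outside the \<open>n\<close>-th partial union. Every subset of this infinite sequence has
  finite traces on the members of \<open>\<K>\<close> and hence is closed, so the sequence has no accumulation point in \<open>C\<close>.
\<close>

lemma compact_in_k_omega:
  assumes Y: "Hausdorff_space Y" and K: "countable \<K>" "\<Union>\<K> = topspace Y"
    and F: "\<And>F. F \<subseteq> topspace Y \<Longrightarrow> (\<forall>K\<in>\<K>. closedin (subtopology Y K) (F \<inter> K)) \<Longrightarrow> closedin Y F"
    and C: "compactin Y C"
  shows "\<exists>n. C \<subseteq> \<Union>(from_nat_into (insert {} \<K>) ` {..n})"
proof (rule ccontr)
  define E where "E = from_nat_into (insert {} \<K>)"
  define Kn where "Kn n = \<Union>(E ` {..n})" for n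
  assume "\<not> ?thesis"
  then have "\<forall>n. \<exists>x. x \<in> C \<and> x \<notin> Kn n" unfolding Kn_def E_def by blast
  from choice[OF this] obtain x where x: "\<forall>n. x n \<in> C \<and> x n \<notin> Kn n" by (rule exE)
  have CY: "C \<subseteq> topspace Y" by (rule compactin_subset_topspace[OF C])
  have Esurj: "\<exists>m. E m = A" if "A \<in> \<K>" for A
    using from_nat_into_surj[of "insert {} \<K>" A] that K(1) by (auto simp: E_def)
  have xm: "n < m" if "x n \<in> E m" for n m
  proof (rule ccontr)
    assume "\<not> n < m"
    then have "x n \<in> Kn n" using that by (auto simp: Kn_def)
    then show False using x by blast
  qed
  have cl: "closedin Y S" if S: "S \<subseteq> range x" for S
  proof (rule F)
    show "S \<subseteq> topspace Y" using S x CY by blast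
    show "\<forall>K\<in>\<K>. closedin (subtopology Y K) (S \<inter> K)"
    proof
      fix A assume A: "A \<in> \<K>"
      obtain m where m: "E m = A" using Esurj[OF A] by blast
      have "S \<inter> A \<subseteq> x ` {..<m}" using S xm m by auto
      then have "finite (S \<inter> A)" by (rule finite_subset) simp
      moreover have "S \<inter> A \<subseteq> topspace Y" using S x CY by blast
      ultimately have "closedin Y (S \<inter> A)"
        using Y Hausdorff_imp_t1_space unfolding t1_space_closedin_finite by blast
      then have "closedin (subtopology Y A) (A \<inter> (S \<inter> A))" by (rule closedin_subtopology_Int_closed)
      moreover have "A \<inter> (S \<inter> A) = S \<inter> A" by blast
      ultimately show "closedin (subtopology Y A) (S \<inter> A)" by simp
    qed
  qed
  have "infinite (range x)"
  proof
    assume fin: "finite (range x)"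
    have "\<forall>y\<in>range x. \<exists>m. y \<in> E m"
    proof
      fix y assume "y \<in> range x"
      then have "y \<in> \<Union>\<K>" using x CY K(2) by blast
      then obtain A where A: "A \<in> \<K>" "y \<in> A" by blast
      then show "\<exists>m. y \<in> E m" using Esurj[OF A(1)] by blast
    qed
    from bchoice[OF this] obtain m where m: "\<forall>y\<in>range x. y \<in> E (m y)" by (rule exE)
    let ?n = "Max (m ` range x)"
    have "x ?n \<in> E (m (x ?n))" using m by blast
    then have "?n < m (x ?n)" by (rule xm)
    moreover have "m (x ?n) \<le> ?n" using fin by (intro Max_ge) auto
    ultimately show False by simp
  qed
  moreover have "range x \<subseteq> C" using x by blast
  ultimately obtain p where p: "p \<in> Y derived_set_of (range x)"
    using compactin_imp_Bolzano_Weierstrass[OF C, of "range x"] by blast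
  have "openin Y (topspace Y - (range x - {p}))" using cl[of "range x - {p}"] by blast
  moreover have "p \<in> topspace Y - (range x - {p})" using p unfolding in_derived_set_of by blast
  ultimately have "\<exists>y\<noteq>p. y \<in> range x \<and> y \<in> topspace Y - (range x - {p})"
    using p[unfolded in_derived_set_of, THEN conjunct2, rule_format, of "topspace Y - (range x - {p})"] by simp
  then show False by blast
qed

text \<open>
  Fix disjoint neighbourhoods \<open>A x y\<close> of \<open>x\<close> and \<open>B x y\<close> of \<open>y\<close> for all distinct \<open>x\<close>, \<open>y\<close>. The network consists of
  the traces on the compact sets \<open>Kn n\<close> of finite intersections of sets \<open>A x y\<close> with fixed \<open>x\<close>. If \<open>x\<close> lies in an open set \<open>U\<close>,
  finitely many \<open>B x y\<close> cover \<open>Kn n - U\<close>, and the corresponding trace is contained in \<open>U\<close>.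
\<close>

lemma countable_k_omega_network:
  assumes Y: "Hausdorff_space Y" "k_omega_space Y" and cY: "countable (topspace Y)"
  obtains \<N> where "k_network Y \<N>" "countable \<N>"
proof -
  obtain \<K> where K: "countable \<K>" "\<forall>K\<in>\<K>. compactin Y K" "\<Union>\<K> = topspace Y"
    and F: "\<And>F. F \<subseteq> topspace Y \<Longrightarrow> closedin Y F \<longleftrightarrow> (\<forall>K\<in>\<K>. closedin (subtopology Y K) (F \<inter> K))"
    using Y(2) unfolding k_omega_space_def by blast
  define E where "E = from_nat_into (insert {} \<K>)"
  define Kn where "Kn n = \<Union>(E ` {..n})" for n
  have EK: "E n \<in> insert {} \<K>" for n unfolding E_def by (rule from_nat_into) simp
  have Ec: "compactin Y (E n)" for n using EK[of n] K(2) by auto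
  have Knc: "compactin Y (Kn n)" for n unfolding Kn_def using Ec by (intro compactin_Union) auto
  have KnY: "Kn n \<subseteq> topspace Y" for n by (rule compactin_subset_topspace[OF Knc])
  have Kcov: "\<exists>n. C \<subseteq> Kn n" if "compactin Y C" for C
    using compact_in_k_omega[OF Y(1) K(1,3) _ that] F unfolding Kn_def E_def by blast
  have "\<forall>p\<in>{(x, y). x \<in> topspace Y \<and> y \<in> topspace Y \<and> x \<noteq> y}. \<exists>q. openin Y (fst q) \<and> openin Y (snd q) \<and>
      fst p \<in> fst q \<and> snd p \<in> snd q \<and> disjnt (fst q) (snd q)"
  proof
    fix p assume "p \<in> {(x, y). x \<in> topspace Y \<and> y \<in> topspace Y \<and> x \<noteq> y}"
    then have "fst p \<in> topspace Y \<and> snd p \<in> topspace Y \<and> fst p \<noteq> snd p" by auto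
    then obtain U V where "openin Y U" "openin Y V" "fst p \<in> U" "snd p \<in> V" "disjnt U V"
      using Y(1) unfolding Hausdorff_space_def by metis
    then show "\<exists>q. openin Y (fst q) \<and> openin Y (snd q) \<and> fst p \<in> fst q \<and> snd p \<in> snd q \<and> disjnt (fst q) (snd q)"
      by (intro exI[of _ "(U, V)"]) simp
  qed
  from bchoice[OF this] obtain q where
    q: "\<forall>p\<in>{(x, y). x \<in> topspace Y \<and> y \<in> topspace Y \<and> x \<noteq> y}. openin Y (fst (q p)) \<and> openin Y (snd (q p)) \<and>
      fst p \<in> fst (q p) \<and> snd p \<in> snd (q p) \<and> disjnt (fst (q p)) (snd (q p))" by (rule exE)
  define A where "A x y = fst (q (x, y))" for x y
  define B where "B x y = snd (q (x, y))" for x y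
  have AB: "openin Y (A x y)" "openin Y (B x y)" "x \<in> A x y" "y \<in> B x y" "disjnt (A x y) (B x y)"
    if "x \<in> topspace Y" "y \<in> topspace Y" "x \<noteq> y" for x y
    using q[rule_format, of "(x, y)"] that by (simp_all add: A_def B_def)
  define N where "N = (\<lambda>(n, x, S). Kn n \<inter> \<Inter>(A x ` S))"
  define \<N> where "\<N> = N ` (UNIV \<times> topspace Y \<times> {S. finite S \<and> S \<subseteq> topspace Y})"
  have "countable \<N>"
    unfolding \<N>_def using cY by (intro countable_image countable_SIGMA countable_Collect_finite_subset) auto
  moreover have "k_network Y \<N>"
    unfolding k_network_def
  proof (intro conjI ballI allI impI)
    show "M \<subseteq> topspace Y" if "M \<in> \<N>" for M using that KnY by (auto simp: \<N>_def N_def)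
    fix U C assume "openin Y U \<and> compactin Y C \<and> C \<subseteq> U"
    then have U: "openin Y U" and C: "compactin Y C" and CU: "C \<subseteq> U" by auto
    have CY: "C \<subseteq> topspace Y" by (rule compactin_subset_topspace[OF C])
    obtain n where n: "C \<subseteq> Kn n" using Kcov[OF C] by blast
    have KU: "compactin Y (Kn n - U)" by (rule compactin_Diff_open[OF Knc U])
    have "\<forall>x\<in>C. \<exists>S. finite S \<and> S \<subseteq> Kn n - U \<and> Kn n \<inter> \<Inter>(A x ` S) \<subseteq> U"
    proof
      fix x assume x: "x \<in> C"
      have xy: "x \<in> topspace Y" "y \<in> topspace Y" "x \<noteq> y" if "y \<in> Kn n - U" for y
        using that x CU CY KnY by blast+
      have "openin Y (B x y) \<and> y \<in> B x y" if "y \<in> Kn n - U" for y using AB(2,4)[OF xy[OF that]] ..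
      from compactin_pointwise_cover[OF KU this]
      obtain S where S: "S \<subseteq> Kn n - U" "finite S" "Kn n - U \<subseteq> \<Union>(B x ` S)" by blast
      have "Kn n \<inter> \<Inter>(A x ` S) \<subseteq> U"
      proof
        fix y assume y: "y \<in> Kn n \<inter> \<Inter>(A x ` S)"
        show "y \<in> U"
        proof (rule ccontr)
          assume "y \<notin> U"
          then obtain s where s: "s \<in> S" "y \<in> B x s" using y S(3) by blast
          have "y \<in> A x s" using y s(1) by blast
          then show False using AB(5)[OF xy, of s] s S(1) by (auto simp: disjnt_def)
        qed
      qed
      then show "\<exists>S. finite S \<and> S \<subseteq> Kn n - U \<and> Kn n \<inter> \<Inter>(A x ` S) \<subseteq> U" using S by blast
    qed
    from bchoice[OF this] obtain S where
      S: "\<forall>x\<in>C. finite (S x) \<and> S x \<subseteq> Kn n - U \<and> Kn n \<inter> \<Inter>(A x ` S x) \<subseteq> U" by (rule exE)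
    define O' where "O' x = \<Inter>(A x ` S x) \<inter> topspace Y" for x
    have O': "openin Y (O' x)" "x \<in> O' x" if x: "x \<in> C" for x
    proof -
      have xy: "x \<in> topspace Y" "y \<in> topspace Y" "x \<noteq> y" if "y \<in> S x" for y
        using that x CU CY KnY S by blast+
      show "openin Y (O' x)" unfolding O'_def using S x AB(1)[OF xy] by (intro openin_INT) auto
      show "x \<in> O' x" unfolding O'_def using AB(3)[OF xy] x CY by blast
    qed
    have "openin Y (O' x) \<and> x \<in> O' x" if "x \<in> C" for x using O'[OF that] ..
    from compactin_pointwise_cover[OF C this]
    obtain D where D: "D \<subseteq> C" "finite D" "C \<subseteq> \<Union>(O' ` D)" by blast
    let ?F = "(\<lambda>x. N (n, x, S x)) ` D"
    have "?F \<subseteq> \<N>"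
    proof (rule image_subsetI)
      fix x assume "x \<in> D"
      then have x: "x \<in> C" using D(1) by blast
      then have "finite (S x)" "S x \<subseteq> Kn n - U" using S by simp_all
      moreover from this(2) have "S x \<subseteq> topspace Y" using KnY[of n] by blast
      ultimately show "N (n, x, S x) \<in> \<N>" unfolding \<N>_def using x CY by (intro imageI) auto
    qed
    moreover have "C \<subseteq> \<Union>?F"
    proof
      fix c assume c: "c \<in> C"
      then obtain x where "x \<in> D" "c \<in> O' x" using D(3) by blast
      then show "c \<in> \<Union>?F" using c n by (intro UN_I[of x]) (auto simp: N_def O'_def)
    qed
    moreover have "\<Union>?F \<subseteq> U"
    proof (rule UN_least)
      fix x assume "x \<in> D"
      then have "x \<in> C" using D(1) by blast
      then show "N (n, x, S x) \<subseteq> U" using S by (simp add: N_def)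
    qed
    ultimately show "\<exists>\<F>. finite \<F> \<and> \<F> \<subseteq> \<N> \<and> C \<subseteq> \<Union>\<F> \<and> \<Union>\<F> \<subseteq> U"
      using D(2) by (intro exI[of _ ?F]) simp
  qed
  ultimately show thesis using that by blast
qed

text \<open>
  A compact set meets finitely many slices, and each slice is handled separately.
\<close>

lemma network_prod_discrete:
  assumes N: "k_network Y \<N>" "countable \<N>"
  shows "\<exists>\<M>. k_network (prod_topology Y (discrete_topology D)) \<M> \<and>
    compact_countable (prod_topology Y (discrete_topology D)) \<M>"
proof -
  let ?Z = "prod_topology Y (discrete_topology D)"
  define \<M> where "\<M> = (\<lambda>(N, d). N \<times> {d}) ` (\<N> \<times> D)"
  have sndC: "finite (snd ` C)" "snd ` C \<subseteq> D" if "compactin ?Z C" for C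
    using image_compactin[OF that continuous_map_snd] by (auto simp: compactin_discrete_topology)
  have "k_network ?Z \<M>"
    unfolding k_network_def
  proof (intro conjI ballI allI impI)
    fix M assume "M \<in> \<M>"
    then obtain N d where "N \<in> \<N>" "d \<in> D" "M = N \<times> {d}" by (auto simp: \<M>_def)
    moreover have "N \<subseteq> topspace Y" if "N \<in> \<N>" for N using N(1) that by (simp add: k_network_def)
    ultimately show "M \<subseteq> topspace ?Z" by auto
  next
    fix U C assume "openin ?Z U \<and> compactin ?Z C \<and> C \<subseteq> U"
    then have U: "openin ?Z U" and C: "compactin ?Z C" and CU: "C \<subseteq> U" by auto
    have "\<forall>d\<in>snd ` C. \<exists>F. finite F \<and> F \<subseteq> \<N> \<and> {x. (x, d) \<in> C} \<subseteq> \<Union>F \<and> \<Union>F \<subseteq> {x. (x, d) \<in> U}"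
    proof
      fix d assume d: "d \<in> snd ` C"
      then have dD: "d \<in> D" using sndC(2)[OF C] by blast
      have "continuous_map Y ?Z (\<lambda>x. (x, d))" using dD by (simp add: continuous_map_pairwise o_def)
      then have oU: "openin Y {x \<in> topspace Y. (x, d) \<in> U}" using U by (rule openin_continuous_map_preimage)
      have "closedin ?Z (topspace Y \<times> {d})" using dD by (simp add: closedin_prod_Times_iff)
      then have "compactin ?Z ((topspace Y \<times> {d}) \<inter> C)" using C by (rule closed_Int_compactin)
      then have "compactin Y (fst ` ((topspace Y \<times> {d}) \<inter> C))" using continuous_map_fst by (rule image_compactin)
      moreover have "fst ` ((topspace Y \<times> {d}) \<inter> C) = {x. (x, d) \<in> C}"
        using compactin_subset_topspace[OF C] by force
      ultimately have cC: "compactin Y {x. (x, d) \<in> C}" by simp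
      have "{x. (x, d) \<in> C} \<subseteq> {x \<in> topspace Y. (x, d) \<in> U}"
        using CU compactin_subset_topspace[OF C] by auto
      from k_networkD[OF N(1) oU cC this] obtain F where
        "finite F" "F \<subseteq> \<N>" "{x. (x, d) \<in> C} \<subseteq> \<Union>F" "\<Union>F \<subseteq> {x \<in> topspace Y. (x, d) \<in> U}" by (elim exE conjE)
      then show "\<exists>F. finite F \<and> F \<subseteq> \<N> \<and> {x. (x, d) \<in> C} \<subseteq> \<Union>F \<and> \<Union>F \<subseteq> {x. (x, d) \<in> U}"
        by (intro exI[of _ F]) auto
    qed
    from bchoice[OF this] obtain F where
      F: "\<forall>d\<in>snd ` C. finite (F d) \<and> F d \<subseteq> \<N> \<and> {x. (x, d) \<in> C} \<subseteq> \<Union>(F d) \<and> \<Union>(F d) \<subseteq> {x. (x, d) \<in> U}" by (rule exE)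
    let ?I = "SIGMA d:snd ` C. F d"
    let ?F = "(\<lambda>(d, N). N \<times> {d}) ` ?I"
    have fF: "finite (F d)" if "d \<in> snd ` C" for d using bspec[OF F that] by (rule conjunct1)
    have "finite ?F" by (intro finite_imageI finite_SigmaI sndC(1)[OF C] fF)
    moreover have "?F \<subseteq> \<M>"
    proof (rule image_subsetI)
      fix p assume "p \<in> ?I"
      then obtain d N where p: "p = (d, N)" "d \<in> snd ` C" "N \<in> F d" by blast
      then have "(N, d) \<in> \<N> \<times> D" using F sndC(2)[OF C] by blast
      then show "(case p of (d, N) \<Rightarrow> N \<times> {d}) \<in> \<M>" unfolding \<M>_def p(1) by (rule rev_image_eqI) simp
    qed
    moreover have "C \<subseteq> \<Union>?F"
    proof
      fix c assume c: "c \<in> C"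
      obtain x d where cd: "c = (x, d)" by (cases c)
      have d: "d \<in> snd ` C" using c cd by (intro image_eqI[of _ _ c]) simp_all
      then obtain N where N: "N \<in> F d" "x \<in> N" using F c cd by blast
      then show "c \<in> \<Union>?F" using d cd by (intro UN_I[of "(d, N)"]) auto
    qed
    moreover have "\<Union>?F \<subseteq> U"
    proof
      fix c assume "c \<in> \<Union>?F"
      then obtain d N where "d \<in> snd ` C" "N \<in> F d" "c \<in> N \<times> {d}" by auto
      moreover obtain x e where "c = (x, e)" by (cases c)
      ultimately show "c \<in> U" using F by blast
    qed
    ultimately show "\<exists>\<F>. finite \<F> \<and> \<F> \<subseteq> \<M> \<and> C \<subseteq> \<Union>\<F> \<and> \<Union>\<F> \<subseteq> U"
      by (intro exI[of _ ?F]) simp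
  qed
  moreover have "compact_countable ?Z \<M>"
    unfolding compact_countable_def
  proof (intro allI impI)
    fix C assume C: "compactin ?Z C"
    have "{M \<in> \<M>. M \<inter> C \<noteq> {}} \<subseteq> (\<lambda>(N, d). N \<times> {d}) ` (\<N> \<times> snd ` C)"
    proof
      fix M assume "M \<in> {M \<in> \<M>. M \<inter> C \<noteq> {}}"
      then obtain N d c where M: "N \<in> \<N>" "M = N \<times> {d}" "c \<in> N \<times> {d}" "c \<in> C" by (auto simp: \<M>_def)
      then have "d \<in> snd ` C" by (intro image_eqI[of _ _ c]) auto
      then show "M \<in> (\<lambda>(N, d). N \<times> {d}) ` (\<N> \<times> snd ` C)" using M by (intro image_eqI[of _ _ "(N, d)"]) auto
    qed
    moreover have "countable ((\<lambda>(N, d). N \<times> {d}) ` (\<N> \<times> snd ` C))"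
      by (intro countable_image countable_SIGMA N(2) countable_finite[OF sndC(1)[OF C]])
    ultimately show "countable {M \<in> \<M>. M \<inter> C \<noteq> {}}" by (rule countable_subset)
  qed
  ultimately show ?thesis by blast
qed

text \<open>
  The hypothesis \<open>ext\<close> holds for embeddings; it asks for the extension of an open set only up to a compact set.
\<close>

lemma network_pullback:
  assumes \<iota>: "continuous_map X Y \<iota>"
    and ext: "\<And>U K. openin X U \<Longrightarrow> compactin X K \<Longrightarrow> K \<subseteq> U \<Longrightarrow>
       \<exists>O'. openin Y O' \<and> \<iota> ` K \<subseteq> O' \<and> {x \<in> topspace X. \<iota> x \<in> O'} \<subseteq> U"
    and N: "k_network Y \<N>" "compact_countable Y \<N>"
  shows "\<exists>\<M>. k_network X \<M> \<and> compact_countable X \<M>"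
proof -
  let ?p = "\<lambda>N. {x \<in> topspace X. \<iota> x \<in> N}"
  have "k_network X (?p ` \<N>)"
    unfolding k_network_def
  proof (intro conjI ballI allI impI)
    show "M \<subseteq> topspace X" if "M \<in> ?p ` \<N>" for M using that by blast
    fix U K assume "openin X U \<and> compactin X K \<and> K \<subseteq> U"
    then have U: "openin X U" "compactin X K" "K \<subseteq> U" by auto
    have KX: "K \<subseteq> topspace X" by (rule compactin_subset_topspace[OF U(2)])
    obtain O' where O': "openin Y O'" "\<iota> ` K \<subseteq> O'" "?p O' \<subseteq> U" using ext[OF U] by blast
    from k_networkD[OF N(1) O'(1) image_compactin[OF U(2) \<iota>] O'(2)]
    obtain F where F: "finite F" "F \<subseteq> \<N>" "\<iota> ` K \<subseteq> \<Union>F" "\<Union>F \<subseteq> O'" by (elim exE conjE)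
    have "K \<subseteq> \<Union>(?p ` F)"
    proof
      fix x assume x: "x \<in> K"
      then obtain N where "N \<in> F" "\<iota> x \<in> N" using F(3) by blast
      then show "x \<in> \<Union>(?p ` F)" using x KX by blast
    qed
    moreover have "\<Union>(?p ` F) \<subseteq> U" using F(4) O'(3) by blast
    ultimately show "\<exists>\<F>. finite \<F> \<and> \<F> \<subseteq> ?p ` \<N> \<and> K \<subseteq> \<Union>\<F> \<and> \<Union>\<F> \<subseteq> U"
      using F(1,2) by (intro exI[of _ "?p ` F"] conjI finite_imageI image_mono)
  qed
  moreover have "compact_countable X (?p ` \<N>)"
    unfolding compact_countable_def
  proof (intro allI impI)
    fix K assume "compactin X K"
    then have "compactin Y (\<iota> ` K)" using \<iota> by (rule image_compactin)
    then have "countable {N \<in> \<N>. N \<inter> \<iota> ` K \<noteq> {}}" using N(2) by (simp add: compact_countable_def)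
    then have "countable (?p ` {N \<in> \<N>. N \<inter> \<iota> ` K \<noteq> {}})" by (rule countable_image)
    moreover have "{M \<in> ?p ` \<N>. M \<inter> K \<noteq> {}} \<subseteq> ?p ` {N \<in> \<N>. N \<inter> \<iota> ` K \<noteq> {}}" by blast
    ultimately show "countable {M \<in> ?p ` \<N>. M \<inter> K \<noteq> {}}" by (rule countable_subset[rotated])
  qed
  ultimately show ?thesis by blast
qed

lemma k_omega_imp_k_space:
  assumes "k_omega_space Y"
  shows "k_space Y"
proof -
  obtain \<K> where K: "\<forall>K\<in>\<K>. compactin Y K"
    and F: "\<And>F. F \<subseteq> topspace Y \<Longrightarrow> closedin Y F \<longleftrightarrow> (\<forall>K\<in>\<K>. closedin (subtopology Y K) (F \<inter> K))"
    using assms unfolding k_omega_space_def by blast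
  show ?thesis
    unfolding k_space_def
  proof (intro allI impI iffI)
    fix S K assume "closedin Y S"
    then show "closedin (subtopology Y K) (K \<inter> S)" by (rule closedin_subtopology_Int_closed)
  next
    fix S assume S: "S \<subseteq> topspace Y" "\<forall>K. compactin Y K \<longrightarrow> closedin (subtopology Y K) (K \<inter> S)"
    then show "closedin Y S" using K F[OF S(1)] by (metis Int_commute)
  qed
qed

text \<open>
  The union of those \<open>F i\<close> that omit a point \<open>y\<close> has finite traces on compact sets, so it is closed and its
  complement is a neighbourhood of \<open>y\<close> meeting only the \<open>F i\<close> that contain \<open>y\<close>.
\<close>

lemma k_space_no_fan:
  assumes T: "k_space T" "t1_space T"
  shows "\<not> Fin_fan T I F"
proof
  assume F: "Fin_fan T I F"
  have cf: "\<And>K. compactin T K \<Longrightarrow> finite {i \<in> I. F i \<inter> K \<noteq> {}}"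
    and fin: "\<And>i. i \<in> I \<Longrightarrow> finite (F i)" "\<And>i. i \<in> I \<Longrightarrow> F i \<subseteq> topspace T"
    using F by (auto simp: Fin_fan_def compact_finite_family_def)
  have "locally_finite_family T I F"
    unfolding locally_finite_family_def
  proof
    fix y assume y: "y \<in> topspace T"
    define S where "S = (\<Union>i\<in>{i \<in> I. y \<notin> F i}. F i)"
    have ST: "S \<subseteq> topspace T" using fin(2) by (auto simp: S_def)
    have "closedin (subtopology T K) (K \<inter> S)" if K: "compactin T K" for K
    proof -
      have "K \<inter> S \<subseteq> (\<Union>i\<in>{i \<in> I. F i \<inter> K \<noteq> {}}. F i)" by (auto simp: S_def)
      then have "finite (K \<inter> S)" using cf[OF K] fin(1) by (rule finite_subset[OF _ finite_UN_I]) auto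
      moreover have "K \<inter> S \<subseteq> topspace T" using ST by blast
      ultimately have "closedin T (K \<inter> S)" using T(2) unfolding t1_space_closedin_finite by blast
      then have "closedin (subtopology T K) (K \<inter> (K \<inter> S))" by (rule closedin_subtopology_Int_closed)
      then show ?thesis by simp
    qed
    then have "closedin T S" using T(1) ST unfolding k_space_def by blast
    then have o: "openin T (topspace T - S)" by blast
    have yS: "y \<in> topspace T - S" using y by (auto simp: S_def)
    have "{i \<in> I. F i \<inter> (topspace T - S) \<noteq> {}} \<subseteq> {i \<in> I. F i \<inter> {y} \<noteq> {}}"
      by (auto simp: S_def)
    moreover have "finite {i \<in> I. F i \<inter> {y} \<noteq> {}}" using y by (intro cf) simp
    ultimately have "finite {i \<in> I. F i \<inter> (topspace T - S) \<noteq> {}}" by (rule finite_subset)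
    then show "\<exists>U. openin T U \<and> y \<in> U \<and> finite {i \<in> I. F i \<inter> U \<noteq> {}}" using o yS by blast
  qed
  then show False using F by (simp add: Fin_fan_def)
qed

section \<open>The equivalence\<close>

text \<open>
  The space \<open>X\<close> is embedded in its free group: a compact \<open>K \<subseteq> U\<close> is covered by the open sets on which the
  extension of a function supported in \<open>U\<close> exceeds \<open>1/2\<close>. So the network of the product pulls back to \<open>X\<close>.
\<close>

lemma PA_product_imp_aleph_k:
  fixes Y :: "'b topology" and D :: "'c set"
  assumes X: "Tychonoff_space X" and Y: "k_omega_space Y" "countable (topspace Y)"
    and h: "homeomorphic_map (PA_topology X) (prod_topology Y (discrete_topology D)) h"
  shows "aleph_k_space X"
proof -
  let ?P = "PA_topology X" and ?Z = "prod_topology Y (discrete_topology D)"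
  have hc: "continuous_map ?P ?Z h" and hi: "inj_on h (topspace ?P)" and hs: "h ` topspace ?P = topspace ?Z"
    using h by (auto simp: homeomorphic_eq_everything_map)
  have "?P homeomorphic_space ?Z" using h by (rule homeomorphic_map_imp_homeomorphic_space)
  then have "Hausdorff_space ?Z" using Hausdorff_PA[OF X] homeomorphic_Hausdorff_space by blast
  moreover have "0 \<in> topspace ?P" by simp
  then have h0: "h 0 \<in> topspace ?Z" using hs by blast
  have "?Z \<noteq> trivial_topology"
  proof
    assume "?Z = trivial_topology"
    then have "topspace ?Z = topspace trivial_topology" by (rule arg_cong)
    then show False using h0 by (simp only: topspace_discrete_topology empty_iff)
  qed
  ultimately have "Hausdorff_space Y" by (meson Hausdorff_space_prod_topology)
  then obtain \<N> where "k_network Y \<N>" "countable \<N>"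
    using countable_k_omega_network Y by metis
  from network_prod_discrete[OF this, of D]
  obtain \<M> where M: "k_network ?Z \<M>" "compact_countable ?Z \<M>" by (elim exE conjE)
  have "\<exists>\<M>. k_network X \<M> \<and> compact_countable X \<M>"
  proof (rule network_pullback[OF _ _ M, of X "h \<circ> frag_of"])
    show "continuous_map X ?Z (h \<circ> frag_of)"
      by (rule continuous_map_compose[OF continuous_frag_of hc])
    fix U K assume U: "openin X U" and K: "compactin X K" "K \<subseteq> U"
    have "\<forall>x\<in>K. \<exists>f. continuous_map X euclideanreal f \<and> f x = 1 \<and> (\<forall>y. y \<notin> U \<longrightarrow> f y = 0)"
    proof
      fix x assume "x \<in> K"
      then have "x \<in> U" using K by blast
      then show "\<exists>f. continuous_map X euclideanreal f \<and> f x = 1 \<and> (\<forall>y. y \<notin> U \<longrightarrow> f y = 0)"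
        using Tychonoff_function[OF X U] by metis
    qed
    from bchoice[OF this] obtain f where
      f: "\<forall>x\<in>K. continuous_map X euclideanreal (f x) \<and> f x x = 1 \<and> (\<forall>y. y \<notin> U \<longrightarrow> f x y = 0)" by (rule exE)
    define V where "V x = {g \<in> topspace ?P. frag_eval (f x) g \<in> {1/2<..}}" for x
    have V: "openin ?P (V x)" if "x \<in> K" for x
      unfolding V_def using f that
      by (intro openin_continuous_map_preimage[OF continuous_map_frag_eval]) auto
    define W where "W = \<Union>(V ` K)"
    have W: "openin ?P W" unfolding W_def using V by (intro openin_Union) auto
    have WP: "W \<subseteq> topspace ?P" by (rule openin_subset[OF W])
    have KX: "K \<subseteq> topspace X" by (rule compactin_subset_topspace[OF K(1)])
    have "openin ?Z (h ` W)" using homeomorphic_map_openness[OF h WP] W by simp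
    moreover have "(h \<circ> frag_of) ` K \<subseteq> h ` W"
    proof (rule image_subsetI)
      fix x assume x: "x \<in> K"
      then have "frag_of x \<in> V x" using f KX by (auto simp: V_def)
      then have "frag_of x \<in> W" using x by (auto simp: W_def)
      then show "(h \<circ> frag_of) x \<in> h ` W" by simp
    qed
    moreover have "{x \<in> topspace X. (h \<circ> frag_of) x \<in> h ` W} \<subseteq> U"
    proof
      fix x assume "x \<in> {x \<in> topspace X. (h \<circ> frag_of) x \<in> h ` W}"
      then have x: "x \<in> topspace X" "h (frag_of x) \<in> h ` W" by auto
      then obtain w where w: "w \<in> W" "h (frag_of x) = h w" by blast
      have "frag_of x = w" using inj_onD[OF hi w(2)] x(1) w(1) WP by auto
      then obtain y where "y \<in> K" "frag_of x \<in> V y" using w(1) by (auto simp: W_def)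
      then show "x \<in> U" using f by (force simp: V_def)
    qed
    ultimately show "\<exists>O'. openin ?Z O' \<and> (h \<circ> frag_of) ` K \<subseteq> O' \<and> {x \<in> topspace X. (h \<circ> frag_of) x \<in> O'} \<subseteq> U"
      by (intro exI[of _ "h ` W"] conjI)
  qed
  then show ?thesis
    using X by (simp add: aleph_k_space_def Tychonoff_space_def completely_regular_imp_regular_space)
qed

lemma k_omega_sum_imp_PA_product:
  fixes X :: "'a topology"
  assumes X: "Tychonoff_space X" and L: "openin X L" "countable L"
    and iso: "\<And>x. x \<in> topspace X - L \<Longrightarrow> openin X {x}" and k: "k_omega_space (subtopology X L)"
  obtains A D h where "k_omega_space (subtopology (PA_topology X) A)" "countable A" "A \<subseteq> topspace (PA_topology X)"
    "D \<subseteq> topspace (PA_topology X)"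
    "homeomorphic_map (prod_topology (subtopology (PA_topology X) A) (discrete_topology D)) (PA_topology X) h"
proof -
  have LX: "L \<subseteq> topspace X" by (rule openin_subset[OF L(1)])
  have tL: "topspace (subtopology X L) = L" using LX by auto
  obtain \<K> where K: "countable \<K>" "\<forall>K\<in>\<K>. compactin (subtopology X L) K" "\<Union>\<K> = topspace (subtopology X L)"
    and F: "\<And>F. F \<subseteq> topspace (subtopology X L) \<Longrightarrow> closedin (subtopology X L) F \<longleftrightarrow>
      (\<forall>K\<in>\<K>. closedin (subtopology (subtopology X L) K) (F \<inter> K))"
    using k unfolding k_omega_space_def by blast
  interpret clopen_k_omega X L \<K>
  proof
    show "compactin X K \<and> K \<subseteq> L" if "K \<in> \<K>" for K
      using bspec[OF K(2) that] by (simp add: compactin_subtopology)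
    show "closedin (subtopology X L) F" if F': "F \<subseteq> L" "\<And>K. K \<in> \<K> \<Longrightarrow> closedin X (F \<inter> K)" for F
    proof -
      have "closedin (subtopology (subtopology X L) K) (F \<inter> K)" if "K \<in> \<K>" for K
      proof -
        have "closedin (subtopology (subtopology X L) K) (K \<inter> (L \<inter> (F \<inter> K)))"
          by (intro closedin_subtopology_Int_closed F'(2) that)
        moreover have "K \<inter> (L \<inter> (F \<inter> K)) = F \<inter> K" using F'(1) by blast
        ultimately show ?thesis by simp
      qed
      then show ?thesis using F[of F] F'(1) tL by blast
    qed
    show "\<Union>\<K> = L" using K(3) tL by simp
  qed (fact X L iso K(1))+
  have "frags (topspace X - L) \<subseteq> topspace (PA_topology X)" by (auto simp: frags_def)
  then show thesis
    using that[OF A_k_omega countable_frags[OF L(2)] AP _ PA_homeomorphic_product] by blast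
qed

text \<open>
  A space without non-isolated points is the case of an empty \<open>L\<close>; otherwise a nontrivial convergent
  sequence is available for the strong fan.
\<close>

lemma no_fans_imp_k_omega_sum:
  assumes X: "Tychonoff_space X" "kR_space X" "mu_complete X"
    and N: "k_network X \<N>" "compact_countable X \<N>"
    and no_strong: "\<nexists>F. strong_Fin_fan (PA_topology X) (UNIV :: nat set) F"
    and no_fan: "\<nexists>F. Fin_fan (PA_topology X) omega1 F"
  shows "\<exists>L. openin X L \<and> closedin X L \<and> countable L \<and> (\<forall>x\<in>topspace X - L. openin X {x}) \<and>
      k_omega_space (subtopology X L)"
proof (cases "{x \<in> topspace X. \<not> openin X {x}} = {}")
  case True
  have "k_omega_space (subtopology X {})"
    unfolding k_omega_space_def by (intro exI[of _ "{}"]) auto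
  then show ?thesis using True by (intro exI[of _ "{}"]) auto
next
  case False
  have H: "Hausdorff_space X" by (rule Tychonoff_imp_Hausdorff[OF X(1)])
  have t1: "t1_space X" using X(1) by (simp add: Tychonoff_space_def)
  have reg: "regular_space X"
    using X(1) by (simp add: Tychonoff_space_def completely_regular_imp_regular_space)
  obtain y where y: "y \<in> topspace X" "\<not> openin X {y}" using False by blast
  obtain C where C: "compactin X C" "y \<in> C" "y \<in> X closure_of (C - {y})"
    using nonisolated_in_compact[OF X(2) t1 y] by blast
  obtain s where s: "range s \<subseteq> C - {y}" "limitin X s y sequentially"
    using k_network_sequence[OF N reg H C order_refl] .
  have sX: "range s \<subseteq> topspace X - {y}" using s(1) compactin_subset_topspace[OF C(1)] by blast
  have cov: "\<exists>F. finite F \<and> F \<subseteq> {N \<in> \<N>. compactin X (X closure_of N)} \<and> K \<subseteq> \<Union>F" if K: "compactin X K" for K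
    using noncompact_network_imp_strong_fan[OF X(1,3) N s(2) sX K] no_strong by blast
  have cX': "countable {x \<in> topspace X. \<not> openin X {x}}"
    using uncountable_nonisolated_imp_fan[OF X(1,2) N] no_fan by blast
  show ?thesis
  proof (rule no_fan_imp_clopen_countable[OF X N cX' cov no_fan])
    fix L \<K>
    assume L: "openin X L" "closedin X L" "countable L" "{x \<in> topspace X. \<not> openin X {x}} \<subseteq> L"
      "countable \<K>" "\<And>K. K \<in> \<K> \<Longrightarrow> compactin X K" "\<Union>\<K> = L"
      "\<And>C. compactin X C \<Longrightarrow> C \<subseteq> L \<Longrightarrow> \<exists>\<F>. finite \<F> \<and> \<F> \<subseteq> \<K> \<and> C \<subseteq> \<Union>\<F>"
    have "k_omega_space (subtopology X L)" by (rule clopen_kR_imp_k_omega[OF X(1,2) L(1,2,5-8)])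
    moreover have "\<forall>x\<in>topspace X - L. openin X {x}" using L(4) by blast
    ultimately show ?thesis using L(1-3) by blast
  qed
qed

theorem theorem1p18:
  fixes X :: "'a topology" and PA :: "'g monoid" and T :: "'g topology" and \<delta> :: "'a \<Rightarrow> 'g"
  assumes "Tychonoff_space X" and "kR_space X" and "mu_complete X"
    and "free_paratop_Abelian_group X PA T \<delta>"
  shows
    "let
       cond1 = (\<exists>(K :: 'a topology) (D :: 'a set).
         k_omega_space K \<and> countable (topspace K) \<and>
         X homeomorphic_space sum_topology (case_bool K (discrete_topology D)) UNIV);
       cond2 = (\<exists>(K :: 'g topology) (D :: 'g set).
         k_omega_space K \<and> countable (topspace K) \<and>
         T homeomorphic_space prod_topology K (discrete_topology D));
       cond3 = (aleph_k_space X \<and>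
         \<not> (\<exists>F. strong_Fin_fan T (UNIV :: nat set) F) \<and>
         \<not> (\<exists>F. Fin_fan T omega1 F));
       cond4 = (aleph_k_space X \<and> k_space T)
     in (cond1 \<longleftrightarrow> cond2) \<and> (cond2 \<longleftrightarrow> cond3) \<and> (cond3 \<longleftrightarrow> cond4)"
proof -
  let ?P = "PA_topology X"
  obtain \<psi> \<phi> where maps: "homeomorphic_maps ?P T \<psi> \<phi>"
    using free_paratop_Abelian_group_homeomorphic[OF assms(4)] .
  have \<psi>: "homeomorphic_map ?P T \<psi>" using maps by (rule homeomorphic_maps_imp_map)
  have \<psi>c: "continuous_map ?P T \<psi>" and \<psi>i: "inj_on \<psi> (topspace ?P)" and \<psi>s: "\<psi> ` topspace ?P = topspace T"
    using \<psi> by (auto simp: homeomorphic_eq_everything_map)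
  have PT: "?P homeomorphic_space T" using \<psi> by (rule homeomorphic_map_imp_homeomorphic_space)
  have "Hausdorff_space T" using Hausdorff_PA[OF assms(1)] homeomorphic_Hausdorff_space[OF PT] by blast
  then have t1: "t1_space T" by (rule Hausdorff_imp_t1_space)
  define split where "split \<longleftrightarrow> (\<exists>L. openin X L \<and> closedin X L \<and> countable L \<and>
      (\<forall>x\<in>topspace X - L. openin X {x}) \<and> k_omega_space (subtopology X L))"
  define cond2 where "cond2 \<longleftrightarrow> (\<exists>(K :: 'g topology) (D :: 'g set).
         k_omega_space K \<and> countable (topspace K) \<and>
         T homeomorphic_space prod_topology K (discrete_topology D))"
  define cond3 where "cond3 \<longleftrightarrow> aleph_k_space X \<and>
         \<not> (\<exists>F. strong_Fin_fan T (UNIV :: nat set) F) \<and> \<not> (\<exists>F. Fin_fan T omega1 F)"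
  define cond4 where "cond4 \<longleftrightarrow> aleph_k_space X \<and> k_space T"
  have 12: cond2 if split
  proof -
    obtain L where L: "openin X L" "countable L" "\<And>x. x \<in> topspace X - L \<Longrightarrow> openin X {x}"
      "k_omega_space (subtopology X L)" using \<open>split\<close> unfolding split_def by blast
    obtain A D h where A: "k_omega_space (subtopology ?P A)" "countable A" "A \<subseteq> topspace ?P" "D \<subseteq> topspace ?P"
      and h: "homeomorphic_map (prod_topology (subtopology ?P A) (discrete_topology D)) ?P h"
      using k_omega_sum_imp_PA_product[OF assms(1) L] .
    let ?K = "subtopology T (\<psi> ` A)" and ?D = "\<psi> ` D"
    have AT: "\<psi> ` A \<subseteq> topspace T" using A(3) \<psi>s by blast
    have "\<psi> ` (topspace ?P \<inter> A) = topspace T \<inter> \<psi> ` A"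
      using A(3) AT by (simp add: Int_absorb1 del: topspace_PA)
    then have hK: "homeomorphic_map (subtopology ?P A) ?K \<psi>" by (rule homeomorphic_map_subtopologies[OF \<psi>])
    have hD: "homeomorphic_map (discrete_topology D) (discrete_topology ?D) \<psi>"
    proof (rule bijective_open_imp_homeomorphic_map)
      show "inj_on \<psi> (topspace (discrete_topology D))" using inj_on_subset[OF \<psi>i A(4)] by simp
    qed (auto simp: open_map_def)
    have "prod_topology (subtopology ?P A) (discrete_topology D) homeomorphic_space prod_topology ?K (discrete_topology ?D)"
      using hK hD by (intro homeomorphic_space_prod_topology homeomorphic_map_imp_homeomorphic_space)
    moreover have "prod_topology (subtopology ?P A) (discrete_topology D) homeomorphic_space ?P"
      using h by (rule homeomorphic_map_imp_homeomorphic_space)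
    ultimately have "T homeomorphic_space prod_topology ?K (discrete_topology ?D)"
      using PT by (meson homeomorphic_space_sym homeomorphic_space_trans)
    moreover have "k_omega_space ?K" by (rule k_omega_homeomorphic[OF hK A(1)])
    moreover have "countable (topspace ?K)" using A(2) by simp
    ultimately show cond2 unfolding cond2_def by blast
  qed
  have 24: cond4 if cond2
  proof -
    obtain K :: "'g topology" and D :: "'g set" where K: "k_omega_space K" "countable (topspace K)"
      and TK: "T homeomorphic_space prod_topology K (discrete_topology D)"
      using \<open>cond2\<close> unfolding cond2_def by blast
    have "?P homeomorphic_space prod_topology K (discrete_topology D)"
      using PT TK by (rule homeomorphic_space_trans)
    then obtain h where "homeomorphic_map ?P (prod_topology K (discrete_topology D)) h"
      unfolding homeomorphic_space by blast
    then have "aleph_k_space X" by (rule PA_product_imp_aleph_k[OF assms(1) K])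
    moreover have "k_space (prod_topology K (discrete_topology D))"
      by (intro k_space_prod_topology_right k_omega_imp_k_space K(1) locally_compact_space_discrete_topology) auto
    then have "k_space T" using homeomorphic_k_space[OF TK] by blast
    ultimately show cond4 by (simp add: cond4_def)
  qed
  have 43: cond3 if cond4
  proof -
    have k: "k_space T" and a: "aleph_k_space X" using \<open>cond4\<close> by (simp_all add: cond4_def)
    have "\<not> Fin_fan T (UNIV :: nat set) F" for F by (rule k_space_no_fan[OF k t1])
    moreover have "\<not> Fin_fan T omega1 F" for F by (rule k_space_no_fan[OF k t1])
    ultimately show cond3 using a by (simp add: cond3_def strong_Fin_fan_def)
  qed
  have 31: split if cond3
  proof -
    obtain \<N> where N: "k_network X \<N>" "compact_countable X \<N>"
      using \<open>cond3\<close> unfolding cond3_def aleph_k_space_def by blast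
    have "\<nexists>F. strong_Fin_fan ?P (UNIV :: nat set) F"
      using \<open>cond3\<close> strong_Fin_fan_image[OF maps] unfolding cond3_def by blast
    moreover have "\<nexists>F. Fin_fan ?P omega1 F"
      using \<open>cond3\<close> Fin_fan_image[OF maps] unfolding cond3_def by blast
    ultimately show split unfolding split_def by (rule no_fans_imp_k_omega_sum[OF assms(1-3) N])
  qed
  show ?thesis
    unfolding Let_def sum_decomposition_iff split_def[symmetric] cond2_def[symmetric]
      cond3_def[symmetric] cond4_def[symmetric]
    using 12 24 43 31 by blast
qed

end
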